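(* There exists a constant $C>0$ such that for every real $q\ge 1$, every $p\in[2,\infty]$, every $d\in\mathbb{N}$ and every $f\in\ell^p(\mathbb{Z}^d)$ we have $$\Big\| \sup_{t\in\mathbb{D},\ t\le d^{1/q}} |\mathcal{M}_t^{B^q} f| \Big\|_{\ell^p(\mathbb{Z}^d)} \le C\,\|f\|_{\ell^p(\mathbb{Z}^d)}.$$
   Context: $\mathbb{N}=\{1,2,\dots\}$, $\mathbb{N}_0=\mathbb{N}\cup\{0\}$, and $\mathbb{D}=\{2^n: n\in\mathbb{N}_0\}$ is the set of dyadic numbers. For real $q\ge1$ and $t\ge 0$, $B_t^q=\{x\in\mathbb{R}^d:\sum_{i=1}^d|x_i|^q\le t^q\}$ (so $B_t^q=t\cdot B^q$ for $t>0$, where $B^q=B_1^q$ is the closed unit $\ell^q$ ball in $\mathbb{R}^d$). For $t>0$, $f:\mathbb{Z}^d\to\mathbb{C}$ and $x\in\mathbb{Z}^d$, the discrete Hardy–Littlewood averaging operator is $$\mathcal{M}_t^{B^q}f(x)=\frac{1}{|B_t^q\cap\mathbb{Z}^d|}\sum_{y\in B_t^q\cap\mathbb{Z}^d}f(x-y),$$ where $|B_t^q\cap\mathbb{Z}^d|$ is the number of elements of the finite set $B_t^q\cap\mathbb{Z}^d$. The space $\ell^p(\mathbb{Z}^d)$ is the usual space of functions $f:\mathbb{Z}^d\to\mathbb{C}$ with finite norm $\|f\|_{\ell^p(\mathbb{Z}^d)}=(\sum_{x\in\mathbb{Z}^d}|f(x)|^p)^{1/p}$ (supremum norm if $p=\infty$).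 The constant $C$ does not depend on $q,p,d,f$. *)

theory Defs
  imports "HOL-Analysis.Infinite_Sum" "HOL-Library.Extended_Real"
begin

text \<open>
  The constant of the theorem is uniform in the dimension \<open>d\<close>, so \<open>d\<close> has to be a number and not a
  type. Points of \<open>\<real>\<^sup>d\<close> and \<open>\<int>\<^sup>d\<close> are represented by sequences that vanish from index \<open>d\<close> on; this
  representation is closed under the pointwise subtraction of functions. Functions on \<open>\<int>\<^sup>d\<close> are total
  functions on sequences of which only the values on \<open>int_lattice d\<close> are used.
\<close>

definition euclid :: "nat \<Rightarrow> (nat \<Rightarrow> real) set" where
  "euclid d = {x. \<forall>i\<ge>d. x i = 0}"

definition int_lattice :: "nat \<Rightarrow> (nat \<Rightarrow> int) set" where
  "int_lattice d = {x. \<forall>i\<ge>d. x i = 0}"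

definition lq_ball :: "nat \<Rightarrow> real \<Rightarrow> real \<Rightarrow> (nat \<Rightarrow> real) set" where
  "lq_ball d q t = {x \<in> euclid d. (\<Sum>i<d. \<bar>x i\<bar> powr q) \<le> t powr q}"

definition int_lattice_ball :: "nat \<Rightarrow> real \<Rightarrow> real \<Rightarrow> (nat \<Rightarrow> int) set" where
  "int_lattice_ball d q t = {y \<in> int_lattice d. (\<lambda>i. real_of_int (y i)) \<in> lq_ball d q t}"

definition hl_avg :: "nat \<Rightarrow> real \<Rightarrow> real \<Rightarrow> ((nat \<Rightarrow> int) \<Rightarrow> complex) \<Rightarrow> (nat \<Rightarrow> int) \<Rightarrow> complex" where
  "hl_avg d q t f x =
     (\<Sum>y\<in>int_lattice_ball d q t. f (x - y)) / of_nat (card (int_lattice_ball d q t))"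

definition dyadic :: "real set" where
  "dyadic = range (\<lambda>n::nat. 2 ^ n)"

text \<open>
  For \<open>d \<ge> 1\<close> and \<open>q \<ge> 1\<close> the index set of the supremum is finite and contains \<open>1\<close>, so the
  supremum in \<open>real\<close> is the genuine one.
\<close>

definition hl_dyadic_max :: "nat \<Rightarrow> real \<Rightarrow> ((nat \<Rightarrow> int) \<Rightarrow> complex) \<Rightarrow> (nat \<Rightarrow> int) \<Rightarrow> real" where
  "hl_dyadic_max d q f x =
     (SUP t\<in>{t \<in> dyadic. t \<le> real d powr (1 / q)}. cmod (hl_avg d q t f x))"

text \<open>
  The space \<open>\<ell>\<^sup>p(A)\<close> and its norm for an exponent \<open>p \<in> (0,\<infinity>]\<close>. The norm is real-valued and is
  meaningful only on members of the space: \<open>infsum\<close> of a non-summable family is \<open>0\<close>.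
\<close>

definition lp_space :: "ereal \<Rightarrow> 'a set \<Rightarrow> ('a \<Rightarrow> 'b::real_normed_vector) set" where
  "lp_space p A =
     (if p = \<infinity> then {f. bdd_above ((\<lambda>x. norm (f x)) ` A)}
      else {f. (\<lambda>x. norm (f x) powr real_of_ereal p) summable_on A})"

definition lp_norm :: "ereal \<Rightarrow> 'a set \<Rightarrow> ('a \<Rightarrow> 'b::real_normed_vector) \<Rightarrow> real" where
  "lp_norm p A f =
     (if p = \<infinity> then (SUP x\<in>A. norm (f x))
      else (\<Sum>\<^sub>\<infinity>x\<in>A. norm (f x) powr real_of_ereal p) powr (1 / real_of_ereal p))"

end

theory Submission
  imports Defs "HOL-Analysis.Harmonic_Numbers" "HOL-Library.Real_Mod"
    "HOL-Library.Function_Algebras" "HOL-Library.Groups_Big_Fun"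
begin

text \<open>
  \<^bold>\<open>Reduction to nonnegative functions in \<open>\<ell>\<^sup>2\<close>.\<close> For \<open>2 \<le> p < \<infinity>\<close> Jensen's inequality gives
  \<open>\<bar>M\<^sub>t f\<bar>\<^sup>p \<le> (M\<^sub>t \<bar>f\<bar>\<^bsup>p/2\<^esup>)\<^sup>2\<close>, so the bound for \<open>f\<close> in \<open>\<ell>\<^sup>p\<close> follows from the bound for
  \<open>\<bar>f\<bar>\<^bsup>p/2\<^esup>\<close> in \<open>\<ell>\<^sup>2\<close>; no interpolation is needed. The case \<open>p = \<infinity>\<close> is trivial.

  \<^bold>\<open>Scales.\<close> Put \<open>K = t\<^sup>q\<close> for \<open>t = 2\<^sup>n\<close>, so that \<open>K \<le> d\<close> and \<open>K\<close> at least doubles with \<open>n\<close>. At most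
  four scales satisfy \<open>K < 4\<close> or \<open>4 K > d\<close>; each is an \<open>\<ell>\<^sup>2\<close> contraction. For the others
  let \<open>T\<close> be the nearest neighbour average. As \<open>f \<ge> 0\<close>, \<open>M\<^sub>t f \<le> 2 M\<^sub>t ((f + T f) / 2)\<close>.
  The right-hand side is compared with the Cesaro mean \<open>A\<^sub>l f = 2\<^bsup>-l\<^esup> (\<Sum>k<2\<^sup>l. T\<^sup>k f)\<close>, where
  \<open>2\<^sup>l \<le> K < 2\<^bsup>l+1\<^esup>\<close>:
  the maximal function is at most twice the sum of \<open>sup A\<^sub>l f\<close> and a square function of the differences.

  \<^bold>\<open>Maximal inequality for the Cesaro means\<close> (\<open>sq_cesaro_max_le\<close>). Since \<open>A\<^sub>l A\<^sub>m f \<le> 2 (A\<^bsub>l+1\<^esub> f + A\<^bsub>m+1\<^esub> f)\<close>,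
  a \<open>T T\<^sup>*\<close> argument turns any a priori bound \<open>M\<close> for the norm into \<open>2 \<surd>(M + 1)\<close>; iteration gives \<open>5\<close>.

  \<^bold>\<open>Square function\<close> (\<open>mult_diff_square_sum\<close>). By Plancherel it suffices to bound, uniformly in the
  frequency \<open>\<xi>\<close>, the sum over the scales of the squared differences of the Fourier multipliers. Let
  \<open>c\<close> be the mean of the numbers \<open>cos \<xi>\<^sub>i\<close>, which is the multiplier of \<open>T\<close>. Write \<open>s = 1 - c\<close>,
  \<open>s' = 1 + c\<close>, and let \<open>\<mu>\<close> be the multiplier of \<open>M\<^sub>t\<close>. Then
    \<^item> \<open>\<bar>\<mu> - 1\<bar> \<le> 48 K s\<close> (\<open>chi_sum_low\<close>), and
    \<^item> \<open>\<bar>\<mu>\<bar> \<le> 481 K / d + 54 / \<surd>(K s s')\<close> (\<open>chi_sum_high\<close>).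
  Near \<open>s' = 0\<close>, where \<open>\<mu>\<close> need not decay, the factor \<open>s' / 2\<close> contributed by \<open>(1 + T) / 2\<close> helps.
  The squared differences are thus \<open>O((K/d)\<^sup>2 + min (K s) (1 / (K s)))\<close>, which is summable over lacunary
  \<open>K \<le> d\<close> with a bound independent of \<open>d\<close>, \<open>q\<close> and \<open>\<xi>\<close>.

  \<^bold>\<open>The two multiplier bounds.\<close> Double counting (\<open>qball_double_count\<close>) shows that lowering the budget
  \<open>K\<close> by one loses a factor \<open>d / K\<close>. Hence a coordinate equals \<open>a\<close> with probability at most
  \<open>(K/d)\<close> to the power \<open>\<lfloor>\<bar>a\<bar>\<^sup>q\<rfloor>\<close>, which gives the first bound via the second moment and
  shows that apart from a set of probability \<open>O(K/d)\<close> at least \<open>K/2\<close> coordinates are \<open>\<plusminus>1\<close>. When the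
  other nonzero coordinates are fixed, the points with \<open>j\<close> coordinates \<open>\<plusminus>1\<close> contribute the \<open>j\<close>-th coefficient
  of a product of factors \<open>1 + 2 w cos \<xi>\<^sub>i\<close>. On a circle the modulus of the product is at most a multiple
  of a Poisson kernel, whose mean is explicit (\<open>layer_sum_bound\<close>).
\<close>

text \<open>Integer points, represented by sequences.\<close>

type_synonym point = "nat \<Rightarrow> int"

section \<open>Roots of unity and the Poisson kernel\<close>

lemma sum_cis_roots:
  assumes "N > 0"
  shows "(\<Sum>k<N. cis (2 * pi * real k / real N * real_of_int m)) = (if int N dvd m then of_nat N else 0)"
proof -
  define z where "z = cis (2 * pi * real_of_int m / real N)"
  have pw: "cis (2 * pi * real k / real N * real_of_int m) = z ^ k" for k
    unfolding z_def Complex.DeMoivre by (rule arg_cong[where f = cis]) (simp add: field_simps)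
  have zN: "z ^ N = 1"
  proof -
    have "z ^ N = cis (2 * pi * real_of_int m)"
      using assms unfolding z_def Complex.DeMoivre by simp
    then show ?thesis by simp
  qed
  have z1: "z = 1 \<longleftrightarrow> int N dvd m"
  proof
    assume "z = 1"
    then obtain n where "2 * pi * real_of_int m / real N = real_of_int n * (2 * pi)"
      unfolding z_def cis_eq_1_iff by auto
    then have "real_of_int m = real_of_int n * real N"
      using assms by (simp add: field_simps)
    then have "real_of_int m = real_of_int (n * int N)" by simp
    then have "m = n * int N" by linarith
    then show "int N dvd m" by simp
  next
    assume "int N dvd m"
    then obtain n where "m = int N * n" by auto
    then have "2 * pi * real_of_int m / real N = real_of_int n * (2 * pi)"
      using assms by simp
    then show "z = 1" unfolding z_def cis_eq_1_iff by blast
  qed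
  show ?thesis
  proof (cases "z = 1")
    case True
    then show ?thesis using z1 unfolding pw by simp
  next
    case False
    then have "(\<Sum>k<N. z ^ k) = (z ^ N - 1) / (z - 1)" by (rule geometric_sum)
    then show ?thesis using False z1 zN unfolding pw by simp
  qed
qed

lemma coeff_extract:
  fixes a :: "nat \<Rightarrow> complex"
  assumes "j \<le> r" "r < N"
  shows "(\<Sum>k<N. (\<Sum>i\<le>r. a i * cis (2 * pi * real k / real N) ^ i)
             * cis (- (2 * pi * real k / real N * real j))) = of_nat N * a j"
proof -
  have "(\<Sum>k<N. (\<Sum>i\<le>r. a i * cis (2 * pi * real k / real N) ^ i)
             * cis (- (2 * pi * real k / real N * real j)))
      = (\<Sum>i\<le>r. \<Sum>k<N. a i * cis (2 * pi * real k / real N * real_of_int (int i - int j)))"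
    unfolding sum_distrib_right Complex.DeMoivre
    by (subst sum.swap) (simp add: mult.assoc cis_mult algebra_simps diff_divide_distrib)
  also have "\<dots> = (\<Sum>i\<le>r. a i * (if i = j then of_nat N else 0))"
  proof (rule sum.cong)
    fix i assume i: "i \<in> {..r}"
    have "int N dvd int i - int j \<longleftrightarrow> i = j"
    proof
      assume "int N dvd int i - int j"
      then have "int i - int j = 0 \<or> \<bar>int N\<bar> \<le> \<bar>int i - int j\<bar>"
        using dvd_imp_le_int by blast
      then show "i = j" using i assms by auto
    qed auto
    then show "(\<Sum>k<N. a i * cis (2 * pi * real k / real N * real_of_int (int i - int j)))
        = a i * (if i = j then of_nat N else 0)"
      using assms unfolding sum_distrib_left[symmetric] by (subst sum_cis_roots) auto
  qed auto
  also have "\<dots> = of_nat N * a j"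
    using assms by (simp add: if_distrib cong: if_cong)
  finally show ?thesis .
qed

lemma norm_square_cis_diff:
  "(cmod (1 - of_real t * cis x))\<^sup>2 = 1 + t\<^sup>2 - 2 * t * cos x"
proof -
  have "(cmod (1 - of_real t * cis x))\<^sup>2 = (1 - t * cos x)\<^sup>2 + (t * sin x)\<^sup>2"
    by (simp add: cmod_power2)
  also have "\<dots> = 1 + t\<^sup>2 * ((sin x)\<^sup>2 + (cos x)\<^sup>2) - 2 * t * cos x"
    unfolding power2_eq_square by (simp only: algebra_simps)
  finally show ?thesis by simp
qed

lemma parseval_roots:
  fixes a :: "nat \<Rightarrow> real"
  assumes "r < N"
  shows "(\<Sum>k<N. (cmod (\<Sum>i\<le>r. of_real (a i) * cis (2 * pi * real k / real N) ^ i))\<^sup>2)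
       = real N * (\<Sum>i\<le>r. (a i)\<^sup>2)"
proof -
  define w where "w = (\<lambda>k. 2 * pi * real k / real N)"
  define F where "F = (\<lambda>k. \<Sum>i\<le>r. of_real (a i) * cis (w k) ^ i)"
  have "complex_of_real (\<Sum>k<N. (cmod (F k))\<^sup>2) = (\<Sum>k<N. F k * cnj (F k))"
    by (simp add: complex_norm_square[symmetric])
  also have "\<dots> = (\<Sum>k<N. \<Sum>j\<le>r. of_real (a j) * (F k * cis (- (w k * real j))))"
  proof (rule sum.cong)
    fix k
    have "cnj (F k) = (\<Sum>j\<le>r. of_real (a j) * cis (- (w k * real j)))"
      by (simp add: F_def Complex.DeMoivre cis_cnj mult.commute[of "w k"])
    then show "F k * cnj (F k) = (\<Sum>j\<le>r. of_real (a j) * (F k * cis (- (w k * real j))))"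
      by (simp add: sum_distrib_left mult_ac)
  qed auto
  also have "\<dots> = (\<Sum>j\<le>r. of_real (a j) * (\<Sum>k<N. F k * cis (- (w k * real j))))"
    by (subst sum.swap) (simp add: sum_distrib_left)
  also have "\<dots> = (\<Sum>j\<le>r. of_real (a j) * (of_nat N * of_real (a j)))"
    by (intro sum.cong refl) (use coeff_extract[OF _ assms] in \<open>auto simp: F_def w_def\<close>)
  also have "\<dots> = complex_of_real (real N * (\<Sum>i\<le>r. (a i)\<^sup>2))"
    by (simp add: sum_distrib_left power2_eq_square mult_ac)
  finally show ?thesis unfolding F_def w_def of_real_eq_iff .
qed

text \<open>The mean of \<open>1 / (1 - c cos x)\<close> over the circle is \<open>1 / \<surd>(1 - c\<^sup>2)\<close>. Averages over the \<open>N\<close>-th roots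
  of unity satisfy this up to the factor \<open>3\<close> for arbitrarily large \<open>N\<close>.\<close>

lemma poisson_kernel_average:
  assumes c: "\<bar>c\<bar> < 1"
  shows "\<exists>N > M. (\<Sum>k<N. 1 / (1 - c * cos (2 * pi * real k / real N))) \<le> real N * (3 / sqrt (1 - c\<^sup>2))"
proof -
  define s where "s = sqrt (1 - c\<^sup>2)"
  have c2: "c\<^sup>2 < 1" using c by (simp add: abs_square_less_1)
  have s0: "s > 0" using c2 by (simp add: s_def)
  have s2: "s\<^sup>2 = 1 - c\<^sup>2" using c2 by (simp add: s_def)
  \<comment> \<open>this choice makes \<open>1 - c cos x\<close> proportional to \<open>\<bar>1 - t cis x\<bar>\<^sup>2\<close>\<close>
  define t where "t = c / (1 + s)"
  have t1: "\<bar>t\<bar> < 1" using c s0 by (simp add: t_def)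
  have ct: "c = t * (1 + s)" using s0 by (simp add: t_def)
  have tt: "t\<^sup>2 * (1 + s) = 1 - s"
  proof -
    have "t\<^sup>2 * (1 + s)\<^sup>2 = (1 - s) * (1 + s)"
      using s2 ct by (simp add: power_mult_distrib[symmetric] algebra_simps power2_eq_square)
    then show ?thesis using s0 by (simp add: power2_eq_square)
  qed
  have tpos: "1 - t\<^sup>2 > 0" using t1 by (simp add: abs_square_less_1)
  have sden: "s * (1 + t\<^sup>2) = 1 - t\<^sup>2" using tt by (simp add: algebra_simps)
  have cden: "c * (1 + t\<^sup>2) = 2 * t"
  proof -
    have "c * (1 + t\<^sup>2) = t * (1 + s + t\<^sup>2 * (1 + s))" unfolding ct by (simp add: algebra_simps)
    then show ?thesis using tt by simp
  qed
  have "(\<lambda>n. \<bar>t\<bar> ^ n) \<longlonglongrightarrow> 0" using t1 by (intro LIMSEQ_power_zero) simp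
  then have "\<forall>\<^sub>F n in sequentially. \<bar>t\<bar> ^ n < 1/2"
    by (rule order_tendstoD) simp
  \<comment> \<open>for \<open>N\<close> this large the factor \<open>(1 + t\<^sup>N) / (1 - t\<^sup>N)\<close> caused by the discrete average is at most \<open>3\<close>\<close>
  then obtain n0 where n0: "\<And>n. n \<ge> n0 \<Longrightarrow> \<bar>t\<bar> ^ n < 1/2"
    unfolding eventually_sequentially by blast
  define N where "N = Suc (max M n0)"
  have NM: "N > M" "N > 0" by (auto simp: N_def)
  define u where "u = t ^ N"
  have u: "\<bar>u\<bar> < 1/2" using n0[of N] by (simp add: u_def N_def power_abs[symmetric] del: power_Suc)
  define w where "w = (\<lambda>k. 2 * pi * real k / real N)"
  \<comment> \<open>at a root of unity the finite geometric sum is \<open>(1 - t\<^sup>N) / (1 - t cis (w k))\<close>\<close>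
  have summand: "1 / (1 - c * cos (w k))
      = (1 + t\<^sup>2) / (1 - u)\<^sup>2 * (cmod (\<Sum>i\<le>N-1. of_real (t ^ i) * cis (w k) ^ i))\<^sup>2" if "k < N" for k
  proof -
    define z where "z = of_real t * cis (w k)"
    have "cmod z < 1" using t1 by (simp add: z_def norm_mult)
    then have z1: "z \<noteq> 1" by auto
    have zN: "z ^ N = of_real u"
    proof -
      have "cis (w k) ^ N = cis (2 * pi * real k)"
        unfolding Complex.DeMoivre w_def using NM by simp
      also have "\<dots> = 1" by simp
      finally show ?thesis by (simp add: z_def power_mult_distrib u_def)
    qed
    have "(\<Sum>i\<le>N-1. of_real (t ^ i) * cis (w k) ^ i) = (\<Sum>i<N. z ^ i)"
      using NM by (intro sum.cong) (auto simp: z_def power_mult_distrib)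
    also have "\<dots> = (z ^ N - 1) / (z - 1)" using z1 by (rule geometric_sum)
    also have "\<dots> = of_real (1 - u) / (1 - z)"
      unfolding zN using z1 by (simp add: field_simps)
    finally have "cmod (\<Sum>i\<le>N-1. of_real (t ^ i) * cis (w k) ^ i) = cmod (of_real (1 - u)) / cmod (1 - z)"
      by (simp only: norm_divide)
    then have e1: "(cmod (\<Sum>i\<le>N-1. of_real (t ^ i) * cis (w k) ^ i))\<^sup>2 = (1-u)\<^sup>2 / (cmod (1 - z))\<^sup>2"
      by (simp add: power_divide norm_of_real del: of_real_diff)
    have e2: "(cmod (1 - z))\<^sup>2 = (1 + t\<^sup>2) * (1 - c * cos (w k))"
    proof -
      have "(1 + t\<^sup>2) * (1 - c * cos (w k)) = 1 + t\<^sup>2 - c * (1 + t\<^sup>2) * cos (w k)"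
        by (simp add: algebra_simps)
      also have "\<dots> = 1 + t\<^sup>2 - 2 * t * cos (w k)" unfolding cden ..
      finally show ?thesis unfolding z_def norm_square_cis_diff by simp
    qed
    have "1 + t\<^sup>2 \<noteq> 0" by (simp add: add_nonneg_eq_0_iff)
    have nz: "(1 - u)\<^sup>2 \<noteq> 0" using u by auto
    have "1 / X = B / A * (A / (B * X))" if "A \<noteq> 0" "B \<noteq> 0" for A B X :: real
      using that by simp
    from this[OF nz \<open>1 + t\<^sup>2 \<noteq> 0\<close>] show ?thesis unfolding e1 e2 .
  qed
  have geo: "(\<Sum>i\<le>N-1. (t ^ i)\<^sup>2) = (1 - u\<^sup>2) / (1 - t\<^sup>2)"
  proof -
    have "(\<Sum>i\<le>N-1. (t ^ i)\<^sup>2) = (\<Sum>i<N. (t\<^sup>2) ^ i)"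
      using NM by (intro sum.cong) (auto simp: power_mult[symmetric] mult.commute)
    also have "\<dots> = ((t\<^sup>2) ^ N - 1) / (t\<^sup>2 - 1)"
      using tpos by (intro geometric_sum) simp
    also have "(t\<^sup>2) ^ N = u\<^sup>2" by (simp add: u_def power_mult[symmetric] mult.commute)
    also have "(u\<^sup>2 - 1) / (t\<^sup>2 - 1) = (1 - u\<^sup>2) / (1 - t\<^sup>2)"
      using tpos by (simp add: field_simps)
    finally show ?thesis .
  qed
  have "(\<Sum>k<N. 1 / (1 - c * cos (w k)))
      = (1 + t\<^sup>2) / (1 - u)\<^sup>2 * (\<Sum>k<N. (cmod (\<Sum>i\<le>N-1. of_real (t ^ i) * cis (w k) ^ i))\<^sup>2)"
    unfolding sum_distrib_left by (intro sum.cong refl summand) auto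
  also have "(\<Sum>k<N. (cmod (\<Sum>i\<le>N-1. of_real (t ^ i) * cis (w k) ^ i))\<^sup>2)
      = real N * (\<Sum>i\<le>N-1. (t ^ i)\<^sup>2)"
    unfolding w_def by (rule parseval_roots) (use NM in auto)
  also have "(1 + t\<^sup>2) / (1 - u)\<^sup>2 * (real N * (\<Sum>i\<le>N-1. (t ^ i)\<^sup>2))
      = real N * ((1 + u) / (1 - u) * ((1 + t\<^sup>2) / (1 - t\<^sup>2)))"
  proof -
    have "(1 - u\<^sup>2) / (1-u)\<^sup>2 = (1 + u) / (1 - u)"
      using u by (simp add: divide_simps power2_eq_square) (simp add: algebra_simps)
    moreover have "B / A * (n * (E / T)) = n * (E / A * (B / T))" for A B E T n :: real
      by simp
    ultimately show ?thesis unfolding geo by metis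
  qed
  also have "(1 + t\<^sup>2) / (1 - t\<^sup>2) = 1 / s"
    using sden tpos s0 by (simp add: field_simps)
  also have "real N * ((1 + u) / (1 - u) * (1 / s)) \<le> real N * (3 * (1 / s))"
  proof -
    have "(1 + u) / (1 - u) \<le> 3" using u by (auto simp: divide_simps abs_less_iff)
    then show ?thesis using s0 by (intro mult_left_mono mult_right_mono) auto
  qed
  finally show ?thesis using NM unfolding w_def s_def by (intro exI[of _ N]) auto
qed

section \<open>Exponential sums over layers of the discrete cube\<close>

text \<open>The quantity \<open>n! e\<^sup>n / n\<^sup>n\<close>, which grows like \<open>\<surd>n\<close>. The binomial probability at the mean is
  a ratio of such quantities, so its monotonicity and an upper bound suffice to bound that probability
  from below.\<close>

definition stirling :: "nat \<Rightarrow> real" where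
  "stirling n = fact n * exp (real n) / real n ^ n"

lemma stirling_pos: "stirling n > 0"
  by (cases "n = 0") (simp_all add: stirling_def)

lemma stirling_Suc:
  assumes "n > 0"
  shows "stirling (Suc n) = stirling n * exp (1 - real n * (ln (real n + 1) - ln (real n)))"
proof -
  have "exp (1 - real n * (ln (real n + 1) - ln (real n))) = exp 1 * (real n ^ n / (real n + 1) ^ n)"
    using assms by (simp add: exp_diff right_diff_distrib exp_of_nat_mult mult.commute)
  then have "stirling n * exp (1 - real n * (ln (real n + 1) - ln (real n)))
      = stirling n * (exp 1 * (real n ^ n / (real n + 1) ^ n))" by (simp only:)
  also have "\<dots> = fact n * (exp (real n) * exp 1) / (real n + 1) ^ n"
    using assms by (simp add: stirling_def)
  also have "\<dots> = stirling (Suc n)"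
  proof -
    have "F * E / X = (y * F) * E / (y * X)" if "y \<noteq> 0" for F E X y :: real
      using that by simp
    from this[of "real n + 1" "fact n" "exp (real n) * exp 1" "(real n + 1) ^ n"]
    show ?thesis by (simp add: stirling_def exp_add add.commute mult.commute)
  qed
  finally show ?thesis ..
qed

lemma stirling_mono:
  assumes "m \<le> n"
  shows "stirling m \<le> stirling n"
  using assms
proof (induction n rule: dec_induct)
  case (step n)
  have "stirling n \<le> stirling (Suc n)"
  proof (cases "n = 0")
    case True
    then show ?thesis by (simp add: stirling_def)
  next
    case False
    have "ln (real n + 1) - ln (real n) = ln (1 + 1 / real n)"
      using False ln_div[of "real n + 1" "real n"] by (simp add: add_divide_distrib)
    also have "\<dots> \<le> 1 / real n" by (rule ln_add_one_self_le_self) simp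
    finally have "real n * (ln (real n + 1) - ln (real n)) \<le> 1"
      using False by (simp add: field_simps)
    then have "1 \<le> exp (1 - real n * (ln (real n + 1) - ln (real n)))" by simp
    then show ?thesis using False stirling_pos[of n] by (simp add: stirling_Suc)
  qed
  then show ?case using step by linarith
qed simp

lemma stirling_upper:
  assumes "n > 0"
  shows "stirling n \<le> exp 1 * sqrt (real n)"
  using assms
proof (induction n rule: nat_induct_non_zero)
  case 1
  then show ?case by (simp add: stirling_def)
next
  case (Suc n)
  define L where "L = ln (real n + 1) - ln (real n)"
  have "L \<ge> 2 * (real n + 1 - real n) / (real n + (real n + 1))"
    unfolding L_def using Suc.hyps by (intro ln_inverse_approx_ge) auto
  then have "(real n + 1/2) * L \<ge> 1" by (simp add: field_simps)
  then have "1 - real n * L \<le> L / 2" by (simp add: algebra_simps)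
  then have "exp (1 - real n * L) \<le> exp (L / 2)" by simp
  also have "exp (L / 2) = sqrt (exp L)"
    by (rule real_sqrt_unique[symmetric]) (simp_all add: power2_eq_square exp_add[symmetric])
  also have "exp L = (real n + 1) / real n" using Suc.hyps by (simp add: L_def exp_diff)
  finally have e: "exp (1 - real n * L) \<le> sqrt ((real n + 1) / real n)" .
  have "stirling (Suc n) = stirling n * exp (1 - real n * L)"
    unfolding L_def by (rule stirling_Suc[OF Suc.hyps])
  also have "\<dots> \<le> (exp 1 * sqrt (real n)) * sqrt ((real n + 1) / real n)"
    using Suc.IH e by (intro mult_mono) auto
  also have "\<dots> = exp 1 * sqrt (real (Suc n))"
    using Suc.hyps by (simp add: real_sqrt_divide add.commute)
  finally show ?case .
qed

lemma binomial_mode_lower: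
  assumes "1 \<le> j" "j \<le> r"
  shows "1 / (exp 1 * sqrt (real j))
      \<le> real (r choose j) * (real j / real r) ^ j * (1 - real j / real r) ^ (r - j)"
proof -
  have r: "r > 0" using assms by simp
  have "real r ^ r = real r ^ j * real r ^ (r - j)"
    using assms by (simp add: power_add[symmetric])
  moreover have "1 - real j / real r = real (r - j) / real r"
    using assms r by (simp add: field_simps)
  moreover have "exp (real r) = exp (real j) * exp (real (r - j))"
    using assms by (simp add: exp_add[symmetric])
  ultimately have "real (r choose j) * (real j / real r) ^ j * (1 - real j / real r) ^ (r - j)
     = stirling r / (stirling j * stirling (r - j))"
    using assms by (cases "r = j") (auto simp: stirling_def binomial_fact power_divide field_simps)
  also have "\<dots> \<ge> 1 / stirling j"
    using stirling_pos[of j] stirling_pos[of "r - j"] stirling_mono[of "r - j" r]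
    by (simp add: field_simps)
  moreover have "1 / (exp 1 * sqrt (real j)) \<le> 1 / stirling j"
    using assms stirling_pos[of j] stirling_upper[of j] by (intro divide_left_mono) auto
  ultimately show ?thesis by linarith
qed

text \<open>Functions with values in \<open>S\<close> on \<open>R\<close> and \<open>0\<close> outside of \<open>R\<close>.\<close>

definition funs :: "'a set \<Rightarrow> 'b::zero set \<Rightarrow> ('a \<Rightarrow> 'b) set" where
  "funs R S = {y. (\<forall>i. i \<notin> R \<longrightarrow> y i = 0) \<and> (\<forall>i\<in>R. y i \<in> S)}"

lemma funs_insert:
  assumes "a \<notin> R"
  shows "funs (insert a R) S = (\<lambda>(v, y). y(a := v)) ` (S \<times> funs R S)"
proof (intro set_eqI iffI)
  fix y assume y: "y \<in> funs (insert a R) S"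
  then have "(y a, y(a := 0)) \<in> S \<times> funs R S"
    using assms by (auto simp: funs_def)
  then have "(\<lambda>(v, y). y(a := v)) (y a, y(a := 0)) \<in> (\<lambda>(v, y). y(a := v)) ` (S \<times> funs R S)"
    by (rule imageI)
  then show "y \<in> (\<lambda>(v, y). y(a := v)) ` (S \<times> funs R S)" by simp
qed (use assms in \<open>auto simp: funs_def\<close>)

lemma inj_on_funs_insert:
  assumes "a \<notin> R"
  shows "inj_on (\<lambda>(v, y). y(a := v)) (S \<times> funs R S)"
proof (rule inj_onI, clarsimp)
  fix v y v' y' assume y: "y \<in> funs R S" "y' \<in> funs R S" "y(a := v) = y'(a := v')"
  have "v = v'" using fun_cong[OF y(3), of a] by simp
  moreover have "y i = y' i" for i
    using fun_cong[OF y(3), of i] y(1,2) assms by (cases "i = a") (auto simp: funs_def)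
  ultimately show "v = v' \<and> y = y'" by auto
qed

lemma funs_empty: "funs {} S = {\<lambda>_. 0}"
  by (auto simp: funs_def)

lemma finite_funs:
  assumes "finite R" "finite S"
  shows "finite (funs R S)"
  using assms by (induction R) (simp_all add: funs_insert funs_empty)

lemma sum_prod_funs:
  fixes g :: "'a \<Rightarrow> 'b::zero \<Rightarrow> 'c::comm_semiring_1"
  assumes "finite R"
  shows "(\<Sum>y\<in>funs R S. \<Prod>i\<in>R. g i (y i)) = (\<Prod>i\<in>R. \<Sum>v\<in>S. g i v)"
  using assms
proof (induction R)
  case empty
  show ?case unfolding funs_empty by simp
next
  case (insert a R)
  have ne: "i \<in> R \<Longrightarrow> i \<noteq> a" for i using insert.hyps by auto
  have "(\<Sum>y\<in>funs (insert a R) S. \<Prod>i\<in>insert a R. g i (y i))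
      = (\<Sum>(v, y)\<in>S \<times> funs R S. g a v * (\<Prod>i\<in>R. g i (y i)))"
    unfolding funs_insert[OF insert.hyps(2)]
    using insert.hyps
    by (subst sum.reindex[OF inj_on_funs_insert])
       (auto intro!: sum.cong arg_cong2[where f = "(*)"] prod.cong simp: comp_def ne)
  also have "\<dots> = (\<Sum>v\<in>S. g a v) * (\<Sum>y\<in>funs R S. \<Prod>i\<in>R. g i (y i))"
    by (simp add: sum_product sum.cartesian_product)
  also have "\<dots> = (\<Prod>i\<in>insert a R. \<Sum>v\<in>S. g i v)"
    using insert by simp
  finally show ?case .
qed

text \<open>Vectors supported in \<open>R\<close> with entries in \<open>{-1, 0, 1}\<close>, exactly \<open>j\<close> of them nonzero.\<close>

definition unit_layer :: "nat set \<Rightarrow> nat \<Rightarrow> point set" where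
  "unit_layer R j = {y \<in> funs R {-1, 0, 1}. (\<Sum>i\<in>R. nat \<bar>y i\<bar>) = j}"

text \<open>The exponential sum at the frequency \<open>\<xi>\<close> over such a layer.\<close>

definition layer_sum :: "nat set \<Rightarrow> (nat \<Rightarrow> real) \<Rightarrow> nat \<Rightarrow> complex" where
  "layer_sum R \<xi> j = (\<Sum>y\<in>unit_layer R j. \<Prod>i\<in>R. cis (\<xi> i * real_of_int (y i)))"

lemma layer_sum_generating:
  fixes w :: complex
  assumes R: "finite R"
  shows "(\<Sum>j\<le>card R. layer_sum R \<xi> j * w ^ j) = (\<Prod>i\<in>R. 1 + 2 * w * of_real (cos (\<xi> i)))"
proof -
  define h where "h = (\<lambda>y::nat \<Rightarrow> int. \<Prod>i\<in>R. w ^ nat \<bar>y i\<bar> * cis (\<xi> i * real_of_int (y i)))"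
  have h: "h y = (\<Prod>i\<in>R. cis (\<xi> i * real_of_int (y i))) * w ^ (\<Sum>i\<in>R. nat \<bar>y i\<bar>)" for y
    unfolding h_def by (simp add: prod.distrib power_sum mult.commute)
  have "(\<Sum>j\<le>card R. layer_sum R \<xi> j * w ^ j)
      = (\<Sum>j\<le>card R. \<Sum>y\<in>{y \<in> funs R {-1, 0, 1}. (\<Sum>i\<in>R. nat \<bar>y i\<bar>) = j}. h y)"
    unfolding layer_sum_def sum_distrib_right unit_layer_def
    by (intro sum.cong refl) (auto simp: h)
  also have "\<dots> = (\<Sum>y\<in>funs R {-1, 0, 1}. h y)"
  proof (rule sum.group)
    show "(\<lambda>y. \<Sum>i\<in>R. nat \<bar>y i\<bar>) ` funs R {- 1, 0, 1} \<subseteq> {..card R}"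
    proof clarsimp
      fix y :: "nat \<Rightarrow> int" assume "y \<in> funs R {- 1, 0, 1}"
      then have "(\<Sum>i\<in>R. nat \<bar>y i\<bar>) \<le> (\<Sum>i\<in>R. 1)"
        by (intro sum_mono) (auto simp: funs_def)
      then show "(\<Sum>i\<in>R. nat \<bar>y i\<bar>) \<le> card R" by simp
    qed
  qed (use R in \<open>simp_all add: finite_funs\<close>)
  also have "\<dots> = (\<Prod>i\<in>R. \<Sum>v\<in>{-1, 0, 1::int}. w ^ nat \<bar>v\<bar> * cis (\<xi> i * real_of_int v))"
    unfolding h_def by (rule sum_prod_funs[OF R])
  also have "\<dots> = (\<Prod>i\<in>R. 1 + 2 * w * of_real (cos (\<xi> i)))"
    by (intro prod.cong refl) (simp add: complex_eq_iff algebra_simps)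
  finally show ?thesis .
qed

text \<open>The generating polynomial, rescaled so that the \<open>i\<close>-th factor is \<open>1 - p + p cos \<xi>\<^sub>i z\<close>, has the layer
  sums as its coefficients up to explicit weights. They are recovered by averaging over roots of unity.\<close>

lemma layer_sum_extract:
  assumes "finite R" "j \<le> card R" "card R < N" "p \<noteq> (1::real)"
  shows "(\<Sum>k<N. (\<Prod>i\<in>R. of_real (1 - p) + of_real (p * cos (\<xi> i)) * cis (2 * pi * real k / real N))
            * cis (- (2 * pi * real k / real N * real j)))
      = of_nat N * (layer_sum R \<xi> j * of_real ((p / 2) ^ j * (1 - p) ^ (card R - j)))"
proof -
  have "(\<Prod>i\<in>R. of_real (1 - p) + of_real (p * cos (\<xi> i)) * z)
      = (\<Sum>j\<le>card R. layer_sum R \<xi> j * of_real ((p / 2) ^ j * (1 - p) ^ (card R - j)) * z ^ j)" for z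
  proof -
    have p: "complex_of_real (1 - p) \<noteq> 0" using assms by (simp only: of_real_eq_0_iff)
    have "(\<Prod>i\<in>R. of_real (1 - p) + of_real (p * cos (\<xi> i)) * z)
        = (\<Prod>i\<in>R. of_real (1 - p) * (1 + 2 * (of_real (p / 2) / of_real (1 - p) * z) * of_real (cos (\<xi> i))))"
      using p by (intro prod.cong refl) (simp add: distrib_left del: of_real_diff)
    also have "\<dots> = of_real (1 - p) ^ card R *
        (\<Sum>j\<le>card R. layer_sum R \<xi> j * (of_real (p / 2) / of_real (1 - p) * z) ^ j)"
      unfolding layer_sum_generating[OF assms(1)] by (simp add: prod.distrib)
    also have "\<dots> = (\<Sum>j\<le>card R. layer_sum R \<xi> j * of_real ((p / 2) ^ j * (1 - p) ^ (card R - j)) * z ^ j)"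
      unfolding sum_distrib_left
    proof (intro sum.cong refl)
      fix j assume "j \<in> {..card R}"
      then have "complex_of_real (1 - p) ^ card R = of_real (1 - p) ^ j * of_real (1 - p) ^ (card R - j)"
        by (simp add: power_add[symmetric])
      then show "of_real (1 - p) ^ card R * (layer_sum R \<xi> j * (of_real (p / 2) / of_real (1 - p) * z) ^ j)
         = layer_sum R \<xi> j * of_real ((p / 2) ^ j * (1 - p) ^ (card R - j)) * z ^ j"
        using p by (simp add: power_mult_distrib power_divide mult_ac del: of_real_diff)
    qed
    finally show ?thesis .
  qed
  then show ?thesis using coeff_extract[OF assms(2,3), of "\<lambda>j. layer_sum R \<xi> j * of_real ((p / 2) ^ j * (1 - p) ^ (card R - j))"]
    by simp
qed

lemma card_unit_layer:
  assumes "finite R" "j \<le> card R"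
  shows "card (unit_layer R j) = (card R choose j) * 2 ^ j"
proof -
  define N where "N = Suc (card R)"
  define r where "r = card R"
  \<comment> \<open>at \<open>\<xi> = 0\<close> the layer sum is the cardinality; \<open>p = 1/2\<close> is an arbitrary choice\<close>
  have "of_nat N * (layer_sum R (\<lambda>_. 0) j * of_real ((1/2 / 2) ^ j * (1 - 1/2) ^ (card R - j)))
      = (\<Sum>k<N. (\<Prod>i\<in>R. of_real (1 - 1/2) + of_real (1/2 * cos 0) * cis (2 * pi * real k / real N))
            * cis (- (2 * pi * real k / real N * real j)))"
    by (rule layer_sum_extract[symmetric]) (use assms in \<open>auto simp: N_def\<close>)
  also have "\<dots> = (\<Sum>k<N. (\<Sum>i\<le>r. (of_nat (r choose i) * (1/2) ^ r) * cis (2 * pi * real k / real N) ^ i)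
             * cis (- (2 * pi * real k / real N * real j)))"
  proof (intro sum.cong refl arg_cong2[where f = "(*)"])
    fix k
    define z where "z = cis (2 * pi * real k / real N)"
    have "(\<Prod>i\<in>R. of_real (1 - 1/2) + of_real (1/2 * cos 0) * z) = (1/2) ^ r * (z + 1) ^ r"
      by (simp add: r_def power_mult_distrib[symmetric] algebra_simps add_divide_distrib)
    also have "(z + 1) ^ r = (\<Sum>i\<le>r. of_nat (r choose i) * z ^ i)" by (simp add: binomial_ring)
    finally show "(\<Prod>i\<in>R. of_real (1 - 1/2) + of_real (1/2 * cos 0) * z)
       = (\<Sum>i\<le>r. (of_nat (r choose i) * (1/2) ^ r) * z ^ i)"
      by (simp add: sum_distrib_left mult_ac)
  qed
  also have "\<dots> = of_nat N * (of_nat (r choose j) * (1/2) ^ r)"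
    by (rule coeff_extract) (use assms in \<open>auto simp: r_def N_def\<close>)
  finally have eq: "of_nat N * (layer_sum R (\<lambda>_. 0) j * of_real ((1/2 / 2) ^ j * (1 - 1/2) ^ (card R - j)))
     = of_nat N * (of_nat (r choose j) * (1/2) ^ r)" .
  have "(1/2::complex) ^ r = (1/2) ^ j * (1/2) ^ (r - j)"
    using assms by (simp add: power_add[symmetric] r_def)
  moreover have "(1/4::complex) ^ j = (1/2) ^ j * (1/2) ^ j" by (simp add: power_mult_distrib[symmetric])
  moreover have "complex_of_nat N \<noteq> 0" unfolding of_nat_eq_0_iff by (simp add: N_def)
  ultimately have "layer_sum R (\<lambda>_. 0) j * (1/2) ^ j = of_nat (r choose j)"
    using eq by (simp add: r_def[symmetric])
  then have "layer_sum R (\<lambda>_. 0) j = of_nat (r choose j) * 2 ^ j"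
    by (simp add: power_divide divide_simps)
  also have "layer_sum R (\<lambda>_. 0) j = of_nat (card (unit_layer R j))"
    by (simp add: layer_sum_def)
  finally have "complex_of_nat (card (unit_layer R j)) = of_nat ((r choose j) * 2 ^ j)" by simp
  then show ?thesis unfolding of_nat_eq_iff r_def .
qed

lemma exp_minus_le_inverse: "y > 0 \<Longrightarrow> exp (- y) \<le> 1 / (y::real)"
  using exp_ge_add_one_self[of y] by (simp add: exp_minus divide_simps del: exp_ge_add_one_self)

text \<open>The exponential sum over a layer, divided by the size of the layer, is \<open>O(1 / \<surd>(j (1 - c\<^sup>2)))\<close> where
  \<open>c\<close> is the mean of the cosines. This is the source of decay of the multipliers.\<close>

lemma layer_sum_bound:
  assumes R: "finite R" and j: "1 \<le> j" "2 * j \<le> card R"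
    and c: "c = (\<Sum>i\<in>R. cos (\<xi> i)) / real (card R)"
  shows "cmod (layer_sum R \<xi> j) * sqrt (real j * (1 - c\<^sup>2)) \<le> 18 * real (card (unit_layer R j))"
proof -
  define r where "r = card R"
  have r: "r > 0" "j \<le> r" using j by (auto simp: r_def)
  have "\<bar>\<Sum>i\<in>R. cos (\<xi> i)\<bar> \<le> (\<Sum>i\<in>R. \<bar>cos (\<xi> i)\<bar>)" by (rule sum_abs)
  also have "\<dots> \<le> (\<Sum>i\<in>R. 1)" by (intro sum_mono) simp
  finally have c1: "\<bar>c\<bar> \<le> 1" using r by (simp add: c r_def)
  show ?thesis
  proof (cases "\<bar>c\<bar> = 1")
    case True
    then have "c\<^sup>2 = 1" by (metis power2_abs one_power2)
    then show ?thesis by simp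
  next
    case False
    then have c1: "\<bar>c\<bar> < 1" using c1 by simp
    define b where "b = 1 - c\<^sup>2"
    have b: "b > 0" using c1 by (simp add: b_def abs_square_less_1)
    \<comment> \<open>the binomial distribution with this success probability has mean \<open>j\<close>\<close>
    define p where "p = real j / real r"
    have p: "p > 0" "p \<le> 1/2" using j r by (auto simp: p_def r_def field_simps)
    define J where "J = p * (1 - p) * real r"
    have J: "J \<ge> real j / 2"
    proof -
      have "J = real j * (1 - p)" using r by (simp add: J_def p_def)
      also have "\<dots> \<ge> real j * (1/2)" using p by (intro mult_left_mono) auto
      finally show ?thesis by simp
    qed
    have J0: "J > 0" using J j by simp
    obtain N where N: "N > r"
      and avg: "(\<Sum>k<N. 1 / (1 - c * cos (2 * pi * real k / real N))) \<le> real N * (3 / sqrt b)"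
      using poisson_kernel_average[OF c1] unfolding b_def by blast
    define w where "w = (\<lambda>k. 2 * pi * real k / real N)"
    define \<kappa> where "\<kappa> = (p / 2) ^ j * (1 - p) ^ (r - j)"
    have \<kappa>: "\<kappa> > 0" using p by (simp add: \<kappa>_def)
    have fac: "cmod (of_real (1 - p) + of_real (p * x) * cis t) \<le> exp (- (p * (1 - p) * (1 - x * cos t)))"
      if "\<bar>x\<bar> \<le> 1" for x t
    proof (rule power2_le_imp_le)
      have "(cmod (of_real (1 - p) + of_real (p * x) * cis t))\<^sup>2
          = (1 - p + p * x * cos t)\<^sup>2 + (p * x * sin t)\<^sup>2"
        by (simp add: cmod_power2)
      also have "\<dots> = (1-p)\<^sup>2 + 2 * p * (1 - p) * (x * cos t) + p\<^sup>2 * x\<^sup>2 * ((sin t)\<^sup>2 + (cos t)\<^sup>2)"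
        unfolding power2_eq_square by (simp only: algebra_simps)
      also have "\<dots> \<le> (1-p)\<^sup>2 + 2 * p * (1 - p) * (x * cos t) + p\<^sup>2 * 1"
        using that by (simp add: abs_square_le_1 mult_left_le)
      also have "\<dots> = 1 + (- (2 * (p * (1 - p) * (1 - x * cos t))))"
        unfolding power2_eq_square by (simp add: algebra_simps)
      also have "\<dots> \<le> exp (- (2 * (p * (1 - p) * (1 - x * cos t))))"
        by (rule exp_ge_add_one_self)
      also have "\<dots> = (exp (- (p * (1 - p) * (1 - x * cos t))))\<^sup>2"
        by (simp add: power2_eq_square exp_add[symmetric])
      finally show "(cmod (of_real (1 - p) + of_real (p * x) * cis t))\<^sup>2
        \<le> (exp (- (p * (1 - p) * (1 - x * cos t))))\<^sup>2" .
    qed simp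
    have prod: "cmod (\<Prod>i\<in>R. of_real (1 - p) + of_real (p * cos (\<xi> i)) * cis t)
       \<le> 1 / J * (1 / (1 - c * cos t))" for t
    proof -
      have "\<bar>c * cos t\<bar> \<le> \<bar>c\<bar> * 1" unfolding abs_mult by (intro mult_left_mono) auto
      then have pos: "1 - c * cos t > 0" using c1 by linarith
      have "cmod (\<Prod>i\<in>R. of_real (1 - p) + of_real (p * cos (\<xi> i)) * cis t)
         \<le> (\<Prod>i\<in>R. exp (- (p * (1 - p) * (1 - cos (\<xi> i) * cos t))))"
        unfolding prod_norm[symmetric] using fac by (intro prod_mono) auto
      also have "\<dots> = exp (\<Sum>i\<in>R. - (p * (1 - p) * (1 - cos (\<xi> i) * cos t)))"
        by (rule exp_sum[OF R, symmetric])
      also have "(\<Sum>i\<in>R. - (p * (1 - p) * (1 - cos (\<xi> i) * cos t)))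
          = - (p * (1 - p) * (real r - (\<Sum>i\<in>R. cos (\<xi> i)) * cos t))"
        by (simp add: sum_negf sum_distrib_left[symmetric] sum_distrib_right[symmetric] sum_subtractf r_def)
      also have "(\<Sum>i\<in>R. cos (\<xi> i)) = c * real r" using r by (simp add: c r_def)
      also have "- (p * (1 - p) * (real r - c * real r * cos t)) = - (J * (1 - c * cos t))"
        by (simp add: J_def algebra_simps)
      also have "exp \<dots> \<le> 1 / (J * (1 - c * cos t))"
        using J0 pos by (intro exp_minus_le_inverse) simp
      finally show ?thesis by simp
    qed
    have "real N * (cmod (layer_sum R \<xi> j) * \<kappa>)
        = cmod (of_nat N * (layer_sum R \<xi> j * of_real ((p / 2) ^ j * (1 - p) ^ (card R - j))))"
      using \<kappa> unfolding \<kappa>_def[symmetric] r_def[symmetric] by (simp add: norm_mult del: of_real_mult of_real_power)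
    also have "\<dots> = cmod (\<Sum>k<N. (\<Prod>i\<in>R. of_real (1 - p) + of_real (p * cos (\<xi> i)) * cis (w k))
            * cis (- (w k * real j)))"
      unfolding w_def
      by (subst layer_sum_extract) (use R r N p in \<open>auto simp: r_def\<close>)
    also have "\<dots> \<le> (\<Sum>k<N. cmod (\<Prod>i\<in>R. of_real (1 - p) + of_real (p * cos (\<xi> i)) * cis (w k)))"
      by (rule order_trans[OF norm_sum]) (simp add: norm_mult)
    also have "\<dots> \<le> (\<Sum>k<N. 1 / J * (1 / (1 - c * cos (w k))))"
      by (intro sum_mono prod)
    also have "\<dots> = 1 / J * (\<Sum>k<N. 1 / (1 - c * cos (w k)))" by (simp add: sum_distrib_left)
    also have "\<dots> \<le> 1 / J * (real N * (3 / sqrt b))"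
      using avg J0 unfolding w_def by (intro mult_left_mono) auto
    finally have "real N * (cmod (layer_sum R \<xi> j) * \<kappa>) \<le> real N * (3 / (J * sqrt b))" by simp
    then have "cmod (layer_sum R \<xi> j) * \<kappa> \<le> 3 / (J * sqrt b)"
      by (rule mult_left_le_imp_le) (use N in simp)
    also have "\<dots> \<le> 3 / (real j / 2 * sqrt b)"
      using J j b by (intro divide_left_mono mult_right_mono) auto
    finally have up: "cmod (layer_sum R \<xi> j) * \<kappa> \<le> 6 / (real j * sqrt b)" by simp
    have "1 / (exp 1 * sqrt (real j)) \<le> real (r choose j) * p ^ j * (1 - p) ^ (r - j)"
      unfolding p_def using j r by (intro binomial_mode_lower) auto
    also have "\<dots> = real (card (unit_layer R j)) * \<kappa>"
      using r by (simp add: card_unit_layer[OF R] r_def[symmetric] \<kappa>_def power_divide)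
    \<comment> \<open>the layer contains enough of the binomial mass to compensate the normalisation \<open>\<kappa>\<close>\<close>
    finally have lo: "1 / (exp 1 * sqrt (real j)) \<le> real (card (unit_layer R j)) * \<kappa>" .
    have "cmod (layer_sum R \<xi> j) * sqrt (real j * b) * \<kappa> \<le> 6 / (real j * sqrt b) * sqrt (real j * b)"
      using mult_right_mono[OF up, of "sqrt (real j * b)"] b by (simp add: mult_ac)
    also have "\<dots> = 6 / sqrt (real j)"
      using b j by (simp add: real_sqrt_mult field_simps)
    also have "\<dots> = 6 * exp 1 * (1 / (exp 1 * sqrt (real j)))" by simp
    also have "\<dots> \<le> 18 * (real (card (unit_layer R j)) * \<kappa>)"
      using lo exp_le by (intro mult_mono) auto
    finally have "cmod (layer_sum R \<xi> j) * sqrt (real j * b) * \<kappa>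
        \<le> 18 * real (card (unit_layer R j)) * \<kappa>" by simp
    then show ?thesis using \<kappa> unfolding b_def by simp
  qed
qed

section \<open>Counting lattice points in balls\<close>

text \<open>The contribution \<open>\<bar>a\<bar>\<^sup>q\<close> of an integer coordinate to the defining sum of an \<open>\<ell>\<^sup>q\<close> ball.\<close>

definition qcost :: "real \<Rightarrow> int \<Rightarrow> real" where
  "qcost q a = \<bar>real_of_int a\<bar> powr q"

lemma qcost_nonneg [simp]: "qcost q a \<ge> 0"
  by (simp add: qcost_def)

lemma qcost_0 [simp]: "qcost q 0 = 0"
  by (simp add: qcost_def)

lemma qcost_uminus [simp]: "qcost q (- a) = qcost q a"
  by (simp add: qcost_def)

lemma qcost_unit: "\<bar>a\<bar> = 1 \<Longrightarrow> qcost q a = 1"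
  by (cases "a \<ge> 0") (simp_all add: qcost_def)

lemma qcost_ge_abs:
  assumes "q \<ge> 1"
  shows "\<bar>real_of_int a\<bar> \<le> qcost q a"
proof (cases "a = 0")
  case False
  then have "\<bar>real_of_int a\<bar> \<ge> 1" by linarith
  then have "\<bar>real_of_int a\<bar> powr 1 \<le> \<bar>real_of_int a\<bar> powr q"
    using assms by (intro powr_mono) auto
  then show ?thesis using \<open>\<bar>real_of_int a\<bar> \<ge> 1\<close> by (simp add: qcost_def)
qed simp

text \<open>Integer points supported in the coordinate set \<open>D\<close> of total cost at most \<open>r\<close>. The parameter \<open>r\<close> is
  the \<open>q\<close>-th power of the radius; a general \<open>D\<close> allows slices by one coordinate.\<close>

definition qball :: "nat set \<Rightarrow> real \<Rightarrow> real \<Rightarrow> point set" where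
  "qball D q r = {x. (\<forall>i. i \<notin> D \<longrightarrow> x i = 0) \<and> (\<Sum>i\<in>D. qcost q (x i)) \<le> r}"

lemma finite_qball:
  assumes "finite D" "q \<ge> 1"
  shows "finite (qball D q r)"
proof (rule finite_subset)
  show "qball D q r \<subseteq> funs D {- \<lfloor>r\<rfloor>..\<lfloor>r\<rfloor>}"
  proof
    fix x assume x: "x \<in> qball D q r"
    have "x i \<in> {- \<lfloor>r\<rfloor>..\<lfloor>r\<rfloor>}" if i: "i \<in> D" for i
    proof -
      have "real_of_int \<bar>x i\<bar> \<le> qcost q (x i)" using qcost_ge_abs[OF assms(2), of "x i"] by simp
      also have "\<dots> \<le> (\<Sum>i\<in>D. qcost q (x i))"
        using assms(1) i by (intro member_le_sum) auto
      also have "\<dots> \<le> r" using x by (simp add: qball_def)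
      finally have "\<bar>x i\<bar> \<le> \<lfloor>r\<rfloor>" by (simp add: le_floor_iff)
      then show ?thesis by auto
    qed
    then show "x \<in> funs D {- \<lfloor>r\<rfloor>..\<lfloor>r\<rfloor>}" using x by (auto simp: qball_def funs_def)
  qed
qed (use assms in \<open>simp add: finite_funs\<close>)

lemma qball_empty: "r < 0 \<Longrightarrow> qball D q r = {}"
proof -
  assume "r < 0"
  moreover have "0 \<le> (\<Sum>i\<in>D. qcost q (x i))" for x by (intro sum_nonneg) simp
  ultimately have "\<not> (\<Sum>i\<in>D. qcost q (x i)) \<le> r" for x by (meson leD le_less_trans)
  then show ?thesis by (simp add: qball_def)
qed

lemma card_nonzero_le:
  assumes "finite D" "q \<ge> 1" "x \<in> qball D q r"
  shows "real (card {i \<in> D. x i \<noteq> 0}) \<le> r"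
proof -
  have "real (card {i \<in> D. x i \<noteq> 0}) = (\<Sum>i\<in>{i \<in> D. x i \<noteq> 0}. 1)" by simp
  also have "\<dots> \<le> (\<Sum>i\<in>{i \<in> D. x i \<noteq> 0}. qcost q (x i))"
  proof (rule sum_mono)
    fix i assume "i \<in> {i \<in> D. x i \<noteq> 0}"
    then have "1 \<le> \<bar>real_of_int (x i)\<bar>" by (simp, linarith)
    then show "1 \<le> qcost q (x i)" using qcost_ge_abs[OF assms(2), of "x i"] by linarith
  qed
  also have "\<dots> \<le> (\<Sum>i\<in>D. qcost q (x i))"
    using assms(1) by (intro sum_mono2) auto
  also have "\<dots> \<le> r" using assms(3) by (simp add: qball_def)
  finally show ?thesis .
qed

text \<open>Changing a zero coordinate of a point of cost at most \<open>r - 1\<close> to \<open>1\<close> or \<open>-1\<close> gives a point of cost at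
  most \<open>r\<close>. Each point of the smaller ball has many images, and a point of the larger ball is obtained at
  most \<open>r\<close> times since it has at most \<open>r\<close> nonzero coordinates.\<close>

lemma qball_double_count:
  assumes D: "finite D" and q: "q \<ge> 1" and r: "r \<ge> 0"
  shows "2 * (real (card D) - r) * real (card (qball D q (r - 1))) \<le> r * real (card (qball D q r))"
proof -
  define P where "P = (SIGMA x:qball D q (r - 1). {i \<in> D. x i = 0} \<times> {-1, 1::int})"
  define T where "T = (SIGMA y:qball D q r. {i \<in> D. \<bar>y i\<bar> = 1})"
  define \<phi> where "\<phi> = (\<lambda>(x :: nat \<Rightarrow> int, i, v). (x(i := v), i))"
  have finT: "finite T" unfolding T_def using D q by (intro finite_SigmaI finite_qball) auto
  have inj: "inj_on \<phi> P"
  proof (rule inj_onI)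
    fix a b assume ab: "a \<in> P" "b \<in> P" "\<phi> a = \<phi> b"
    obtain x i v where a: "a = (x, i, v)" by (cases a)
    obtain x' i' v' where b: "b = (x', i', v')" by (cases b)
    have i: "i = i'" and upd: "x(i := v) = x'(i := v')" using ab(3) by (auto simp: a b \<phi>_def)
    have "v = v'" using fun_cong[OF upd, of i] by simp
    moreover have "x k = x' k" for k
      using fun_cong[OF upd, of k] ab(1,2) i by (cases "k = i") (auto simp: a b P_def)
    ultimately show "a = b" using i by (auto simp: a b)
  qed
  have im: "\<phi> ` P \<subseteq> T"
  proof
    fix t assume "t \<in> \<phi> ` P"
    then obtain x i v where x: "x \<in> qball D q (r - 1)" "i \<in> D" "x i = 0" "v = -1 \<or> v = 1"
      and t: "t = (x(i := v), i)" by (auto simp: \<phi>_def P_def)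
    have "(\<Sum>k\<in>D. qcost q ((x(i := v)) k)) = qcost q v + (\<Sum>k\<in>D - {i}. qcost q (x k))"
      using D x(2) by (subst sum.remove[of D i]) (auto intro!: sum.cong)
    also have "qcost q v = 1" using x(4) by (intro qcost_unit) auto
    also have "(\<Sum>k\<in>D - {i}. qcost q (x k)) = (\<Sum>k\<in>D. qcost q (x k))"
      using D x(2,3) by (subst sum.remove[of D i]) auto
    also have "1 + \<dots> \<le> r" using x(1) by (simp add: qball_def)
    finally show "t \<in> T" using x t by (auto simp: T_def qball_def)
  qed
  have "2 * (real (card D) - r) * real (card (qball D q (r - 1)))
      = (\<Sum>x\<in>qball D q (r - 1). 2 * (real (card D) - r))" by simp
  also have "\<dots> \<le> (\<Sum>x\<in>qball D q (r - 1). real (card ({i \<in> D. x i = 0} \<times> {-1, 1::int})))"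
  proof (rule sum_mono)
    fix x assume x: "x \<in> qball D q (r - 1)"
    have "card D = card ({i \<in> D. x i = 0} \<union> {i \<in> D. x i \<noteq> 0})"
      by (rule arg_cong[where f = card]) auto
    also have "\<dots> = card {i \<in> D. x i = 0} + card {i \<in> D. x i \<noteq> 0}"
      using D by (intro card_Un_disjoint) auto
    finally have "real (card D) - r \<le> real (card {i \<in> D. x i = 0})"
      using card_nonzero_le[OF D q x] by simp
    then show "2 * (real (card D) - r) \<le> real (card ({i \<in> D. x i = 0} \<times> {-1, 1::int}))"
      by (simp add: card_cartesian_product)
  qed
  also have "\<dots> = real (card P)"
    unfolding P_def using D q by (subst card_SigmaI) (auto simp: finite_qball)
  also have "\<dots> \<le> real (card T)"
    using card_inj_on_le[OF inj im finT] by simp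
  also have "\<dots> = (\<Sum>y\<in>qball D q r. real (card {i \<in> D. \<bar>y i\<bar> = 1}))"
    unfolding T_def using D q by (subst card_SigmaI) (auto simp: finite_qball)
  also have "\<dots> \<le> (\<Sum>y\<in>qball D q r. r)"
  proof (rule sum_mono)
    fix y assume y: "y \<in> qball D q r"
    have "card {i \<in> D. \<bar>y i\<bar> = 1} \<le> card {i \<in> D. y i \<noteq> 0}"
      using D by (intro card_mono) auto
    then show "real (card {i \<in> D. \<bar>y i\<bar> = 1}) \<le> r" using card_nonzero_le[OF D q y] by simp
  qed
  finally show ?thesis by (simp add: mult.commute)
qed

lemma qball_shrink:
  assumes D: "finite D" and q: "q \<ge> 1" and K: "1 \<le> K" "4 * K \<le> d" and m: "d \<le> real (card D) + 1" and r: "r \<le> K"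
  shows "real (card (qball D q (r - real n))) \<le> (K / d) ^ n * real (card (qball D q r))"
proof (induction n)
  case (Suc n)
  define t where "t = r - real n"
  define V where "V = (\<lambda>s. real (card (qball D q s)))"
  have d: "d > 0" using K by linarith
  have step: "V (t - 1) \<le> K / d * V t"
  proof (cases "t \<ge> 0")
    case True
    have t: "t \<le> K" using r by (simp add: t_def)
    have "d * V (t - 1) \<le> 2 * (real (card D) - t) * V (t - 1)"
      using K m t unfolding V_def by (intro mult_right_mono) auto
    also have "\<dots> \<le> t * V t" unfolding V_def by (rule qball_double_count[OF D q True])
    also have "\<dots> \<le> K * V t" using t by (intro mult_right_mono) (auto simp: V_def)
    finally show ?thesis using d by (simp add: field_simps)
  next
    case False
    then have "V (t - 1) = 0" unfolding V_def by (subst qball_empty) auto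
    then show ?thesis using K d by (simp add: V_def)
  qed
  have "V (r - real (Suc n)) = V (t - 1)" by (simp add: t_def algebra_simps)
  also have "\<dots> \<le> K / d * V t" by (rule step)
  also have "\<dots> \<le> K / d * ((K / d) ^ n * V r)"
    using Suc K d unfolding V_def t_def by (intro mult_left_mono) auto
  finally show ?case by (simp add: V_def)
qed simp

lemma qball_slice:
  assumes q: "q \<ge> 1" and K: "1 \<le> K" "4 * K \<le> real d" and i: "i < d"
  shows "real (card {x \<in> qball {..<d} q K. x i = a})
      \<le> (K / real d) ^ nat \<lfloor>qcost q a\<rfloor> * real (card (qball {..<d} q K))"
proof -
  define D where "D = {..<d} - {i}"
  define m where "m = nat \<lfloor>qcost q a\<rfloor>"
  have D: "finite D" by (simp add: D_def)
  have m: "real m \<le> qcost q a"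
    unfolding m_def by (simp add: of_nat_nat)
  have ins: "(\<Sum>k<d. qcost q (x k)) = qcost q (x i) + (\<Sum>k\<in>D. qcost q (x k))" for x
    unfolding D_def using i by (intro sum.remove) auto
  have "card {x \<in> qball {..<d} q K. x i = a} \<le> card (qball D q (K - real m))"
  proof (rule card_inj_on_le)
    show "inj_on (\<lambda>x. x(i := 0)) {x \<in> qball {..<d} q K. x i = a}"
    proof (rule inj_onI)
      fix x y :: "nat \<Rightarrow> int" assume xy: "x \<in> {x \<in> qball {..<d} q K. x i = a}" "y \<in> {x \<in> qball {..<d} q K. x i = a}"
        "x(i := 0) = y(i := 0)"
      have "x k = y k" for k using fun_cong[OF xy(3), of k] xy(1,2) by (cases "k = i") auto
      then show "x = y" by auto
    qed
    show "(\<lambda>x. x(i := 0)) ` {x \<in> qball {..<d} q K. x i = a} \<subseteq> qball D q (K - real m)"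
    proof clarsimp
      fix x assume x: "x \<in> qball {..<d} q K" "a = x i"
      have "(\<Sum>k\<in>D. qcost q ((x(i := 0)) k)) = (\<Sum>k\<in>D. qcost q (x k))"
        by (intro sum.cong) (auto simp: D_def)
      also have "\<dots> \<le> K - real m" using x ins[of x] m by (simp add: qball_def)
      finally show "x(i := 0) \<in> qball D q (K - real m)"
        using x(1) by (auto simp: qball_def D_def)
    qed
  qed (rule finite_qball[OF D q])
  then have "real (card {x \<in> qball {..<d} q K. x i = a}) \<le> real (card (qball D q (K - real m)))" by simp
  also have "\<dots> \<le> (K / real d) ^ m * real (card (qball D q K))"
    by (rule qball_shrink) (use D q K i in \<open>auto simp: D_def\<close>)
  also have "\<dots> \<le> (K / real d) ^ m * real (card (qball {..<d} q K))"
  proof (intro mult_left_mono of_nat_mono card_mono)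
    show "qball D q K \<subseteq> qball {..<d} q K"
    proof
      fix x assume x: "x \<in> qball D q K"
      then have "x i = 0" by (simp add: qball_def D_def)
      then show "x \<in> qball {..<d} q K" using x i ins[of x] by (auto simp: qball_def D_def)
    qed
  qed (use K q in \<open>auto simp: finite_qball\<close>)
  finally show ?thesis by (simp add: m_def)
qed

lemma sum_half_powers: "(\<Sum>a\<in>{- int L..int L}. (1/2::real) ^ nat \<bar>a\<bar>) = 3 - 2 * (1/2) ^ L"
proof (induction L)
  case (Suc L)
  have "{- int (Suc L)..int (Suc L)} = insert (int (Suc L)) (insert (- int (Suc L)) {- int L..int L})"
    by auto
  then have "(\<Sum>a\<in>{- int (Suc L)..int (Suc L)}. (1/2::real) ^ nat \<bar>a\<bar>)
     = (1/2) ^ Suc L + (1/2) ^ Suc L + (3 - 2 * (1/2) ^ L)"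
    by (simp add: Suc nat_add_distrib del: of_nat_Suc power_Suc)
  then show ?case by simp
qed simp

text \<open>Expectation of a weight of one coordinate, when the geometric decay of the distribution of that coordinate
  dominates the weight.\<close>

lemma qball_moment:
  assumes q: "q \<ge> 1" and K: "1 \<le> K" "4 * K \<le> real d" and i: "i < d"
    and w: "\<And>a. w a \<ge> 0" "\<And>a. w a * (K / real d) ^ nat \<lfloor>qcost q a\<rfloor> \<le> c * (1/2) ^ nat \<bar>a\<bar>"
  shows "(\<Sum>x\<in>qball {..<d} q K. w (x i)) \<le> 3 * c * real (card (qball {..<d} q K))"
proof -
  define B where "B = qball {..<d} q K"
  have B: "finite B" unfolding B_def using q by (simp add: finite_qball)
  have c: "c \<ge> 0" using w(2)[of 0] w(1)[of 0] by simp
  define L where "L = nat (Max ((\<lambda>x. \<bar>x i\<bar>) ` insert 0 B))"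
  have im: "(\<lambda>x. x i) ` B \<subseteq> {- int L..int L}"
  proof clarify
    fix x assume "x \<in> B"
    then have "\<bar>x i\<bar> \<le> Max ((\<lambda>x. \<bar>x i\<bar>) ` insert 0 B)"
      using B by (intro Max_ge) auto
    then show "x i \<in> {- int L..int L}" by (auto simp: L_def)
  qed
  have "(\<Sum>x\<in>B. w (x i)) = (\<Sum>a\<in>{- int L..int L}. \<Sum>x\<in>{x \<in> B. x i = a}. w (x i))"
    by (rule sum.group[symmetric]) (use B im in auto)
  also have "\<dots> = (\<Sum>a\<in>{- int L..int L}. w a * real (card {x \<in> B. x i = a}))"
    by (intro sum.cong refl) (simp add: mult.commute)
  also have "\<dots> \<le> (\<Sum>a\<in>{- int L..int L}. c * (1/2) ^ nat \<bar>a\<bar> * real (card B))"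
  proof (rule sum_mono)
    fix a
    have "w a * real (card {x \<in> B. x i = a}) \<le> w a * ((K / real d) ^ nat \<lfloor>qcost q a\<rfloor> * real (card B))"
      unfolding B_def using w(1) by (intro mult_left_mono qball_slice q K i)
    also have "\<dots> \<le> c * (1/2) ^ nat \<bar>a\<bar> * real (card B)"
      using mult_right_mono[OF w(2)[of a], of "real (card B)"] by (simp add: mult.assoc)
    finally show "w a * real (card {x \<in> B. x i = a}) \<le> c * (1/2) ^ nat \<bar>a\<bar> * real (card B)" .
  qed
  also have "\<dots> = c * real (card B) * (\<Sum>a\<in>{- int L..int L}. (1/2) ^ nat \<bar>a\<bar>)"
    by (simp add: sum_distrib_left mult_ac)
  also have "\<dots> \<le> c * real (card B) * 3"
    unfolding sum_half_powers using c by (intro mult_left_mono) auto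
  finally show ?thesis by (simp add: B_def mult_ac)
qed

lemma square_le_four_two_power: "(n::nat)\<^sup>2 \<le> 4 * 2 ^ n"
proof -
  have "n\<^sup>2 + 2 * n + 3 \<le> 4 * 2 ^ n"
  proof (induction n)
    case (Suc n)
    have "(Suc n)\<^sup>2 + 2 * Suc n + 3 \<le> 2 * (n\<^sup>2 + 2 * n + 3)"
      by (simp add: power2_eq_square)
    also have "\<dots> \<le> 2 * (4 * 2 ^ n)" using Suc by (intro mult_left_mono) auto
    finally show ?case by simp
  qed simp
  then show ?thesis by linarith
qed

lemma qball_second_moment:
  assumes q: "q \<ge> 1" and K: "1 \<le> K" "4 * K \<le> real d" and i: "i < d"
  shows "(\<Sum>x\<in>qball {..<d} q K. (real_of_int (x i))\<^sup>2) \<le> 48 * (K / real d) * real (card (qball {..<d} q K))"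
proof -
  define \<rho> where "\<rho> = K / real d"
  have \<rho>: "0 \<le> \<rho>" "\<rho> \<le> 1/4" using K by (auto simp: \<rho>_def field_simps)
  have "(real_of_int a)\<^sup>2 * \<rho> ^ nat \<lfloor>qcost q a\<rfloor> \<le> 16 * \<rho> * (1/2) ^ nat \<bar>a\<bar>" for a
  proof (cases "a = 0")
    case False
    define n where "n = nat \<bar>a\<bar>"
    have n: "n \<ge> 1" "\<bar>real_of_int a\<bar> = real n" using False by (auto simp: n_def)
    have "real_of_int (int n) \<le> qcost q a" using qcost_ge_abs[OF q, of a] n by simp
    then have "int n \<le> \<lfloor>qcost q a\<rfloor>" by (simp only: le_floor_iff)
    then have "\<rho> ^ nat \<lfloor>qcost q a\<rfloor> \<le> \<rho> ^ n" using \<rho> by (intro power_decreasing) auto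
    also have "\<dots> = \<rho> * \<rho> ^ (n - 1)" using n by (cases n) auto
    also have "\<dots> \<le> \<rho> * (1/4) ^ (n - 1)" using \<rho> by (intro mult_left_mono power_mono) auto
    also have "\<dots> = 4 * \<rho> * ((1/2) ^ n * (1/2) ^ n)"
      using n by (cases n) (auto simp: power_mult_distrib[symmetric])
    finally have "(real_of_int a)\<^sup>2 * \<rho> ^ nat \<lfloor>qcost q a\<rfloor> \<le> (real n)\<^sup>2 * (4 * \<rho> * ((1/2) ^ n * (1/2) ^ n))"
      using n \<rho> by (intro mult_mono) (auto simp: abs_le_square_iff[symmetric])
    also have "\<dots> \<le> (4 * 2 ^ n) * (4 * \<rho> * ((1/2) ^ n * (1/2) ^ n))"
    proof (rule mult_right_mono)
      have "real (n\<^sup>2) \<le> real (4 * 2 ^ n)" unfolding of_nat_le_iff by (rule square_le_four_two_power)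
      then show "(real n)\<^sup>2 \<le> 4 * 2 ^ n" by simp
    qed (use \<rho> in auto)
    also have "\<dots> = 16 * \<rho> * (1/2) ^ n" by (simp add: power_divide)
    finally show ?thesis by (simp add: n_def)
  qed (use \<rho> in simp)
  then have "(\<Sum>x\<in>qball {..<d} q K. (real_of_int (x i))\<^sup>2) \<le> 3 * (16 * \<rho>) * real (card (qball {..<d} q K))"
    unfolding \<rho>_def by (intro qball_moment[where w = "\<lambda>a. (real_of_int a)\<^sup>2"] q K i) auto
  then show ?thesis by (simp add: \<rho>_def)
qed

text \<open>The cost of a coordinate, counted only if it is neither \<open>0\<close> nor \<open>\<plusminus>1\<close>.\<close>

definition bigcost :: "real \<Rightarrow> int \<Rightarrow> real" where
  "bigcost q a = (if \<bar>a\<bar> \<ge> 2 then qcost q a else 0)"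

lemma bigcost_nonneg [simp]: "bigcost q a \<ge> 0"
  by (simp add: bigcost_def)

lemma qball_big_moment:
  assumes q: "q \<ge> 1" and K: "1 \<le> K" "4 * K \<le> real d" and i: "i < d"
  shows "(\<Sum>x\<in>qball {..<d} q K. bigcost q (x i)) \<le> 96 * (K / real d)\<^sup>2 * real (card (qball {..<d} q K))"
proof -
  define \<rho> where "\<rho> = K / real d"
  have \<rho>: "0 \<le> \<rho>" "\<rho> \<le> 1/4" using K by (auto simp: \<rho>_def field_simps)
  have "bigcost q a * \<rho> ^ nat \<lfloor>qcost q a\<rfloor> \<le> 32 * \<rho>\<^sup>2 * (1/2) ^ nat \<bar>a\<bar>" for a
  proof (cases "\<bar>a\<bar> \<ge> 2")
    case True
    define m where "m = nat \<lfloor>qcost q a\<rfloor>"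
    have "real_of_int \<bar>a\<bar> \<le> qcost q a" using qcost_ge_abs[OF q, of a] by simp
    then have fl: "\<bar>a\<bar> \<le> \<lfloor>qcost q a\<rfloor>" by (simp only: le_floor_iff)
    have m2: "m \<ge> 2" "nat \<bar>a\<bar> \<le> m" using fl True by (auto simp: m_def)
    have "qcost q a < real_of_int \<lfloor>qcost q a\<rfloor> + 1" by linarith
    also have "real_of_int \<lfloor>qcost q a\<rfloor> = real m" by (simp add: m_def of_nat_nat)
    finally have c: "qcost q a \<le> 2 * real m" using m2 by simp
    have "qcost q a * \<rho> ^ m \<le> 2 * real m * \<rho> ^ m" using c \<rho> by (intro mult_right_mono) auto
    also have "2 * real m * \<rho> ^ m = 2 * real m * (\<rho>\<^sup>2 * \<rho> ^ (m - 2))"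
      using m2 by (simp only: power_add[symmetric] le_add_diff_inverse)
    also have "\<dots> \<le> 2 * real m * (\<rho>\<^sup>2 * (1/4) ^ (m - 2))"
      using \<rho> by (intro mult_left_mono power_mono) auto
    also have "(1/4::real) ^ (m - 2) = 16 * ((1/2) ^ m * (1/2) ^ m)"
    proof -
      have "(1/4::real) ^ m = (1/4) ^ 2 * (1/4) ^ (m - 2)" using m2 by (simp only: power_add[symmetric] le_add_diff_inverse)
      moreover have "(1/4::real) ^ m = (1/2) ^ m * (1/2) ^ m" by (simp add: power_mult_distrib[symmetric])
      ultimately show ?thesis by (simp add: power2_eq_square)
    qed
    also have "2 * real m * (\<rho>\<^sup>2 * (16 * ((1/2) ^ m * (1/2) ^ m))) = 32 * \<rho>\<^sup>2 * (real m * (1/2) ^ m) * (1/2) ^ m"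
      by simp
    also have "\<dots> \<le> 32 * \<rho>\<^sup>2 * 1 * (1/2) ^ m"
    proof (intro mult_right_mono mult_left_mono)
      have "real m \<le> 2 ^ m" by (rule of_nat_less_two_power[THEN less_imp_le])
      then show "real m * (1/2) ^ m \<le> 1" by (simp add: power_divide)
    qed auto
    also have "\<dots> \<le> 32 * \<rho>\<^sup>2 * 1 * (1/2) ^ nat \<bar>a\<bar>"
      using m2 by (intro mult_left_mono power_decreasing) auto
    finally show ?thesis using True by (simp add: bigcost_def m_def)
  qed (simp add: bigcost_def)
  then have "(\<Sum>x\<in>qball {..<d} q K. bigcost q (x i)) \<le> 3 * (32 * \<rho>\<^sup>2) * real (card (qball {..<d} q K))"
    unfolding \<rho>_def by (intro qball_moment[where w = "bigcost q"] q K i) auto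
  then show ?thesis by (simp add: \<rho>_def)
qed

section \<open>Exponential sums over balls\<close>

text \<open>The character of \<open>\<int>\<^sup>d\<close> with frequency \<open>\<xi>\<close>; only the entries \<open>\<xi> i\<close> with \<open>i < d\<close> matter.\<close>

definition chi :: "nat \<Rightarrow> (nat \<Rightarrow> real) \<Rightarrow> point \<Rightarrow> complex" where
  "chi d \<xi> x = (\<Prod>i<d. cis (\<xi> i * real_of_int (x i)))"

lemma norm_chi [simp]: "cmod (chi d \<xi> x) = 1"
  by (simp add: chi_def prod_norm[symmetric])

lemma abs_sin_multiple_le: "\<bar>sin (real n * x)\<bar> \<le> real n * \<bar>sin x\<bar>"
proof (induction n)
  case (Suc n)
  have "\<bar>sin (real (Suc n) * x)\<bar> = \<bar>sin (real n * x) * cos x + cos (real n * x) * sin x\<bar>"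
    using sin_add[of "real n * x" x] by (simp add: distrib_right add.commute)
  also have "\<dots> \<le> \<bar>sin (real n * x)\<bar> * 1 + 1 * \<bar>sin x\<bar>"
    by (rule order_trans[OF abs_triangle_ineq])
       (unfold abs_mult, intro add_mono mult_mono abs_cos_le_one, auto)
  also have "\<dots> \<le> real (Suc n) * \<bar>sin x\<bar>" using Suc by (simp add: distrib_right)
  finally show ?case .
qed simp

lemma one_minus_cos_multiple_le:
  "1 - cos (x * real_of_int a) \<le> (real_of_int a)\<^sup>2 * (1 - cos x)"
proof -
  define n where "n = nat \<bar>a\<bar>"
  have n: "\<bar>real_of_int a\<bar> = real n" by (simp add: n_def)
  have half: "1 - cos y = 2 * (sin (y / 2))\<^sup>2" for y :: real
    using cos_double_sin[of "y / 2"] by simp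
  have "cos (x * real_of_int a) = cos \<bar>x * real_of_int a\<bar>" by simp
  also have "\<dots> = cos \<bar>real n * x\<bar>" unfolding abs_mult n by (simp add: mult.commute)
  also have "\<dots> = cos (real n * x)" by simp
  finally have "1 - cos (x * real_of_int a) = 2 * (sin (real n * (x / 2)))\<^sup>2"
    by (simp add: half)
  also have "\<dots> \<le> 2 * (real n * \<bar>sin (x / 2)\<bar>)\<^sup>2"
    using abs_sin_multiple_le[of n "x / 2"] by (intro mult_left_mono power2_le_iff_abs_le[THEN iffD2]) auto
  also have "\<dots> = (real n)\<^sup>2 * (1 - cos x)" by (simp add: half power_mult_distrib)
  also have "(real n)\<^sup>2 = (real_of_int a)\<^sup>2" unfolding n[symmetric] by simp
  finally show ?thesis .
qed

lemma qball_flip: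
  "(\<lambda>x. x(i := - x i)) ` qball D q r = qball D q r"
proof -
  have sub: "x(i := - x i) \<in> qball D q r" if "x \<in> qball D q r" for x
  proof -
    have "(\<Sum>k\<in>D. qcost q ((x(i := - x i)) k)) = (\<Sum>k\<in>D. qcost q (x k))"
      by (intro sum.cong) auto
    then show ?thesis using that by (auto simp: qball_def)
  qed
  show ?thesis
  proof (intro set_eqI iffI)
    fix x assume x: "x \<in> qball D q r"
    have "x = (\<lambda>x. x(i := - x i)) (x(i := - x i))" by auto
    then show "x \<in> (\<lambda>x. x(i := - x i)) ` qball D q r" using sub[OF x] by blast
  qed (use sub in auto)
qed

lemma inj_flip: "inj (\<lambda>x. x(i := - x i :: int))"
proof (rule injI)
  fix x y :: "'a \<Rightarrow> int" assume eq: "x(i := - x i) = y(i := - y i)"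
  have "x k = y k" for k using fun_cong[OF eq, of k] by (cases "k = i") auto
  then show "x = y" by auto
qed

text \<open>The coordinates are processed one at a time. Averaging over the reflection of one coordinate replaces its
  factor \<open>cis (\<xi>\<^sub>i x\<^sub>i)\<close> by \<open>cos (\<xi>\<^sub>i x\<^sub>i)\<close>, which makes the error quadratic in \<open>x\<^sub>i\<close>.\<close>

lemma chi_sum_low:
  assumes q: "q \<ge> 1" and K: "1 \<le> K" "4 * K \<le> real d"
  shows "cmod (of_nat (card (qball {..<d} q K)) - (\<Sum>x\<in>qball {..<d} q K. chi d \<xi> x))
       \<le> 48 * (K / real d) * (\<Sum>i<d. 1 - cos (\<xi> i)) * real (card (qball {..<d} q K))"
proof -
  define B where "B = qball {..<d} q K"
  define M where "M = 48 * (K / real d) * real (card B)"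
  have step: "cmod ((\<Sum>x\<in>B. chi n \<xi> x) - (\<Sum>x\<in>B. chi (Suc n) \<xi> x)) \<le> M * (1 - cos (\<xi> n))"
    if n: "n < d" for n
  proof -
    \<comment> \<open>\<open>chi n\<close> involves only the coordinates below \<open>n\<close>\<close>
    have chi_flip: "chi n \<xi> (x(n := - x n)) = chi n \<xi> x" for x
      by (simp add: chi_def)
    have "(\<Sum>x\<in>B. chi n \<xi> x * cis (\<xi> n * real_of_int (x n)))
        = (\<Sum>x\<in>(\<lambda>x. x(n := - x n)) ` B. chi n \<xi> x * cis (\<xi> n * real_of_int (x n)))"
      unfolding B_def qball_flip ..
    also have "\<dots> = (\<Sum>x\<in>B. chi n \<xi> x * cis (- (\<xi> n * real_of_int (x n))))"
      by (subst sum.reindex[OF inj_on_subset[OF inj_flip subset_UNIV]]) (simp add: chi_flip)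
    finally have "2 * (\<Sum>x\<in>B. chi n \<xi> x * cis (\<xi> n * real_of_int (x n)))
      = (\<Sum>x\<in>B. chi n \<xi> x * (cis (\<xi> n * real_of_int (x n)) + cis (- (\<xi> n * real_of_int (x n)))))"
      unfolding distrib_left sum.distrib mult_2 by (rule arg_cong)
    also have "\<dots> = 2 * (\<Sum>x\<in>B. chi n \<xi> x * of_real (cos (\<xi> n * real_of_int (x n))))"
      unfolding sum_distrib_left by (intro sum.cong refl) (simp add: complex_eq_iff)
    finally have "(\<Sum>x\<in>B. chi (Suc n) \<xi> x) = (\<Sum>x\<in>B. chi n \<xi> x * of_real (cos (\<xi> n * real_of_int (x n))))"
      by (simp add: chi_def)
    then have "(\<Sum>x\<in>B. chi n \<xi> x) - (\<Sum>x\<in>B. chi (Suc n) \<xi> x)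
       = (\<Sum>x\<in>B. chi n \<xi> x * of_real (1 - cos (\<xi> n * real_of_int (x n))))"
      unfolding of_real_diff right_diff_distrib sum_subtractf by simp
    then have "cmod ((\<Sum>x\<in>B. chi n \<xi> x) - (\<Sum>x\<in>B. chi (Suc n) \<xi> x))
       \<le> (\<Sum>x\<in>B. cmod (chi n \<xi> x * of_real (1 - cos (\<xi> n * real_of_int (x n)))))"
      by (simp only: norm_sum)
    also have "\<dots> = (\<Sum>x\<in>B. 1 - cos (\<xi> n * real_of_int (x n)))"
      by (simp add: norm_mult norm_of_real del: of_real_diff)
    also have "\<dots> \<le> (\<Sum>x\<in>B. (real_of_int (x n))\<^sup>2 * (1 - cos (\<xi> n)))"
      by (intro sum_mono one_minus_cos_multiple_le)
    also have "\<dots> = (\<Sum>x\<in>B. (real_of_int (x n))\<^sup>2) * (1 - cos (\<xi> n))"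
      by (simp add: sum_distrib_right)
    also have "\<dots> \<le> M * (1 - cos (\<xi> n))"
      unfolding M_def B_def by (intro mult_right_mono qball_second_moment q K n) simp
    finally show ?thesis .
  qed
  have "cmod (of_nat (card B) - (\<Sum>x\<in>B. chi n \<xi> x)) \<le> M * (\<Sum>i<n. 1 - cos (\<xi> i))" if "n \<le> d" for n
    using that
  proof (induction n)
    case (Suc n)
    have "cmod (of_nat (card B) - (\<Sum>x\<in>B. chi (Suc n) \<xi> x))
       = cmod ((of_nat (card B) - (\<Sum>x\<in>B. chi n \<xi> x)) + ((\<Sum>x\<in>B. chi n \<xi> x) - (\<Sum>x\<in>B. chi (Suc n) \<xi> x)))"
      by simp
    also have "\<dots> \<le> M * (\<Sum>i<n. 1 - cos (\<xi> i)) + M * (1 - cos (\<xi> n))"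
      using Suc step[of n] by (intro norm_triangle_mono) auto
    finally show ?case by (simp add: distrib_left)
  qed (simp add: chi_def)
  from this[of d] show ?thesis by (simp add: B_def M_def mult_ac)
qed

text \<open>The part of a point made of its coordinates of modulus at least \<open>2\<close>.\<close>

definition bigpart :: "point \<Rightarrow> nat \<Rightarrow> int" where
  "bigpart x = (\<lambda>i. if \<bar>x i\<bar> \<ge> 2 then x i else 0)"

text \<open>The number of coordinates equal to \<open>\<plusminus>1\<close>.\<close>

definition ones :: "nat \<Rightarrow> point \<Rightarrow> nat" where
  "ones d x = card {i. i < d \<and> \<bar>x i\<bar> = 1}"

lemma qcost_bigpart: "qcost q (bigpart x i) = bigcost q (x i)"
  by (simp add: bigpart_def bigcost_def)

lemma qcost_split: "(\<Sum>i<d. qcost q (x i)) = (\<Sum>i<d. bigcost q (x i)) + real (ones d x)"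
proof -
  have pt: "qcost q a = bigcost q a + (if \<bar>a\<bar> = 1 then 1 else 0)" for a
  proof -
    consider "a = 0" | "\<bar>a\<bar> = 1" | "\<bar>a\<bar> \<ge> 2" by linarith
    then show ?thesis by cases (auto simp: bigcost_def qcost_unit)
  qed
  have "(\<Sum>i<d. qcost q (x i)) = (\<Sum>i<d. bigcost q (x i)) + (\<Sum>i<d. if \<bar>x i\<bar> = 1 then 1 else 0)"
    by (subst pt) (simp add: sum.distrib)
  also have "(\<Sum>i<d. if \<bar>x i\<bar> = 1 then 1 else 0) = real (ones d x)"
    by (simp add: ones_def sum.If_cases Int_def)
  finally show ?thesis .
qed

text \<open>The points of a ball with prescribed big part and prescribed number of coordinates \<open>\<plusminus>1\<close> form a
  translate of a layer, because membership in the ball depends on these two data only.\<close>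

lemma fiber_eq:
  assumes x0: "x0 \<in> qball {..<d} q K" and z: "z = bigpart x0" and j: "j = ones d x0"
    and R: "R = {i. i < d \<and> z i = 0}"
  shows "{x \<in> qball {..<d} q K. (bigpart x, ones d x) = (z, j)} = (\<lambda>y i. z i + y i) ` unit_layer R j"
proof (intro set_eqI iffI)
  fix x assume "x \<in> {x \<in> qball {..<d} q K. (bigpart x, ones d x) = (z, j)}"
  then have x: "x \<in> qball {..<d} q K" "bigpart x = z" "ones d x = j" by auto
  define y where "y = (\<lambda>i. x i - z i)"
  have zi: "z i = (if \<bar>x i\<bar> \<ge> 2 then x i else 0)" for i
    unfolding x(2)[symmetric] bigpart_def ..
  have yi: "y i = (if \<bar>x i\<bar> \<ge> 2 then 0 else x i)" for i by (simp add: y_def zi)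
  have xout: "x i = 0" if "i \<ge> d" for i using x(1) that by (simp add: qball_def)
  have "y \<in> funs R {-1, 0, 1}"
    unfolding funs_def mem_Collect_eq
  proof (intro conjI allI impI ballI)
    fix i assume "i \<notin> R"
    then show "y i = 0" using xout[of i] by (cases "i < d") (auto simp: yi R zi split: if_splits)
  next
    fix i
    consider "\<bar>x i\<bar> \<ge> 2" | "x i = -1" | "x i = 0" | "x i = 1" by linarith
    then show "y i \<in> {-1, 0, 1}" by cases (simp_all add: yi)
  qed
  moreover have "(\<Sum>i\<in>R. nat \<bar>y i\<bar>) = j"
  proof -
    have "j = (\<Sum>i\<in>{i. i < d \<and> \<bar>x i\<bar> = 1}. 1)" using x(3) by (simp add: ones_def)
    also have "\<dots> = (\<Sum>i\<in>R. nat \<bar>y i\<bar>)"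
    proof (rule sum.mono_neutral_cong_left)
      show "{i. i < d \<and> \<bar>x i\<bar> = 1} \<subseteq> R" by (auto simp: R zi)
      show "\<forall>i\<in>R - {i. i < d \<and> \<bar>x i\<bar> = 1}. nat \<bar>y i\<bar> = 0"
      proof
        fix i assume "i \<in> R - {i. i < d \<and> \<bar>x i\<bar> = 1}"
        then have "\<bar>x i\<bar> \<noteq> 1" by (simp add: R)
        then consider "\<bar>x i\<bar> \<ge> 2" | "x i = 0" by linarith
        then show "nat \<bar>y i\<bar> = 0" by cases (simp_all add: yi)
      qed
    qed (simp_all add: R yi)
    finally show ?thesis ..
  qed
  ultimately have "y \<in> unit_layer R j" by (simp add: unit_layer_def)
  moreover have "x = (\<lambda>i. z i + y i)" by (simp add: y_def)
  ultimately show "x \<in> (\<lambda>y i. z i + y i) ` unit_layer R j" by blast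
next
  fix x assume "x \<in> (\<lambda>y i. z i + y i) ` unit_layer R j"
  then obtain y where y: "y \<in> funs R {-1, 0, 1}" "(\<Sum>i\<in>R. nat \<bar>y i\<bar>) = j"
    and x: "x = (\<lambda>i. z i + y i)" by (auto simp: unit_layer_def)
  have z2: "z i = 0 \<or> \<bar>z i\<bar> \<ge> 2" for i by (auto simp: z bigpart_def)
  have y2: "y i = -1 \<or> y i = 0 \<or> y i = 1" for i
    using y(1) by (cases "i \<in> R") (auto simp: funs_def)
  have yR: "y i = 0" if "i \<notin> R" for i using y(1) that by (auto simp: funs_def)
  have zout: "z i = 0" if "i \<ge> d" for i using x0 that by (auto simp: z bigpart_def qball_def)
  have yz: "y i = 0 \<or> z i = 0" for i using yR[of i] by (auto simp: R)
  have big: "bigpart x = z"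
  proof
    fix i show "bigpart x i = z i"
      using z2[of i] y2[of i] yz[of i] by (auto simp: bigpart_def x)
  qed
  have on: "ones d x = j"
  proof -
    have "ones d x = (\<Sum>i\<in>{i. i < d \<and> \<bar>x i\<bar> = 1}. 1)" by (simp add: ones_def)
    also have "\<dots> = (\<Sum>i\<in>R. nat \<bar>y i\<bar>)"
    proof (rule sum.mono_neutral_cong_left)
      show "{i. i < d \<and> \<bar>x i\<bar> = 1} \<subseteq> R"
      proof
        fix i assume "i \<in> {i. i < d \<and> \<bar>x i\<bar> = 1}"
        then show "i \<in> R" using z2[of i] yz[of i] by (auto simp: R x)
      qed
      show "\<forall>i\<in>R - {i. i < d \<and> \<bar>x i\<bar> = 1}. nat \<bar>y i\<bar> = 0"
      proof
        fix i assume "i \<in> R - {i. i < d \<and> \<bar>x i\<bar> = 1}"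
        then show "nat \<bar>y i\<bar> = 0" using y2[of i] by (auto simp: R x)
      qed
      show "1 = nat \<bar>y i\<bar>" if "i \<in> {i. i < d \<and> \<bar>x i\<bar> = 1}" for i
        using that z2[of i] y2[of i] yz[of i] by (auto simp: x)
    qed (simp add: R)
    finally show ?thesis using y(2) by simp
  qed
  have "(\<Sum>i<d. qcost q (x i)) = (\<Sum>i<d. qcost q (x0 i))"
  proof -
    have "bigcost q (x i) = bigcost q (x0 i)" for i
      using qcost_bigpart[of q x i] qcost_bigpart[of q x0 i] by (simp add: big z)
    then show ?thesis unfolding qcost_split by (simp add: on j)
  qed
  also have "\<dots> \<le> K" using x0 by (simp add: qball_def)
  finally have "x \<in> qball {..<d} q K"
    using zout yR by (auto simp: qball_def x R)
  then show "x \<in> {x \<in> qball {..<d} q K. (bigpart x, ones d x) = (z, j)}"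
    using big on by simp
qed

lemma chi_add: "chi d \<xi> (\<lambda>i. x i + y i) = chi d \<xi> x * chi d \<xi> y"
  by (simp add: chi_def prod.distrib[symmetric] cis_mult distrib_left)

lemma markov_card:
  fixes h :: "'a \<Rightarrow> real"
  assumes "finite B" "\<And>x. x \<in> B \<Longrightarrow> h x \<ge> 0" "a > 0"
  shows "a * real (card {x \<in> B. h x \<ge> a}) \<le> (\<Sum>x\<in>B. h x)"
proof -
  have "a * real (card {x \<in> B. h x \<ge> a}) = (\<Sum>x\<in>{x \<in> B. h x \<ge> a}. a)" by simp
  also have "\<dots> \<le> (\<Sum>x\<in>{x \<in> B. h x \<ge> a}. h x)" by (intro sum_mono) auto
  also have "\<dots> \<le> (\<Sum>x\<in>B. h x)" using assms by (intro sum_mono2) auto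
  finally show ?thesis .
qed

text \<open>The mass of \<open>u\<close> sitting on the big coordinates of a point is at least half of the total mass only on a
  small portion of the ball. It is used for \<open>u\<^sub>i = 1 - cos \<xi>\<^sub>i\<close> and \<open>u\<^sub>i = 1 + cos \<xi>\<^sub>i\<close>.\<close>

lemma card_heavy_bigpart:
  assumes q: "q \<ge> 1" and K: "1 \<le> K" "4 * K \<le> real d"
    and u: "\<And>i. u i \<ge> (0::real)" and tot: "(\<Sum>i<d. u i) > 0"
  shows "real (card {x \<in> qball {..<d} q K. (\<Sum>i\<in>{i. i < d \<and> bigpart x i \<noteq> 0}. u i) \<ge> (\<Sum>i<d. u i) / 2})
      \<le> 48 * (K / real d) * real (card (qball {..<d} q K))"
proof -
  define B where "B = qball {..<d} q K"
  define \<rho> where "\<rho> = K / real d"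
  have \<rho>: "0 \<le> \<rho>" "\<rho> \<le> 1/4" using K by (auto simp: \<rho>_def field_simps)
  have fin: "finite B" unfolding B_def using q by (simp add: finite_qball)
  define S where "S = (\<Sum>i<d. u i)"
  define h where "h = (\<lambda>x::nat \<Rightarrow> int. \<Sum>i\<in>{i. i < d \<and> bigpart x i \<noteq> 0}. u i)"
  have h: "h x \<le> (\<Sum>i<d. u i * bigcost q (x i))" for x
  proof -
    have "h x \<le> (\<Sum>i\<in>{i. i < d \<and> bigpart x i \<noteq> 0}. u i * bigcost q (x i))"
      unfolding h_def
    proof (rule sum_mono)
      fix i assume "i \<in> {i. i < d \<and> bigpart x i \<noteq> 0}"
      then have b: "\<bar>x i\<bar> \<ge> 2" by (auto simp: bigpart_def split: if_splits)
      then have "1 \<le> bigcost q (x i)" using qcost_ge_abs[OF q, of "x i"] by (simp add: bigcost_def)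
      then show "u i \<le> u i * bigcost q (x i)" using u[of i] by (simp add: mult_left_le mult_le_cancel_left1)
    qed
    also have "\<dots> \<le> (\<Sum>i<d. u i * bigcost q (x i))"
      using u by (intro sum_mono2) auto
    finally show ?thesis .
  qed
  have "S / 2 * real (card {x \<in> B. h x \<ge> S / 2}) \<le> (\<Sum>x\<in>B. h x)"
    using tot u by (intro markov_card fin) (auto simp: h_def S_def intro!: sum_nonneg)
  also have "\<dots> \<le> (\<Sum>x\<in>B. \<Sum>i<d. u i * bigcost q (x i))" by (intro sum_mono h)
  also have "\<dots> = (\<Sum>i<d. u i * (\<Sum>x\<in>B. bigcost q (x i)))"
    by (subst sum.swap) (simp add: sum_distrib_left)
  also have "\<dots> \<le> (\<Sum>i<d. u i * (96 * \<rho>\<^sup>2 * real (card B)))"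
    unfolding \<rho>_def B_def using u by (intro sum_mono mult_left_mono qball_big_moment q K) auto
  also have "\<dots> = S / 2 * (192 * \<rho>\<^sup>2 * real (card B))"
    unfolding S_def sum_distrib_right[symmetric] by simp
  finally have "real (card {x \<in> B. h x \<ge> S / 2}) \<le> 192 * \<rho>\<^sup>2 * real (card B)"
    using tot by (simp only: S_def[symmetric] mult_le_cancel_left_pos)
  also have "\<dots> \<le> 48 * \<rho> * real (card B)"
  proof (rule mult_right_mono)
    have "\<rho> * \<rho> \<le> \<rho> * (1/4)" using \<rho> by (intro mult_left_mono) auto
    then show "192 * \<rho>\<^sup>2 \<le> 48 * \<rho>" by (simp add: power2_eq_square)
  qed simp
  finally show ?thesis by (simp add: B_def \<rho>_def h_def S_def)
qed

text \<open>If a point has few coordinates \<open>\<plusminus>1\<close>, then its big coordinates use up a quarter of the budget or at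
  least one unit of the budget is unused. Both events are rare.\<close>

lemma card_few_ones:
  assumes q: "q \<ge> 1" and K: "4 \<le> K" "4 * K \<le> real d"
  shows "real (card {x \<in> qball {..<d} q K. real (ones d x) < K / 2})
      \<le> 385 * (K / real d) * real (card (qball {..<d} q K))"
proof -
  define B where "B = qball {..<d} q K"
  define \<rho> where "\<rho> = K / real d"
  have d: "real d > 0" using K by linarith
  have fin: "finite B" unfolding B_def using q by (simp add: finite_qball)
  define h where "h = (\<lambda>x::nat \<Rightarrow> int. \<Sum>i<d. bigcost q (x i))"
  have "K / 4 * real (card {x \<in> B. h x \<ge> K / 4}) \<le> (\<Sum>x\<in>B. h x)"
    using K by (intro markov_card fin) (auto simp: h_def intro!: sum_nonneg)
  also have "\<dots> = (\<Sum>i<d. \<Sum>x\<in>B. bigcost q (x i))"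
    unfolding h_def by (rule sum.swap)
  also have "\<dots> \<le> (\<Sum>i<d. 96 * \<rho>\<^sup>2 * real (card B))"
    unfolding \<rho>_def B_def using K by (intro sum_mono qball_big_moment q) auto
  also have "\<dots> = K / 4 * (384 * \<rho> * real (card B))"
    using d by (simp add: \<rho>_def power2_eq_square)
  finally have 1: "real (card {x \<in> B. h x \<ge> K / 4}) \<le> 384 * \<rho> * real (card B)"
    using K by (simp only: mult_le_cancel_left_pos)
  \<comment> \<open>points that leave at least one unit of the budget unused\<close>
  have 2: "real (card (qball {..<d} q (K - 1))) \<le> \<rho> * real (card B)"
    using qball_shrink[of "{..<d}" q K "real d" K 1] K q by (simp add: \<rho>_def B_def)
  have "{x \<in> B. real (ones d x) < K / 2} \<subseteq> {x \<in> B. h x \<ge> K / 4} \<union> qball {..<d} q (K - 1)"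
  proof clarify
    fix x assume x: "x \<in> B" "real (ones d x) < K / 2" "x \<notin> qball {..<d} q (K - 1)"
    have "(\<Sum>i<d. qcost q (x i)) > K - 1" using x(1,3) by (auto simp: B_def qball_def)
    then have "h x > K - 1 - K / 2" using x(2) unfolding qcost_split h_def by linarith
    then show "h x \<ge> K / 4" using K by simp
  qed
  then have "card {x \<in> B. real (ones d x) < K / 2} \<le> card ({x \<in> B. h x \<ge> K / 4} \<union> qball {..<d} q (K - 1))"
    using fin q by (intro card_mono) (auto simp: finite_qball)
  also have "\<dots> \<le> card {x \<in> B. h x \<ge> K / 4} + card (qball {..<d} q (K - 1))" by (rule card_Un_le)
  finally show ?thesis using 1 2 unfolding B_def \<rho>_def by simp
qed

lemma good_fiber_bound:
  assumes q: "q \<ge> 1" and K: "4 \<le> K" "4 * K \<le> real d"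
    and s: "s = (\<Sum>i<d. 1 - cos (\<xi> i)) / real d" and s': "s' = (\<Sum>i<d. 1 + cos (\<xi> i)) / real d"
    and pos: "s > 0" "s' > 0"
    and x0: "x0 \<in> qball {..<d} q K"
    and R: "R = {i. i < d \<and> bigpart x0 i = 0}"
    and g1: "real (ones d x0) \<ge> K / 2"
    and g2: "(\<Sum>i\<in>{i. i < d \<and> bigpart x0 i \<noteq> 0}. 1 - cos (\<xi> i)) < (\<Sum>i<d. 1 - cos (\<xi> i)) / 2"
    and g3: "(\<Sum>i\<in>{i. i < d \<and> bigpart x0 i \<noteq> 0}. 1 + cos (\<xi> i)) < (\<Sum>i<d. 1 + cos (\<xi> i)) / 2"
  shows "cmod (layer_sum R \<xi> (ones d x0)) \<le> 54 / sqrt (K * (s * s')) * real (card (unit_layer R (ones d x0)))"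
proof -
  define j where "j = ones d x0"
  define U where "U = {i. i < d \<and> bigpart x0 i \<noteq> 0}"
  have d: "real d > 0" using K by linarith
  have fin: "finite R" "finite U" by (auto simp: R U_def)
  have un: "R \<union> U = {..<d}" "R \<inter> U = {}" by (auto simp: R U_def)
  have split: "(\<Sum>i<d. f i) = (\<Sum>i\<in>R. f i) + (\<Sum>i\<in>U. f i)" for f :: "nat \<Rightarrow> real"
    unfolding un(1)[symmetric] by (rule sum.union_disjoint) (use fin un in auto)
  have cost: "(\<Sum>i<d. bigcost q (x0 i)) + real j \<le> K"
    using x0 unfolding j_def qcost_split[symmetric] by (simp add: qball_def)
  have "real j \<le> K" using cost sum_nonneg[of "{..<d}" "\<lambda>i. bigcost q (x0 i)"] by simp
  have "real (card U) \<le> (\<Sum>i\<in>U. bigcost q (x0 i))"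
  proof -
    have "(\<Sum>i\<in>U. 1) \<le> (\<Sum>i\<in>U. bigcost q (x0 i))"
    proof (rule sum_mono)
      fix i assume "i \<in> U"
      then have b: "\<bar>x0 i\<bar> \<ge> 2" by (auto simp: U_def bigpart_def split: if_splits)
      then show "1 \<le> bigcost q (x0 i)" using qcost_ge_abs[OF q, of "x0 i"] by (simp add: bigcost_def)
    qed
    then show ?thesis by simp
  qed
  also have "\<dots> \<le> (\<Sum>i<d. bigcost q (x0 i))" by (intro sum_mono2) (auto simp: U_def)
  finally have "real (card U) \<le> K" using cost by linarith
  have cR: "real (card R) + real (card U) = real d"
    using split[of "\<lambda>_. 1"] by simp
  then have "real (2 * j) \<le> real (card R)" using \<open>real j \<le> K\<close> \<open>real (card U) \<le> K\<close> K by simp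
  then have jR: "2 * j \<le> card R" by linarith
  have j1: "1 \<le> j" using g1 K by (simp add: j_def)
  have r: "real (card R) > 0" "real (card R) \<le> real d" using jR j1 cR by auto
  define c where "c = (\<Sum>i\<in>R. cos (\<xi> i)) / real (card R)"
  have "1 - c = (\<Sum>i\<in>R. 1 - cos (\<xi> i)) / real (card R)"
    using r by (simp add: c_def sum_subtractf diff_divide_distrib)
  moreover have "1 + c = (\<Sum>i\<in>R. 1 + cos (\<xi> i)) / real (card R)"
    using r by (simp add: c_def sum.distrib add_divide_distrib)
  moreover have "(\<Sum>i\<in>R. 1 - cos (\<xi> i)) / real (card R) \<ge> s / 2"
  proof -
    have "(\<Sum>i\<in>R. 1 - cos (\<xi> i)) \<ge> real d * s / 2"
      using g2 split[of "\<lambda>i. 1 - cos (\<xi> i)"] d by (simp add: U_def s)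
    moreover have "real (card R) * s \<le> real d * s" using r pos by (intro mult_right_mono) auto
    ultimately show ?thesis using r by (simp add: field_simps)
  qed
  moreover have "(\<Sum>i\<in>R. 1 + cos (\<xi> i)) / real (card R) \<ge> s' / 2"
  proof -
    have "(\<Sum>i\<in>R. 1 + cos (\<xi> i)) \<ge> real d * s' / 2"
      using g3 split[of "\<lambda>i. 1 + cos (\<xi> i)"] d by (simp add: U_def s')
    moreover have "real (card R) * s' \<le> real d * s'" using r pos by (intro mult_right_mono) auto
    ultimately show ?thesis using r by (simp add: field_simps)
  qed
  ultimately have cc: "1 - c \<ge> s / 2" "1 + c \<ge> s' / 2" by auto
  have "1 - c\<^sup>2 = (1 - c) * (1 + c)" by (simp add: power2_eq_square algebra_simps)
  also have "\<dots> \<ge> (s / 2) * (s' / 2)" using cc pos by (intro mult_mono) auto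
  finally have b: "1 - c\<^sup>2 \<ge> s * s' / 4" by simp
  have "K * (s * s') / 9 \<le> (K / 2) * (s * s' / 4)" using K pos by simp
  also have "\<dots> \<le> real j * (1 - c\<^sup>2)"
    using g1 b K pos unfolding j_def[symmetric] by (intro mult_mono) auto
  finally have "sqrt (K * (s * s') / 9) \<le> sqrt (real j * (1 - c\<^sup>2))" by simp
  then have sq: "sqrt (K * (s * s')) / 3 \<le> sqrt (real j * (1 - c\<^sup>2))"
    by (simp add: real_sqrt_divide)
  have "cmod (layer_sum R \<xi> j) * (sqrt (K * (s * s')) / 3) \<le> cmod (layer_sum R \<xi> j) * sqrt (real j * (1 - c\<^sup>2))"
    using sq by (intro mult_left_mono) auto
  also have "\<dots> \<le> 18 * real (card (unit_layer R j))"
    by (rule layer_sum_bound[OF fin(1) j1 jR c_def])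
  finally have "cmod (layer_sum R \<xi> j) * sqrt (K * (s * s')) \<le> 54 * real (card (unit_layer R j))"
    by simp
  moreover have "sqrt (K * (s * s')) > 0" using K pos by simp
  ultimately show ?thesis unfolding j_def[symmetric] by (simp add: field_simps)
qed

text \<open>The ball is cut into the fibres of \<open>fiber_eq\<close>. Fibres with few coordinates \<open>\<plusminus>1\<close>, or whose big
  part carries half of the mass of \<open>1 - cos \<xi>\<close> or of \<open>1 + cos \<xi>\<close>, are estimated trivially and make up a
  proportion \<open>O(K/d)\<close>; the others are covered by \<open>layer_sum_bound\<close>.\<close>

lemma chi_sum_high:
  assumes q: "q \<ge> 1" and K: "4 \<le> K" "4 * K \<le> real d"
    and s: "s = (\<Sum>i<d. 1 - cos (\<xi> i)) / real d" and s': "s' = (\<Sum>i<d. 1 + cos (\<xi> i)) / real d"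
    and pos: "s > 0" "s' > 0"
  shows "cmod (\<Sum>x\<in>qball {..<d} q K. chi d \<xi> x)
      \<le> (481 * (K / real d) + 54 / sqrt (K * (s * s'))) * real (card (qball {..<d} q K))"
proof -
  define B where "B = qball {..<d} q K"
  define \<rho> where "\<rho> = K / real d"
  have d: "real d > 0" using K by linarith
  have fin: "finite B" unfolding B_def using q by (simp add: finite_qball)
  define U where "U = (\<lambda>z::nat \<Rightarrow> int. {i. i < d \<and> z i \<noteq> 0})"
  define \<delta> where "\<delta> = 54 / sqrt (K * (s * s'))"
  have \<delta>: "\<delta> \<ge> 0" using K pos by (simp add: \<delta>_def)
  define bad where "bad = (\<lambda>(z::nat \<Rightarrow> int, j::nat). real j < K / 2
     \<or> (\<Sum>i\<in>U z. 1 - cos (\<xi> i)) \<ge> (\<Sum>i<d. 1 - cos (\<xi> i)) / 2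
     \<or> (\<Sum>i\<in>U z. 1 + cos (\<xi> i)) \<ge> (\<Sum>i<d. 1 + cos (\<xi> i)) / 2)"
  define g where "g = (\<lambda>x. (bigpart x, ones d x))"
  define G where "G = (\<lambda>t. if bad t then 1 else \<delta>)"
  have fiber: "cmod (\<Sum>x\<in>{x \<in> B. g x = t}. chi d \<xi> x) \<le> (\<Sum>x\<in>{x \<in> B. g x = t}. G (g x))"
    if t: "t \<in> g ` B" for t
  proof (cases "bad t")
    case True
    have "cmod (\<Sum>x\<in>{x \<in> B. g x = t}. chi d \<xi> x) \<le> (\<Sum>x\<in>{x \<in> B. g x = t}. cmod (chi d \<xi> x))"
      by (rule norm_sum)
    also have "\<dots> = (\<Sum>x\<in>{x \<in> B. g x = t}. G (g x))"
      using True by (intro sum.cong) (auto simp: G_def)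
    finally show ?thesis .
  next
    case False
    obtain x0 where x0: "x0 \<in> B" "t = g x0" using t by auto
    define z where "z = bigpart x0"
    define j where "j = ones d x0"
    define R where "R = {i. i < d \<and> z i = 0}"
    have R: "finite R" by (simp add: R_def)
    have eq: "{x \<in> B. g x = t} = (\<lambda>y i. z i + y i) ` unit_layer R j"
      using fiber_eq[OF x0(1)[unfolded B_def] z_def j_def R_def]
      by (simp add: B_def g_def x0(2) z_def j_def)
    have inj: "inj_on (\<lambda>y i. z i + y i) (unit_layer R j)"
      by (rule inj_onI) (auto simp: fun_eq_iff)
    have "(\<Sum>x\<in>{x \<in> B. g x = t}. chi d \<xi> x) = chi d \<xi> z * (\<Sum>y\<in>unit_layer R j. chi d \<xi> y)"
      unfolding eq by (subst sum.reindex[OF inj]) (simp add: chi_add sum_distrib_left)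
    also have "(\<Sum>y\<in>unit_layer R j. chi d \<xi> y) = layer_sum R \<xi> j"
      unfolding layer_sum_def chi_def
    proof (rule sum.cong[OF refl])
      fix y assume "y \<in> unit_layer R j"
      then have y: "y i = 0" if "i \<notin> R" for i
        using that by (auto simp: unit_layer_def funs_def)
      show "(\<Prod>i<d. cis (\<xi> i * real_of_int (y i))) = (\<Prod>i\<in>R. cis (\<xi> i * real_of_int (y i)))"
      proof (rule prod.mono_neutral_right)
        show "\<forall>i\<in>{..<d} - R. cis (\<xi> i * real_of_int (y i)) = 1" using y by simp
      qed (auto simp: R_def)
    qed
    finally have "cmod (\<Sum>x\<in>{x \<in> B. g x = t}. chi d \<xi> x) = cmod (layer_sum R \<xi> j)"
      by (simp add: norm_mult)
    also have "\<dots> \<le> \<delta> * real (card (unit_layer R j))"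
      unfolding \<delta>_def j_def
      by (rule good_fiber_bound[OF q K s s' pos x0(1)[unfolded B_def]])
         (use False in \<open>auto simp: R_def z_def x0(2) g_def bad_def U_def not_le not_less\<close>)
    also have "\<dots> = (\<Sum>x\<in>{x \<in> B. g x = t}. G (g x))"
    proof -
      have "(\<Sum>x\<in>{x \<in> B. g x = t}. G (g x)) = (\<Sum>x\<in>{x \<in> B. g x = t}. \<delta>)"
        using False by (intro sum.cong) (auto simp: G_def)
      also have "\<dots> = \<delta> * real (card {x \<in> B. g x = t})" by simp
      also have "card {x \<in> B. g x = t} = card (unit_layer R j)" unfolding eq by (rule card_image[OF inj])
      finally show ?thesis ..
    qed
    finally show ?thesis .
  qed
  have S: "(\<Sum>i<d. 1 - cos (\<xi> i)) > 0" "(\<Sum>i<d. 1 + cos (\<xi> i)) > 0"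
    using pos d unfolding s s' by (simp_all add: zero_less_divide_iff)
  have cardbad: "real (card {x \<in> B. bad (g x)}) \<le> 481 * \<rho> * real (card B)"
  proof -
    define B1 where "B1 = {x \<in> B. real (ones d x) < K / 2}"
    define B2 where "B2 = {x \<in> B. (\<Sum>i\<in>{i. i < d \<and> bigpart x i \<noteq> 0}. 1 - cos (\<xi> i)) \<ge> (\<Sum>i<d. 1 - cos (\<xi> i)) / 2}"
    define B3 where "B3 = {x \<in> B. (\<Sum>i\<in>{i. i < d \<and> bigpart x i \<noteq> 0}. 1 + cos (\<xi> i)) \<ge> (\<Sum>i<d. 1 + cos (\<xi> i)) / 2}"
    have 1: "real (card B1) \<le> 385 * \<rho> * real (card B)"
      unfolding B1_def B_def \<rho>_def by (rule card_few_ones[OF q K])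
    have 2: "real (card B2) \<le> 48 * \<rho> * real (card B)"
      unfolding B2_def B_def \<rho>_def using K S by (intro card_heavy_bigpart q) auto
    have 3: "real (card B3) \<le> 48 * \<rho> * real (card B)"
    proof -
      have "1 + cos x \<ge> 0" for x :: real using cos_ge_minus_one[of x] by linarith
      then show ?thesis unfolding B3_def B_def \<rho>_def using K S by (intro card_heavy_bigpart q) auto
    qed
    have "{x \<in> B. bad (g x)} = B1 \<union> (B2 \<union> B3)"
      by (auto simp: bad_def g_def B1_def B2_def B3_def U_def)
    then have "card {x \<in> B. bad (g x)} \<le> card B1 + (card B2 + card B3)"
      using card_Un_le[of B1 "B2 \<union> B3"] card_Un_le[of B2 B3] by simp
    then have "real (card {x \<in> B. bad (g x)}) \<le> real (card B1) + (real (card B2) + real (card B3))"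
      by linarith
    then show ?thesis using 1 2 3 by linarith
  qed
  have "(\<Sum>x\<in>B. chi d \<xi> x) = (\<Sum>t\<in>g ` B. \<Sum>x\<in>{x \<in> B. g x = t}. chi d \<xi> x)"
    by (rule sum.group[symmetric]) (use fin in auto)
  then have "cmod (\<Sum>x\<in>B. chi d \<xi> x) \<le> (\<Sum>t\<in>g ` B. cmod (\<Sum>x\<in>{x \<in> B. g x = t}. chi d \<xi> x))"
    by (simp only: norm_sum)
  also have "\<dots> \<le> (\<Sum>t\<in>g ` B. \<Sum>x\<in>{x \<in> B. g x = t}. G (g x))"
    by (intro sum_mono fiber)
  also have "\<dots> = (\<Sum>x\<in>B. G (g x))"
    by (rule sum.group) (use fin in auto)
  also have "\<dots> \<le> (\<Sum>x\<in>B. (if bad (g x) then 1 else 0) + \<delta>)"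
    using \<delta> by (intro sum_mono) (auto simp: G_def)
  also have "\<dots> = real (card {x \<in> B. bad (g x)}) + \<delta> * real (card B)"
    using fin by (simp add: sum.distrib sum.If_cases Int_def)
  also have "\<dots> \<le> (481 * \<rho> + \<delta>) * real (card B)"
    using cardbad by (simp add: distrib_right)
  finally show ?thesis by (simp add: B_def \<rho>_def \<delta>_def)
qed

section \<open>Finitely supported functions and averages\<close>

text \<open>Finitely supported functions on \<open>\<int>\<^sup>d\<close>, extended by \<open>0\<close> to all sequences. Sums of such functions are
  written with \<open>Sum_any\<close>.\<close>

definition FS :: "nat \<Rightarrow> (point \<Rightarrow> 'a::zero) set" where
  "FS d = {f. finite {x. f x \<noteq> 0} \<and> {x. f x \<noteq> 0} \<subseteq> int_lattice d}"

lemma FS_finite: "f \<in> FS d \<Longrightarrow> finite {x. f x \<noteq> 0}"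
  by (simp add: FS_def)

lemma FS_dominated:
  assumes "f \<in> FS d" "\<And>x. f x = 0 \<Longrightarrow> g x = 0"
  shows "g \<in> FS d"
proof -
  have "{x. g x \<noteq> 0} \<subseteq> {x. f x \<noteq> 0}" using assms(2) by auto
  then show ?thesis using assms(1) finite_subset by (auto simp: FS_def)
qed

lemma FS_zero: "(\<lambda>_. 0) \<in> FS d"
  by (simp add: FS_def)

lemma FS_add:
  fixes f g :: "point \<Rightarrow> 'a::monoid_add"
  assumes "f \<in> FS d" "g \<in> FS d"
  shows "(\<lambda>x. f x + g x) \<in> FS d"
proof -
  have "{x. f x + g x \<noteq> 0} \<subseteq> {x. f x \<noteq> 0} \<union> {x. g x \<noteq> 0}" by auto
  then show ?thesis using assms finite_subset[OF _ finite_UnI] by (auto simp: FS_def)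
qed

lemma FS_sum:
  fixes f :: "'b \<Rightarrow> point \<Rightarrow> 'a::comm_monoid_add"
  assumes "\<And>i. i \<in> I \<Longrightarrow> f i \<in> FS d"
  shows "(\<lambda>x. \<Sum>i\<in>I. f i x) \<in> FS d"
  using assms by (induction I rule: infinite_finite_induct) (auto simp: FS_zero FS_add)

lemma FS_shift:
  assumes "f \<in> FS d" "y \<in> int_lattice d"
  shows "(\<lambda>x. f (x - y)) \<in> FS d"
proof -
  have "{x. f (x - y) \<noteq> 0} = (\<lambda>x. x + y) ` {x. f x \<noteq> 0}"
  proof (intro set_eqI iffI)
    fix x assume "x \<in> {x. f (x - y) \<noteq> 0}"
    then have "x - y \<in> {x. f x \<noteq> 0}" by simp
    then have "(x - y) + y \<in> (\<lambda>x. x + y) ` {x. f x \<noteq> 0}" by (rule imageI)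
    then show "x \<in> (\<lambda>x. x + y) ` {x. f x \<noteq> 0}" by simp
  qed auto
  then show ?thesis using assms by (force simp: FS_def int_lattice_def)
qed

lemma Sum_any_FS:
  assumes "finite W" "\<And>x. x \<notin> W \<Longrightarrow> f x = 0"
  shows "Sum_any f = sum f W"
  using assms by (intro Sum_any.expand_superset) auto

lemma Sum_any_FS_sum:
  assumes "\<And>i. i \<in> I \<Longrightarrow> f i \<in> FS d"
  shows "Sum_any (\<lambda>x. \<Sum>i\<in>I. f i x) = (\<Sum>i\<in>I. Sum_any (f i))"
  using assms
proof (induction I rule: infinite_finite_induct)
  case (insert i I)
  have "(\<lambda>x. \<Sum>i\<in>I. f i x) \<in> FS d" using insert by (intro FS_sum) auto
  then show ?case
    using insert by (simp add: Sum_any.distrib[OF FS_finite[of "f i" d] FS_finite[of _ d]])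
qed auto

lemma Sum_any_FS_mono:
  fixes f g :: "point \<Rightarrow> real"
  assumes "f \<in> FS d" "g \<in> FS d" "\<And>x. f x \<le> g x"
  shows "Sum_any f \<le> Sum_any g"
proof -
  define W where "W = {x. f x \<noteq> 0} \<union> {x. g x \<noteq> 0}"
  have W: "finite W" using assms by (simp add: W_def FS_finite)
  have "Sum_any f = sum f W" "Sum_any g = sum g W"
    using W by (auto intro!: Sum_any_FS simp: W_def)
  then show ?thesis using assms(3) by (simp add: sum_mono)
qed

lemma Sum_any_shift:
  fixes f :: "point \<Rightarrow> 'a::comm_monoid_add"
  shows "Sum_any (\<lambda>x. f (x - y)) = Sum_any f"
proof -
  have "bij (\<lambda>x. x - y)"
    by (rule o_bij[of "\<lambda>x. x + y"]) (auto simp: fun_eq_iff)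
  then show ?thesis by (rule Sum_any.reindex_cong[symmetric]) (simp add: comp_def)
qed

text \<open>Inner product and squared \<open>\<ell>\<^sup>2\<close> norm of finitely supported functions.\<close>

definition ip :: "(point \<Rightarrow> real) \<Rightarrow> (point \<Rightarrow> real) \<Rightarrow> real" where
  "ip f g = Sum_any (\<lambda>x. f x * g x)"

definition sq :: "(point \<Rightarrow> real) \<Rightarrow> real" where
  "sq f = Sum_any (\<lambda>x. (f x)\<^sup>2)"

lemma FS_mult: "f \<in> FS d \<Longrightarrow> (\<lambda>x. f x * g x :: real) \<in> FS d"
  by (rule FS_dominated) auto

lemma FS_cmult: "f \<in> FS d \<Longrightarrow> (\<lambda>x. c * f x :: real) \<in> FS d"
  by (rule FS_dominated) auto

lemma FS_power2: "f \<in> FS d \<Longrightarrow> (\<lambda>x. (f x)\<^sup>2 :: real) \<in> FS d"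
  by (rule FS_dominated) auto

lemma sq_nonneg: "sq f \<ge> 0"
  by (simp add: sq_def Sum_any.expand_set sum_nonneg)

lemma sq_eq_ip: "sq f = ip f f"
  by (simp add: sq_def ip_def power2_eq_square)

lemma ip_commute: "ip f g = ip g f"
  by (simp add: ip_def mult.commute)

lemma ip_mono_right:
  assumes "f \<in> FS d" "\<And>x. f x \<ge> 0" "\<And>x. g x \<le> h x"
  shows "ip f g \<le> ip f h"
  unfolding ip_def using assms
  by (intro Sum_any_FS_mono[where d = d] FS_mult mult_left_mono) auto

lemma ip_sum_left:
  assumes "\<And>i. i \<in> I \<Longrightarrow> f i \<in> FS d"
  shows "ip (\<lambda>x. \<Sum>i\<in>I. f i x) g = (\<Sum>i\<in>I. ip (f i) g)"
  unfolding ip_def sum_distrib_right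
  by (rule Sum_any_FS_sum[where d = d]) (use assms in \<open>auto intro: FS_mult\<close>)

lemma ip_sum_right:
  assumes "\<And>i. i \<in> I \<Longrightarrow> f i \<in> FS d"
  shows "ip g (\<lambda>x. \<Sum>i\<in>I. f i x) = (\<Sum>i\<in>I. ip g (f i))"
  using ip_sum_left[OF assms, where g = g] by (simp add: ip_commute)

lemma ip_cmult: "f \<in> FS d \<Longrightarrow> ip (\<lambda>x. c * f x) g = c * ip f g"
  unfolding ip_def by (simp add: Sum_any_right_distrib FS_finite FS_mult mult.assoc)

lemma ip_cmult_right: "g \<in> FS d \<Longrightarrow> ip f (\<lambda>x. c * g x) = c * ip f g"
  using ip_cmult[of g d c f] by (simp add: ip_commute)

lemma ip_add_right:
  assumes "f \<in> FS d"
  shows "ip f (\<lambda>x. g x + h x) = ip f g + ip f h"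
  unfolding ip_def distrib_left by (rule Sum_any.distrib) (use assms in \<open>simp_all add: FS_finite FS_mult\<close>)

lemma ip_cauchy_schwarz:
  assumes "f \<in> FS d"  "g \<in> FS d"
  shows "(ip f g)\<^sup>2 \<le> sq f * sq g"
proof -
  define W where "W = {x. f x \<noteq> 0} \<union> {x. g x \<noteq> 0}"
  have W: "finite W" using assms by (simp add: W_def FS_finite)
  have "ip f g = (\<Sum>x\<in>W. f x * g x)" "sq f = (\<Sum>x\<in>W. (f x)\<^sup>2)" "sq g = (\<Sum>x\<in>W. (g x)\<^sup>2)"
    unfolding ip_def sq_def using W by (auto intro!: Sum_any_FS simp: W_def)
  then show ?thesis using Cauchy_Schwarz_ineq_sum[of f g W] by simp
qed

lemma sq_average_le:
  assumes S: "finite S" "S \<noteq> {}" and f: "\<And>k. k \<in> S \<Longrightarrow> f k \<in> FS d" "\<And>k. k \<in> S \<Longrightarrow> sq (f k) \<le> M"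
  shows "sq (\<lambda>x. (\<Sum>k\<in>S. f k x) / real (card S)) \<le> M"
proof -
  define n where "n = real (card S)"
  have n: "n > 0" using S by (simp add: n_def card_gt_0_iff)
  have fs: "(\<lambda>x. \<Sum>k\<in>S. f k x) \<in> FS d" using f by (intro FS_sum) auto
  have fs2: "(\<lambda>x. \<Sum>k\<in>S. (f k x)\<^sup>2) \<in> FS d" using f by (intro FS_sum FS_power2) auto
  have "sq (\<lambda>x. (\<Sum>k\<in>S. f k x) / n) \<le> Sum_any (\<lambda>x. 1 / n * (\<Sum>k\<in>S. (f k x)\<^sup>2))"
    unfolding sq_def
  proof (rule Sum_any_FS_mono[where d = d])
    show "(\<lambda>x. ((\<Sum>k\<in>S. f k x) / n)\<^sup>2) \<in> FS d" by (rule FS_dominated[OF fs]) auto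
    show "(\<lambda>x. 1 / n * (\<Sum>k\<in>S. (f k x)\<^sup>2)) \<in> FS d" by (intro FS_cmult fs2)
    fix x
    have "(\<Sum>k\<in>S. f k x)\<^sup>2 \<le> (\<Sum>k\<in>S. (f k x)\<^sup>2) * n"
      using sum_squared_le_sum_of_squares[of "\<lambda>k. f k x" S] S by (simp add: n_def)
    then show "((\<Sum>k\<in>S. f k x) / n)\<^sup>2 \<le> 1 / n * (\<Sum>k\<in>S. (f k x)\<^sup>2)"
      using n by (simp add: power_divide power2_eq_square field_simps)
  qed
  also have "\<dots> = 1 / n * (\<Sum>k\<in>S. sq (f k))"
    unfolding sq_def using f
    by (subst Sum_any_right_distrib[symmetric])
       (auto simp: FS_finite[OF fs2] Sum_any_FS_sum[where d = d] FS_power2)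
  also have "\<dots> \<le> 1 / n * (\<Sum>k\<in>S. M)" using n f by (intro mult_left_mono sum_mono) auto
  also have "\<dots> = M" using n by (simp add: n_def)
  finally show ?thesis by (simp add: n_def)
qed

text \<open>The average of \<open>f\<close> over the translates of \<open>x\<close> by a finite set \<open>V\<close>.\<close>

definition avg :: "point set \<Rightarrow> (point \<Rightarrow> real) \<Rightarrow> point \<Rightarrow> real" where
  "avg V f x = (\<Sum>y\<in>V. f (x - y)) / real (card V)"

lemma FS_avg:
  assumes "V \<subseteq> int_lattice d" "f \<in> FS d"
  shows "avg V f \<in> FS d"
proof -
  have "(\<lambda>x. \<Sum>y\<in>V. f (x - y)) \<in> FS d"
    using assms by (intro FS_sum FS_shift) auto
  then show ?thesis by (rule FS_dominated) (simp add: avg_def)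
qed

lemma avg_nonneg: "(\<And>x. f x \<ge> 0) \<Longrightarrow> avg V f x \<ge> 0"
  by (simp add: avg_def sum_nonneg)

lemma avg_sum: "avg V (\<lambda>x. \<Sum>i\<in>I. f i x) = (\<lambda>x. \<Sum>i\<in>I. avg V (f i) x)"
  unfolding avg_def by (subst sum.swap) (simp add: sum_divide_distrib)

lemma avg_cmult: "avg V (\<lambda>x. c * f x) = (\<lambda>x. c * avg V f x)"
  unfolding avg_def by (simp add: sum_distrib_left)

lemma avg_add: "avg V (\<lambda>x. f x + g x) = (\<lambda>x. avg V f x + avg V g x)"
  unfolding avg_def by (simp add: sum.distrib add_divide_distrib)

lemma sq_avg_le:
  assumes "V \<subseteq> int_lattice d" "finite V" "V \<noteq> {}" "f \<in> FS d"
  shows "sq (avg V f) \<le> sq f"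
  unfolding avg_def
proof (rule sq_average_le[OF assms(2,3)])
  fix y assume "y \<in> V"
  then show "(\<lambda>x. f (x - y)) \<in> FS d" using assms by (intro FS_shift) auto
  show "sq (\<lambda>x. f (x - y)) \<le> sq f"
    unfolding sq_def using Sum_any_shift[of "\<lambda>x. (f x)\<^sup>2" y] by simp
qed

lemma avg_self_adjoint:
  assumes V: "V \<subseteq> int_lattice d" "uminus ` V = V" and f: "f \<in> FS d" and g: "g \<in> FS d"
  shows "ip (avg V f) g = ip f (avg V g)"
proof -
  have shift: "ip (\<lambda>x. f (x - y)) g = ip f (\<lambda>x. g (x - - y))" for y
    unfolding ip_def
    using Sum_any_shift[of "\<lambda>x. f (x - y) * g x" "- y"] by simp
  have c: "avg V h = (\<lambda>x. 1 / real (card V) * (\<Sum>y\<in>V. h (x - y)))" for h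
    by (simp add: avg_def fun_eq_iff)
  have FSs: "(\<lambda>x. h (x - y)) \<in> FS d" if "h \<in> FS d" "y \<in> V" for h :: "point \<Rightarrow> real" and y
    using V that by (intro FS_shift) auto
  have "ip (avg V f) g = 1 / real (card V) * (\<Sum>y\<in>V. ip (\<lambda>x. f (x - y)) g)"
    unfolding c using FSs[OF f] by (subst ip_cmult[where d = d]) (auto intro: FS_sum simp: ip_sum_left[where d = d])
  also have "(\<Sum>y\<in>V. ip (\<lambda>x. f (x - y)) g) = (\<Sum>y\<in>V. ip f (\<lambda>x. g (x - - y)))"
    by (simp only: shift)
  also have "\<dots> = (\<Sum>y\<in>uminus ` V. ip f (\<lambda>x. g (x - y)))"
    by (subst sum.reindex) (auto intro!: inj_onI)
  also have "1 / real (card V) * \<dots> = ip f (avg V g)"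
    unfolding c V(2) using FSs[OF g] by (subst ip_cmult_right[where d = d]) (auto intro: FS_sum simp: ip_sum_right[where d = d])
  finally show ?thesis .
qed

section \<open>Cesaro means of the nearest neighbour average\<close>

text \<open>The \<open>2 d\<close> signed unit vectors.\<close>

definition units :: "nat \<Rightarrow> point set" where
  "units d = (\<lambda>(i, v). (\<lambda>_. 0)(i := v)) ` ({..<d} \<times> {-1, 1})"

lemma inj_on_units: "inj_on (\<lambda>(i, v). (\<lambda>_. 0)(i := v)) ({..<d::nat} \<times> {-1, 1::int})"
proof (rule inj_onI)
  fix a b :: "nat \<times> int"
  assume ab: "a \<in> {..<d} \<times> {-1, 1}" "b \<in> {..<d} \<times> {-1, 1}"
    and eq: "(\<lambda>(i, v). (\<lambda>_. 0)(i := v)) a = (\<lambda>(i, v). (\<lambda>_. 0)(i := v)) b"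
  obtain i v j w where iv: "a = (i, v)" "b = (j, w)" by (metis surj_pair)
  have "((\<lambda>_. 0)(i := v)) i = ((\<lambda>_. 0)(j := w)) i" using eq by (simp add: iv)
  then show "a = b" using ab by (auto simp: iv split: if_splits)
qed

lemma card_units: "card (units d) = 2 * d"
  unfolding units_def by (subst card_image[OF inj_on_units]) (simp add: card_cartesian_product)

lemma units_lattice: "units d \<subseteq> int_lattice d"
  by (auto simp: units_def int_lattice_def)

lemma finite_units: "finite (units d)"
  by (simp add: units_def)

lemma uminus_units: "uminus ` units d = units d"
proof -
  have sub: "uminus ` units d \<subseteq> units d"
  proof clarify
    fix x assume "x \<in> units d"
    then obtain i v where i: "i < d" "v = -1 \<or> v = 1" "x = (\<lambda>_. 0)(i := v)" by (auto simp: units_def)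
    have "- x = (\<lambda>(i, v). (\<lambda>_. 0)(i := v)) (i, - v)" unfolding i(3) by auto
    moreover have "(i, - v) \<in> {..<d} \<times> {-1, 1}" using i(1,2) by auto
    ultimately show "- x \<in> units d" unfolding units_def by (rule image_eqI)
  qed
  show ?thesis
  proof
    show "units d \<subseteq> uminus ` units d"
    proof
      fix x assume "x \<in> units d"
      then have "- x \<in> units d" using sub by auto
      then have "- (- x) \<in> uminus ` units d" by (rule imageI)
      then show "x \<in> uminus ` units d" by simp
    qed
  qed (rule sub)
qed

text \<open>The \<open>k\<close>-th power of the nearest neighbour average, that is \<open>k\<close> steps of the simple random walk.\<close>

definition walk :: "nat \<Rightarrow> nat \<Rightarrow> (point \<Rightarrow> real) \<Rightarrow> point \<Rightarrow> real" where
  "walk d k = (avg (units d)) ^^ k"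

text \<open>The mean of the first \<open>2\<^sup>l\<close> powers of the nearest neighbour average.\<close>

definition cesaro :: "nat \<Rightarrow> nat \<Rightarrow> (point \<Rightarrow> real) \<Rightarrow> point \<Rightarrow> real" where
  "cesaro d l f x = (\<Sum>k<2 ^ l. walk d k f x) / 2 ^ l"

lemma walk_Suc: "walk d (Suc k) f = avg (units d) (walk d k f)"
  by (simp add: walk_def)

lemma walk_0: "walk d 0 f = f"
  by (simp add: walk_def)

lemma walk_add: "walk d (a + b) f = walk d a (walk d b f)"
  by (simp add: walk_def funpow_add)

lemma FS_walk: "f \<in> FS d \<Longrightarrow> walk d k f \<in> FS d"
  by (induction k) (simp_all add: walk_0 walk_Suc FS_avg[OF units_lattice])

lemma walk_nonneg:
  assumes "\<And>x. f x \<ge> 0"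
  shows "walk d k f x \<ge> 0"
proof -
  have "\<forall>x. walk d k f x \<ge> 0"
    using assms by (induction k) (auto simp: walk_0 walk_Suc intro: avg_nonneg)
  then show ?thesis by blast
qed

lemma walk_linear: "walk d k (\<lambda>x. (\<Sum>i\<in>I. f i x) * c) = (\<lambda>x. (\<Sum>i\<in>I. walk d k (f i) x) * c)"
proof (induction k)
  case (Suc k)
  show ?case unfolding walk_Suc Suc
    using avg_cmult[of "units d" c "\<lambda>x. \<Sum>i\<in>I. walk d k (f i) x"]
    by (simp add: avg_sum mult.commute)
qed (simp add: walk_0)

lemma sq_walk_le:
  assumes "d > 0" "f \<in> FS d"
  shows "sq (walk d k f) \<le> sq f"
proof (induction k)
  case (Suc k)
  have "units d \<noteq> {}" using assms card_units[of d] by auto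
  then have "sq (walk d (Suc k) f) \<le> sq (walk d k f)"
    unfolding walk_Suc by (intro sq_avg_le[where d = d] units_lattice finite_units FS_walk assms)
  then show ?case using Suc by simp
qed (simp add: walk_0)

lemma walk_self_adjoint:
  assumes "f \<in> FS d" "g \<in> FS d"
  shows "ip (walk d k f) g = ip f (walk d k g)"
  using assms
proof (induction k arbitrary: g)
  case (Suc k)
  have "ip (walk d (Suc k) f) g = ip (walk d k f) (avg (units d) g)"
    unfolding walk_Suc using Suc by (intro avg_self_adjoint[where d = d] units_lattice uminus_units FS_walk)
  also have "\<dots> = ip f (walk d k (avg (units d) g))"
    using Suc by (intro Suc.IH FS_avg units_lattice)
  also have "walk d k (avg (units d) g) = walk d (Suc k) g"
    using walk_add[of d k 1 g] by (simp add: walk_Suc walk_0)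
  finally show ?case .
qed (simp add: walk_0)

lemma cesaro_eq: "cesaro d l f = (\<lambda>x. 1 / 2 ^ l * (\<Sum>k<2 ^ l. walk d k f x))"
  by (simp add: cesaro_def fun_eq_iff)

lemma FS_cesaro: "f \<in> FS d \<Longrightarrow> cesaro d l f \<in> FS d"
  unfolding cesaro_eq by (intro FS_cmult FS_sum FS_walk)

lemma cesaro_nonneg: "(\<And>x. f x \<ge> 0) \<Longrightarrow> cesaro d l f x \<ge> 0"
  by (simp add: cesaro_def sum_nonneg walk_nonneg)

lemma sq_cesaro_le:
  assumes "d > 0" "f \<in> FS d"
  shows "sq (cesaro d l f) \<le> sq f"
proof -
  have "sq (\<lambda>x. (\<Sum>k\<in>{..<2 ^ l}. walk d k f x) / real (card {..<(2::nat) ^ l})) \<le> sq f"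
    using assms by (intro sq_average_le[where d = d] FS_walk sq_walk_le) (auto simp: lessThan_empty_iff)
  then show ?thesis by (simp add: cesaro_def[abs_def])
qed

lemma cesaro_self_adjoint:
  assumes "f \<in> FS d" "g \<in> FS d"
  shows "ip (cesaro d l f) g = ip f (cesaro d l g)"
proof -
  have "ip (cesaro d l f) g = 1 / 2 ^ l * (\<Sum>k<2 ^ l. ip (walk d k f) g)"
    unfolding cesaro_eq using assms
    by (subst ip_cmult[where d = d]) (auto intro: FS_sum FS_walk simp: ip_sum_left[where d = d] FS_walk)
  also have "\<dots> = 1 / 2 ^ l * (\<Sum>k<2 ^ l. ip f (walk d k g))"
    using assms by (simp add: walk_self_adjoint)
  also have "\<dots> = ip f (cesaro d l g)"
    unfolding cesaro_eq using assms
    by (subst ip_cmult_right[where d = d]) (auto intro: FS_sum FS_walk simp: ip_sum_right[where d = d] FS_walk)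
  finally show ?thesis .
qed

lemma cesaro_cesaro: "cesaro d l (cesaro d m f) x = (\<Sum>a<2 ^ l. \<Sum>b<2 ^ m. walk d (a + b) f x) / (2 ^ l * 2 ^ m)"
proof -
  have "walk d a (cesaro d m f) = (\<lambda>x. (\<Sum>b<2 ^ m. walk d (a + b) f x) * (1 / 2 ^ m))" for a
    unfolding walk_add by (subst walk_linear[symmetric]) (simp add: cesaro_def[abs_def])
  then show ?thesis
    by (simp add: cesaro_def[of d l] sum_divide_distrib sum_distrib_right[symmetric] mult.commute)
qed

lemma cesaro_cesaro_le_aux:
  assumes f: "\<And>x. f x \<ge> 0" and ml: "m \<le> l"
  shows "(\<Sum>a<2 ^ l. \<Sum>b<2 ^ m. walk d (a + b) f x) / (2 ^ l * 2 ^ m) \<le> 2 * cesaro d (Suc l) f x"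
proof -
  have "(\<Sum>a<2 ^ l. \<Sum>b<2 ^ m. walk d (a + b) f x) = (\<Sum>b<2 ^ m. \<Sum>a<2 ^ l. walk d (a + b) f x)"
    by (rule sum.swap)
  also have "\<dots> \<le> (\<Sum>b<(2::nat) ^ m. \<Sum>k<2 ^ Suc l. walk d k f x)"
  proof (rule sum_mono)
    fix b assume b: "b \<in> {..<(2::nat) ^ m}"
    have "(2::nat) ^ m \<le> 2 ^ l" using ml by (intro power_increasing) auto
    then have lt: "a + b < 2 ^ Suc l" if "a < 2 ^ l" for a
      using that b by (simp only: lessThan_iff power_Suc)
    have "(\<Sum>a<2 ^ l. walk d (a + b) f x) = (\<Sum>k\<in>(\<lambda>a. a + b) ` {..<2 ^ l}. walk d k f x)"
      by (subst sum.reindex) (auto simp: inj_on_def)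
    also have "\<dots> \<le> (\<Sum>k<2 ^ Suc l. walk d k f x)"
    proof (rule sum_mono2)
      show "(\<lambda>a. a + b) ` {..<2 ^ l} \<subseteq> {..<2 ^ Suc l}" using lt by blast
    qed (use f in \<open>auto intro: walk_nonneg\<close>)
    finally show "(\<Sum>a<2 ^ l. walk d (a + b) f x) \<le> (\<Sum>k<2 ^ Suc l. walk d k f x)" .
  qed
  also have "\<dots> = 2 ^ m * (\<Sum>k<2 ^ Suc l. walk d k f x)" by simp
  finally have "(\<Sum>a<2 ^ l. \<Sum>b<2 ^ m. walk d (a + b) f x) / (2 ^ l * 2 ^ m)
     \<le> 2 ^ m * (\<Sum>k<2 ^ Suc l. walk d k f x) / (2 ^ l * 2 ^ m)"
    by (rule divide_right_mono) simp
  also have "\<dots> = 2 * cesaro d (Suc l) f x" by (simp add: cesaro_def)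
  finally show ?thesis .
qed

text \<open>A product of two of these means is a combination of powers below \<open>2\<^bsup>max l m + 1\<^esup>\<close> with coefficients
  at most \<open>2\<^bsup>- max l m\<^esup>\<close>. The maximum is bounded by the sum of both terms to keep the bound symmetric
  and linear.\<close>

lemma cesaro_cesaro_le:
  assumes f: "\<And>x. f x \<ge> 0"
  shows "cesaro d l (cesaro d m f) x \<le> 2 * (cesaro d (Suc l) f x + cesaro d (Suc m) f x)"
proof (cases "m \<le> l")
  case True
  then show ?thesis
    using cesaro_cesaro_le_aux[of f m l d x] f cesaro_nonneg[of f d "Suc m" x] by (simp add: cesaro_cesaro)
next
  case False
  have "(\<Sum>a<2 ^ l. \<Sum>b<2 ^ m. walk d (a + b) f x) = (\<Sum>a<2 ^ m. \<Sum>b<2 ^ l. walk d (a + b) f x)"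
    by (subst sum.swap) (simp add: add.commute)
  then show ?thesis
    using False cesaro_cesaro_le_aux[of f l m d x] f cesaro_nonneg[of f d "Suc l" x]
    by (simp add: cesaro_cesaro mult.commute)
qed

text \<open>The maximal function of the Cesaro means with \<open>l \<le> b\<close>.\<close>

definition cesaro_max :: "nat \<Rightarrow> nat \<Rightarrow> (point \<Rightarrow> real) \<Rightarrow> point \<Rightarrow> real" where
  "cesaro_max d b f x = Max ((\<lambda>l. cesaro d l f x) ` {..b})"

lemma cesaro_le_cesaro_max: "l \<le> b \<Longrightarrow> cesaro d l f x \<le> cesaro_max d b f x"
  unfolding cesaro_max_def by (intro Max_ge) auto

lemma cesaro_max_attained: "\<exists>l\<le>b. cesaro_max d b f x = cesaro d l f x"
proof -
  have "cesaro_max d b f x \<in> (\<lambda>l. cesaro d l f x) ` {..b}"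
    unfolding cesaro_max_def by (intro Max_in) auto
  then show ?thesis by auto
qed

lemma cesaro_max_nonneg: "(\<And>x. f x \<ge> 0) \<Longrightarrow> cesaro_max d b f x \<ge> 0"
  using cesaro_max_attained[of b d f x] cesaro_nonneg[of f d _ x] by metis

lemma FS_cesaro_max:
  assumes "f \<in> FS d" "\<And>x. f x \<ge> 0"
  shows "cesaro_max d b f \<in> FS d"
proof -
  have "(\<lambda>x. \<Sum>l\<le>b. cesaro d l f x) \<in> FS d" using assms by (intro FS_sum FS_cesaro) auto
  then show ?thesis
  proof (rule FS_dominated)
    fix x assume "(\<Sum>l\<le>b. cesaro d l f x) = 0"
    then have "\<forall>l\<in>{..b}. cesaro d l f x = 0"
      by (subst (asm) sum_nonneg_eq_0_iff) (auto intro: cesaro_nonneg assms)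
    then show "cesaro_max d b f x = 0" using cesaro_max_attained[of b d f x] by auto
  qed
qed

text \<open>The \<open>T T\<^sup>*\<close> step. Let \<open>h\<close> be the maximal function, attained at \<open>x\<close> by the mean with index \<open>sel x\<close>, and let
  \<open>hl l\<close> be the restriction of \<open>h\<close> to the points with \<open>sel x = l\<close>. By duality \<open>\<parallel>h\<parallel>\<^sup>2\<close> is the inner product of \<open>f\<close>
  with \<open>G = (\<Sum>l\<le>b. A\<^sub>l (hl l))\<close>. The estimate for products of means bounds \<open>\<parallel>G\<parallel>\<^sup>2\<close> by the inner product of \<open>h\<close>
  with its own maximal function, up to the factor \<open>4\<close> and one additional mean of index \<open>b + 1\<close>.\<close>

lemma cesaro_max_bound_improve:
  assumes d: "d > 0" and M: "M \<ge> 0"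
    and valid: "\<And>f. f \<in> FS d \<Longrightarrow> (\<And>x. f x \<ge> 0) \<Longrightarrow> sq (cesaro_max d b f) \<le> M\<^sup>2 * sq f"
    and f: "f \<in> FS d" "\<And>x. f x \<ge> 0"
  shows "sq (cesaro_max d b f) \<le> 4 * (M + 1) * sq f"
proof -
  define h where "h = cesaro_max d b f"
  have h: "h \<in> FS d" "\<And>x. h x \<ge> 0"
    unfolding h_def using f by (auto intro: FS_cesaro_max cesaro_max_nonneg)
  obtain sel where sel: "\<And>x. sel x \<le> b" "\<And>x. h x = cesaro d (sel x) f x"
    using cesaro_max_attained[of b d f] unfolding h_def by metis
  define hl where "hl = (\<lambda>l x. if sel x = l then h x else 0)"
  have hl: "hl l \<in> FS d" "hl l x \<ge> 0" for l x
    unfolding hl_def using h by (auto intro: FS_dominated[OF h(1)])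
  have hsum: "(\<Sum>l\<le>b. hl l x * c l) = h x * c (sel x)" for x c
    using sel(1)[of x] by (simp add: hl_def if_distrib[of "\<lambda>t. t * _"] cong: if_cong)
  have hsum1: "(\<Sum>l\<le>b. hl l x) = h x" for x using hsum[of x "\<lambda>_. 1"] by simp
  define G where "G = (\<lambda>x. \<Sum>l\<le>b. cesaro d l (hl l) x)"
  have G: "G \<in> FS d" unfolding G_def using hl by (intro FS_sum FS_cesaro)
  have ip_hl: "(\<Sum>l\<le>b. ip (hl l) (u l)) = ip h (\<lambda>x. u (sel x) x)" for u
  proof -
    have "(\<Sum>l\<le>b. ip (hl l) (u l)) = Sum_any (\<lambda>x. \<Sum>l\<le>b. hl l x * u l x)"
      unfolding ip_def using hl by (intro Sum_any_FS_sum[where d = d, symmetric] FS_mult)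
    then show ?thesis by (simp add: hsum ip_def)
  qed
  have "sq h = ip h (\<lambda>x. cesaro d (sel x) f x)"
    unfolding sq_eq_ip ip_def by (simp only: sel(2)[symmetric])
  also have "\<dots> = (\<Sum>l\<le>b. ip (hl l) (cesaro d l f))" by (rule ip_hl[symmetric])
  also have "\<dots> = (\<Sum>l\<le>b. ip (cesaro d l (hl l)) f)"
    using hl f by (simp add: cesaro_self_adjoint)
  also have "\<dots> = ip G f"
    unfolding G_def using hl by (intro ip_sum_left[where d = d, symmetric] FS_cesaro)
  finally have shG: "sq h = ip G f" .
  have pos: "ip (hl l) u \<ge> 0" if "\<And>x. u x \<ge> 0" for l u
    using hl that by (simp add: ip_def Sum_any.expand_set sum_nonneg)
  \<comment> \<open>the second term is symmetrised, so that each term pairs \<open>hl\<close> with the index of its own mean\<close>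
  have cross: "ip (cesaro d l (hl l)) (cesaro d m (hl m))
      \<le> 2 * ip (hl l) (cesaro d (Suc l) (hl m)) + 2 * ip (hl m) (cesaro d (Suc m) (hl l))" for l m
  proof -
    have "ip (cesaro d l (hl l)) (cesaro d m (hl m)) = ip (hl l) (cesaro d l (cesaro d m (hl m)))"
      using hl by (intro cesaro_self_adjoint FS_cesaro)
    also have "\<dots> \<le> ip (hl l) (\<lambda>x. 2 * (cesaro d (Suc l) (hl m) x + cesaro d (Suc m) (hl m) x))"
      using hl by (intro ip_mono_right[where d = d] cesaro_cesaro_le) auto
    also have "\<dots> = 2 * ip (hl l) (cesaro d (Suc l) (hl m)) + 2 * ip (hl l) (cesaro d (Suc m) (hl m))"
      using hl by (subst ip_cmult_right[where d = d])
        (auto intro!: FS_add FS_cesaro simp: ip_add_right[where d = d])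
    also have "ip (hl l) (cesaro d (Suc m) (hl m)) = ip (hl m) (cesaro d (Suc m) (hl l))"
      using hl by (subst ip_commute) (rule cesaro_self_adjoint)
    finally show ?thesis .
  qed
  have "sq G = (\<Sum>l\<le>b. \<Sum>m\<le>b. ip (cesaro d l (hl l)) (cesaro d m (hl m)))"
    unfolding sq_eq_ip G_def using hl
    by (subst ip_sum_left[where d = d]) (auto intro!: FS_cesaro FS_sum sum.cong ip_sum_right[where d = d])
  also have "\<dots> \<le> (\<Sum>l\<le>b. \<Sum>m\<le>b. 2 * ip (hl l) (cesaro d (Suc l) (hl m)) + 2 * ip (hl m) (cesaro d (Suc m) (hl l)))"
    by (intro sum_mono cross)
  also have "\<dots> = (\<Sum>l\<le>b. \<Sum>m\<le>b. 2 * ip (hl l) (cesaro d (Suc l) (hl m)))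
                + (\<Sum>l\<le>b. \<Sum>m\<le>b. 2 * ip (hl m) (cesaro d (Suc m) (hl l)))"
    by (simp add: sum.distrib)
  also have "(\<Sum>l\<le>b. \<Sum>m\<le>b. 2 * ip (hl m) (cesaro d (Suc m) (hl l)))
      = (\<Sum>l\<le>b. \<Sum>m\<le>b. 2 * ip (hl l) (cesaro d (Suc l) (hl m)))"
    by (rule sum.swap)
  also have "(\<Sum>l\<le>b. \<Sum>m\<le>b. 2 * ip (hl l) (cesaro d (Suc l) (hl m))) = 2 * (\<Sum>l\<le>b. ip (hl l) (cesaro d (Suc l) h))"
  proof -
    have "(\<Sum>m\<le>b. ip (hl l) (cesaro d (Suc l) (hl m))) = ip (hl l) (cesaro d (Suc l) h)" for l
    proof -
      have "(\<Sum>m\<le>b. ip (hl l) (cesaro d (Suc l) (hl m))) = (\<Sum>m\<le>b. ip (hl m) (cesaro d (Suc l) (hl l)))"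
        using hl by (intro sum.cong refl) (metis cesaro_self_adjoint ip_commute)
      also have "\<dots> = ip h (cesaro d (Suc l) (hl l))" by (rule ip_hl)
      also have "\<dots> = ip (hl l) (cesaro d (Suc l) h)"
        using hl h by (metis cesaro_self_adjoint ip_commute)
      finally show ?thesis .
    qed
    then show ?thesis by (simp add: sum_distrib_left[symmetric])
  qed
  also have "(\<Sum>l\<le>b. ip (hl l) (cesaro d (Suc l) h)) = ip h (\<lambda>x. cesaro d (Suc (sel x)) h x)"
    by (rule ip_hl)
  also have "\<dots> \<le> ip h (\<lambda>x. cesaro_max d b h x + cesaro d (Suc b) h x)"
  proof (rule ip_mono_right[OF h])
    fix x
    show "cesaro d (Suc (sel x)) h x \<le> cesaro_max d b h x + cesaro d (Suc b) h x"
    proof (cases "sel x = b")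
      case True
      then show ?thesis using cesaro_max_nonneg[of h d b x] h by simp
    next
      case False
      then have "Suc (sel x) \<le> b" using sel(1)[of x] by simp
      then show ?thesis
        using cesaro_le_cesaro_max[of "Suc (sel x)" b d h x] cesaro_nonneg[of h d "Suc b" x] h by simp
    qed
  qed
  also have "\<dots> = ip h (cesaro_max d b h) + ip h (cesaro d (Suc b) h)"
    by (rule ip_add_right[OF h(1)])
  also have "\<dots> \<le> (M + 1) * sq h"
  proof -
    have sqrt_bound: "ip h u \<le> c * sq h" if u: "u \<in> FS d" "sq u \<le> c\<^sup>2 * sq h" "c \<ge> 0" for u c
    proof (rule power2_le_imp_le)
      have "(ip h u)\<^sup>2 \<le> sq h * sq u" by (rule ip_cauchy_schwarz[OF h(1) u(1)])
      also have "\<dots> \<le> sq h * (c\<^sup>2 * sq h)" using u sq_nonneg by (intro mult_left_mono) auto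
      finally show "(ip h u)\<^sup>2 \<le> (c * sq h)\<^sup>2" by (simp add: power2_eq_square mult_ac)
    qed (use u sq_nonneg[of h] in simp)
    have "ip h (cesaro_max d b h) \<le> M * sq h"
      using h M by (intro sqrt_bound FS_cesaro_max valid) auto
    moreover have "ip h (cesaro d (Suc b) h) \<le> 1 * sq h"
      using h d by (intro sqrt_bound FS_cesaro) (auto intro: sq_cesaro_le)
    ultimately show ?thesis by (simp add: distrib_right)
  qed
  finally have sqG: "sq G \<le> 4 * (M + 1) * sq h" by (simp add: algebra_simps)
  show ?thesis
  proof (cases "sq h = 0")
    case True
    then show ?thesis using M sq_nonneg[of f] by (simp add: h_def[symmetric])
  next
    case False
    then have pos: "sq h > 0" using sq_nonneg[of h] by simp
    have "sq h * sq h \<le> sq G * sq f"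
      using ip_cauchy_schwarz[OF G f(1)] by (simp add: shG[symmetric] power2_eq_square)
    also have "\<dots> \<le> (4 * (M + 1) * sq h) * sq f"
      using sqG sq_nonneg by (intro mult_right_mono) auto
    finally have "sq h * sq h \<le> sq h * (4 * (M + 1) * sq f)" by (simp add: mult_ac)
    then show ?thesis using pos by (simp add: h_def)
  qed
qed

lemma sq_cesaro_max_crude:
  assumes d: "d > 0" and f: "f \<in> FS d" "\<And>x. f x \<ge> 0"
  shows "sq (cesaro_max d b f) \<le> (real b + 1) * sq f"
proof -
  have "sq (cesaro_max d b f) \<le> Sum_any (\<lambda>x. \<Sum>l\<le>b. (cesaro d l f x)\<^sup>2)"
    unfolding sq_def
  proof (rule Sum_any_FS_mono[where d = d])
    fix x
    obtain l where l: "l \<le> b" "cesaro_max d b f x = cesaro d l f x" using cesaro_max_attained by blast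
    have "(cesaro d l f x)\<^sup>2 \<le> (\<Sum>l\<le>b. (cesaro d l f x)\<^sup>2)" using l(1) by (intro member_le_sum) auto
    then show "(cesaro_max d b f x)\<^sup>2 \<le> (\<Sum>l\<le>b. (cesaro d l f x)\<^sup>2)" by (simp add: l(2))
  qed (use f in \<open>auto intro!: FS_power2 FS_cesaro_max FS_sum FS_cesaro\<close>)
  also have "\<dots> = (\<Sum>l\<le>b. sq (cesaro d l f))"
    unfolding sq_def using f by (intro Sum_any_FS_sum[where d = d] FS_power2 FS_cesaro)
  also have "\<dots> \<le> (\<Sum>l\<le>b. sq f)" using d f by (intro sum_mono sq_cesaro_le)
  finally show ?thesis by (simp add: add.commute)
qed

text \<open>Starting from the crude bound, which depends on \<open>b\<close>, the improvement step halves the distance of the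
  constant to \<open>5\<close>, because \<open>4 (M + 1) \<le> ((M + 5) / 2)\<^sup>2\<close>.\<close>

lemma sq_cesaro_max_le:
  assumes d: "d > 0" and f: "f \<in> FS d" "\<And>x. f x \<ge> 0"
  shows "sq (cesaro_max d b f) \<le> 25 * sq f"
proof -
  have iter: "\<forall>f. f \<in> FS d \<longrightarrow> (\<forall>x. f x \<ge> 0) \<longrightarrow> sq (cesaro_max d b f) \<le> (5 + real b * (1/2) ^ k)\<^sup>2 * sq f" for k
  proof (induction k)
    case 0
    show ?case
    proof (intro allI impI)
      fix f :: "point \<Rightarrow> real" assume f: "f \<in> FS d" "\<forall>x. f x \<ge> 0"
      have "sq (cesaro_max d b f) \<le> (real b + 1) * sq f" using d f by (intro sq_cesaro_max_crude) auto
      also have "\<dots> \<le> (5 + real b * (1/2) ^ 0)\<^sup>2 * sq f"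
        using sq_nonneg by (intro mult_right_mono) (auto simp: power2_eq_square algebra_simps)
      finally show "sq (cesaro_max d b f) \<le> (5 + real b * (1/2) ^ 0)\<^sup>2 * sq f" .
    qed
  next
    case (Suc k)
    define e where "e = real b * (1/2) ^ k"
    have e: "e \<ge> 0" by (simp add: e_def)
    show ?case
    proof (intro allI impI)
      fix f :: "point \<Rightarrow> real" assume f: "f \<in> FS d" "\<forall>x. f x \<ge> 0"
      have "sq (cesaro_max d b f) \<le> 4 * ((5 + e) + 1) * sq f"
        using f d e Suc unfolding e_def by (intro cesaro_max_bound_improve) auto
      also have "\<dots> \<le> (5 + e / 2)\<^sup>2 * sq f"
      proof (rule mult_right_mono)
        have "(5 + e / 2)\<^sup>2 - 4 * ((5 + e) + 1) = (e + 2)\<^sup>2 / 4"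
          by (simp add: power2_eq_square field_simps)
        then show "4 * ((5 + e) + 1) \<le> (5 + e / 2)\<^sup>2"
          using zero_le_power2[of "e + 2"] by linarith
      qed (rule sq_nonneg)
      also have "e / 2 = real b * (1/2) ^ Suc k" by (simp add: e_def)
      finally show "sq (cesaro_max d b f) \<le> (5 + real b * (1/2) ^ Suc k)\<^sup>2 * sq f" .
    qed
  qed
  have "(\<lambda>k. (5 + real b * (1/2) ^ k)\<^sup>2 * sq f) \<longlonglongrightarrow> (5 + real b * 0)\<^sup>2 * sq f"
    by (intro tendsto_intros LIMSEQ_power_zero) simp
  then have "sq (cesaro_max d b f) \<le> (5 + real b * 0)\<^sup>2 * sq f"
    by (rule LIMSEQ_le_const) (use iter f in auto)
  then show ?thesis by simp
qed

section \<open>Fourier transform and Plancherel identity\<close>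

text \<open>The Fourier transform of a finitely supported function at the frequency \<open>\<xi>\<close>.\<close>

definition FT :: "nat \<Rightarrow> (nat \<Rightarrow> real) \<Rightarrow> (point \<Rightarrow> real) \<Rightarrow> complex" where
  "FT d \<xi> f = Sum_any (\<lambda>x. of_real (f x) * chi d \<xi> x)"

lemma FS_chi: "f \<in> FS d \<Longrightarrow> (\<lambda>x. of_real (f x) * chi d \<xi> x) \<in> FS d"
  by (rule FS_dominated) auto

lemma FT_sum:
  assumes "\<And>i. i \<in> I \<Longrightarrow> f i \<in> FS d"
  shows "FT d \<xi> (\<lambda>x. \<Sum>i\<in>I. f i x) = (\<Sum>i\<in>I. FT d \<xi> (f i))"
  unfolding FT_def of_real_sum sum_distrib_right
  by (rule Sum_any_FS_sum[where d = d]) (use assms in \<open>auto intro: FS_chi\<close>)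

lemma FT_cmult:
  assumes "f \<in> FS d"
  shows "FT d \<xi> (\<lambda>x. c * f x) = of_real c * FT d \<xi> f"
  unfolding FT_def of_real_mult mult.assoc
  by (rule Sum_any_right_distrib[symmetric]) (rule FS_finite[OF FS_chi[OF assms]])

lemma FT_add:
  assumes "f \<in> FS d" "g \<in> FS d"
  shows "FT d \<xi> (\<lambda>x. f x + g x) = FT d \<xi> f + FT d \<xi> g"
  unfolding FT_def of_real_add distrib_right
  by (rule Sum_any.distrib[OF FS_finite[OF FS_chi[OF assms(1)]] FS_finite[OF FS_chi[OF assms(2)]]])

lemma chi_sum_point: "chi d \<xi> (x + y) = chi d \<xi> x * chi d \<xi> y"
  using chi_add[of d \<xi> x y] by (simp add: plus_fun_def)

lemma FT_shift:
  assumes "f \<in> FS d"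
  shows "FT d \<xi> (\<lambda>x. f (x - y)) = chi d \<xi> y * FT d \<xi> f"
proof -
  have "FT d \<xi> (\<lambda>x. f (x - y)) = Sum_any (\<lambda>x. (\<lambda>u. chi d \<xi> y * (of_real (f u) * chi d \<xi> u)) (x - y))"
    unfolding FT_def
  proof (rule Sum_any.cong)
    fix x
    show "of_real (f (x - y)) * chi d \<xi> x = chi d \<xi> y * (of_real (f (x - y)) * chi d \<xi> (x - y))"
      using chi_sum_point[of d \<xi> "x - y" y] by simp
  qed
  also have "\<dots> = Sum_any (\<lambda>u. chi d \<xi> y * (of_real (f u) * chi d \<xi> u))"
    by (rule Sum_any_shift)
  also have "\<dots> = chi d \<xi> y * FT d \<xi> f"
    unfolding FT_def by (rule Sum_any_right_distrib[symmetric]) (rule FS_finite[OF FS_chi[OF assms]])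
  finally show ?thesis .
qed

lemma FT_avg:
  assumes V: "V \<subseteq> int_lattice d" and f: "f \<in> FS d"
  shows "FT d \<xi> (avg V f) = (\<Sum>y\<in>V. chi d \<xi> y) / of_nat (card V) * FT d \<xi> f"
proof -
  have fs: "(\<lambda>x. f (x - y)) \<in> FS d" if "y \<in> V" for y
    using V f that by (intro FS_shift) auto
  have "FT d \<xi> (avg V f) = FT d \<xi> (\<lambda>x. 1 / real (card V) * (\<Sum>y\<in>V. f (x - y)))"
    by (simp add: avg_def[abs_def])
  also have "\<dots> = of_real (1 / real (card V)) * (\<Sum>y\<in>V. FT d \<xi> (\<lambda>x. f (x - y)))"
    using fs by (subst FT_cmult[OF FS_sum]) (simp_all only: FT_sum)
  also have "\<dots> = (\<Sum>y\<in>V. chi d \<xi> y) / of_nat (card V) * FT d \<xi> f"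
    by (simp add: FT_shift[OF f] sum_distrib_right[symmetric])
  finally show ?thesis .
qed

lemma chi_unit:
  assumes "i < d"
  shows "chi d \<xi> ((\<lambda>_. 0)(i := v)) = cis (\<xi> i * real_of_int v)"
proof -
  have "chi d \<xi> ((\<lambda>_. 0)(i := v)) = (\<Prod>k<d. if k = i then cis (\<xi> i * real_of_int v) else 1)"
    unfolding chi_def by (intro prod.cong) auto
  then show ?thesis using assms by simp
qed

lemma sum_chi_units: "(\<Sum>y\<in>units d. chi d \<xi> y) = of_real (2 * (\<Sum>i<d. cos (\<xi> i)))"
proof -
  have "(\<Sum>y\<in>units d. chi d \<xi> y) = (\<Sum>(i, v)\<in>{..<d} \<times> {-1, 1}. chi d \<xi> ((\<lambda>_. 0)(i := v)))"
    unfolding units_def by (subst sum.reindex[OF inj_on_units]) (auto intro!: sum.cong)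
  also have "\<dots> = (\<Sum>i<d. \<Sum>v\<in>{-1, 1}. chi d \<xi> ((\<lambda>_. 0)(i := v)))"
    by (rule sum.cartesian_product[symmetric])
  also have "\<dots> = (\<Sum>i<d. of_real (2 * cos (\<xi> i)))"
    by (intro sum.cong refl) (simp add: chi_unit complex_eq_iff)
  finally show ?thesis by (simp add: sum_distrib_left)
qed

lemma FT_walk:
  assumes f: "f \<in> FS d"
  shows "FT d \<xi> (walk d k f) = of_real (((\<Sum>i<d. cos (\<xi> i)) / real d) ^ k) * FT d \<xi> f"
proof (induction k)
  case (Suc k)
  have "FT d \<xi> (walk d (Suc k) f) = of_real ((\<Sum>i<d. cos (\<xi> i)) / real d) * FT d \<xi> (walk d k f)"
    unfolding walk_Suc FT_avg[OF units_lattice FS_walk[OF f]] sum_chi_units card_units by simp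
  then show ?case by (simp add: Suc)
qed (simp add: walk_0)

lemma FT_cesaro:
  assumes f: "f \<in> FS d"
  shows "FT d \<xi> (cesaro d l f) = of_real ((\<Sum>k<2 ^ l. ((\<Sum>i<d. cos (\<xi> i)) / real d) ^ k) / 2 ^ l) * FT d \<xi> f"
proof -
  have "FT d \<xi> (cesaro d l f) = of_real (1 / 2 ^ l) * (\<Sum>k<2 ^ l. FT d \<xi> (walk d k f))"
    unfolding cesaro_eq using f by (subst FT_cmult) (auto intro: FS_sum FS_walk simp: FT_sum FS_walk)
  then show ?thesis by (simp add: FT_walk[OF f] sum_distrib_right[symmetric])
qed

lemma chi_orthogonality:
  assumes xy: "x \<in> int_lattice d" "y \<in> int_lattice d" "\<And>i. i < d \<Longrightarrow> \<bar>x i\<bar> \<le> int L" "\<And>i. i < d \<Longrightarrow> \<bar>y i\<bar> \<le> int L"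
    and N: "N = 2 * L + 1"
  shows "(\<Sum>k\<in>funs {..<d} {..<N}. chi d (\<lambda>i. 2 * pi * real (k i) / real N) x
           * cnj (chi d (\<lambda>i. 2 * pi * real (k i) / real N) y)) = (if x = y then of_nat N ^ d else 0)"
proof -
  have "(\<Sum>k\<in>funs {..<d} {..<N}. chi d (\<lambda>i. 2 * pi * real (k i) / real N) x
           * cnj (chi d (\<lambda>i. 2 * pi * real (k i) / real N) y))
      = (\<Sum>k\<in>funs {..<d} {..<N}. \<Prod>i<d. cis (2 * pi * real (k i) / real N * real_of_int (x i - y i)))"
    unfolding chi_def cnj_prod prod.distrib[symmetric] cis_cnj cis_mult
    by (simp add: right_diff_distrib diff_divide_distrib)
  also have "\<dots> = (\<Prod>i<d. \<Sum>v<N. cis (2 * pi * real v / real N * real_of_int (x i - y i)))"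
    by (rule sum_prod_funs) simp
  also have "\<dots> = (\<Prod>i<d. if x i = y i then of_nat N else 0)"
  proof (intro prod.cong refl)
    fix i assume i: "i \<in> {..<d}"
    have "int N dvd x i - y i \<longleftrightarrow> x i = y i"
    proof
      assume "int N dvd x i - y i"
      then have "x i - y i = 0 \<or> \<bar>int N\<bar> \<le> \<bar>x i - y i\<bar>" using dvd_imp_le_int by blast
      then show "x i = y i" using xy(3,4)[of i] i N by auto
    qed simp
    moreover have "N > 0" using N by simp
    ultimately show "(\<Sum>v<N. cis (2 * pi * real v / real N * real_of_int (x i - y i)))
       = (if x i = y i then of_nat N else 0)"
      by (subst sum_cis_roots) auto
  qed
  also have "\<dots> = (if x = y then of_nat N ^ d else 0)"
  proof (cases "x = y")
    case False
    then obtain i where "x i \<noteq> y i" by auto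
    then have "i < d" using xy(1,2) by (cases "i < d") (auto simp: int_lattice_def)
    then show ?thesis using False \<open>x i \<noteq> y i\<close> by (auto intro!: prod_zero)
  qed simp
  finally show ?thesis .
qed

text \<open>For a function supported in a box of side length less than \<open>N\<close> the integral over the torus may be replaced
  by the mean over the frequencies in \<open>2 \<pi> / N\<close> times \<open>{0,\<dots>,N-1}\<^sup>d\<close>.\<close>

lemma plancherel:
  assumes f: "f \<in> FS d" and L: "\<And>x i. f x \<noteq> 0 \<Longrightarrow> i < d \<Longrightarrow> \<bar>x i\<bar> \<le> int L" and N: "N = 2 * L + 1"
  shows "(\<Sum>k\<in>funs {..<d} {..<N}. (cmod (FT d (\<lambda>i. 2 * pi * real (k i) / real N) f))\<^sup>2) = real N ^ d * sq f"
proof -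
  define W where "W = {x. f x \<noteq> 0}"
  define \<Theta> where "\<Theta> = (\<lambda>(k :: nat \<Rightarrow> nat) i. 2 * pi * real (k i) / real N)"
  have W: "finite W" using f by (simp add: W_def FS_finite)
  have Wl: "x \<in> int_lattice d" if "x \<in> W" for x using f that by (auto simp: FS_def W_def)
  have FT: "FT d \<xi> f = (\<Sum>x\<in>W. of_real (f x) * chi d \<xi> x)" for \<xi>
    unfolding FT_def using W by (intro Sum_any_FS) (auto simp: W_def)
  have sq: "sq f = (\<Sum>x\<in>W. (f x)\<^sup>2)"
    unfolding sq_def using W by (intro Sum_any_FS) (auto simp: W_def)
  have "complex_of_real (\<Sum>k\<in>funs {..<d} {..<N}. (cmod (FT d (\<Theta> k) f))\<^sup>2)
      = (\<Sum>k\<in>funs {..<d} {..<N}. FT d (\<Theta> k) f * cnj (FT d (\<Theta> k) f))"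
    by (simp add: complex_norm_square[symmetric])
  also have "\<dots> = (\<Sum>k\<in>funs {..<d} {..<N}. \<Sum>x\<in>W. \<Sum>y\<in>W.
        of_real (f x * f y) * (chi d (\<Theta> k) x * cnj (chi d (\<Theta> k) y)))"
    unfolding FT cnj_sum sum_product by (simp add: mult_ac)
  also have "\<dots> = (\<Sum>x\<in>W. \<Sum>y\<in>W. of_real (f x * f y) *
        (\<Sum>k\<in>funs {..<d} {..<N}. chi d (\<Theta> k) x * cnj (chi d (\<Theta> k) y)))"
    unfolding sum_distrib_left
    by (subst sum.swap, intro sum.cong refl) (rule sum.swap)
  also have "\<dots> = (\<Sum>x\<in>W. \<Sum>y\<in>W. of_real (f x * f y) * (if x = y then of_nat N ^ d else 0))"
    unfolding \<Theta>_def
    by (intro sum.cong refl arg_cong2[where f = "(*)"] chi_orthogonality[where L = L] Wl L N)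
       (auto simp: W_def)
  also have "\<dots> = (\<Sum>x\<in>W. of_real ((f x)\<^sup>2) * of_nat N ^ d)"
    using W by (intro sum.cong refl) (simp add: if_distrib power2_eq_square cong: if_cong)
  also have "\<dots> = complex_of_real (real N ^ d * sq f)"
    by (simp add: sq sum_distrib_left mult.commute)
  finally show ?thesis unfolding \<Theta>_def of_real_eq_iff .
qed

lemma sum_sq_le_of_multipliers:
  assumes I: "finite I" and f: "f \<in> FS d" and g: "\<And>n. n \<in> I \<Longrightarrow> g n \<in> FS d"
    and FT: "\<And>n \<xi>. n \<in> I \<Longrightarrow> FT d \<xi> (g n) = m n \<xi> * FT d \<xi> f"
    and m: "\<And>\<xi>. (\<Sum>n\<in>I. (cmod (m n \<xi>))\<^sup>2) \<le> C"
  shows "(\<Sum>n\<in>I. sq (g n)) \<le> C * sq f"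
proof -
  define W where "W = {x. f x \<noteq> 0} \<union> (\<Union>n\<in>I. {x. g n x \<noteq> 0})"
  have W: "finite W" using I FS_finite[OF f] FS_finite[OF g] by (auto simp: W_def)
  define L where "L = (\<Sum>x\<in>W. \<Sum>i<d. nat \<bar>x i\<bar>)"
  have L: "\<bar>x i\<bar> \<le> int L" if "x \<in> W" "i < d" for x i
  proof -
    have "nat \<bar>x i\<bar> \<le> (\<Sum>i<d. nat \<bar>x i\<bar>)" using that by (intro member_le_sum) auto
    also have "\<dots> \<le> L" unfolding L_def using that W by (intro member_le_sum[of x W "\<lambda>x. \<Sum>i<d. nat \<bar>x i\<bar>"]) auto
    finally show ?thesis by linarith
  qed
  \<comment> \<open>coordinates of points in the supports differ by at most \<open>2 L < N\<close>\<close>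
  define N where "N = 2 * L + 1"
  define \<Theta> where "\<Theta> = (\<lambda>(k :: nat \<Rightarrow> nat) i. 2 * pi * real (k i) / real N)"
  define T where "T = funs {..<d} {..<N}"
  have "real N ^ d * (\<Sum>n\<in>I. sq (g n)) = (\<Sum>n\<in>I. \<Sum>k\<in>T. (cmod (FT d (\<Theta> k) (g n)))\<^sup>2)"
    unfolding sum_distrib_left T_def \<Theta>_def
    by (intro sum.cong refl plancherel[symmetric, OF g _ N_def] L) (auto simp: W_def)
  also have "\<dots> = (\<Sum>k\<in>T. (\<Sum>n\<in>I. (cmod (m n (\<Theta> k)))\<^sup>2) * (cmod (FT d (\<Theta> k) f))\<^sup>2)"
    by (subst sum.swap) (simp add: FT norm_mult power_mult_distrib sum_distrib_right)
  also have "\<dots> \<le> (\<Sum>k\<in>T. C * (cmod (FT d (\<Theta> k) f))\<^sup>2)"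
    by (intro sum_mono mult_right_mono m) auto
  also have "\<dots> = C * (real N ^ d * sq f)"
    unfolding sum_distrib_left[symmetric] T_def \<Theta>_def
    by (intro arg_cong2[where f = "(*)"] refl plancherel[OF f _ N_def] L) (auto simp: W_def)
  finally have "real N ^ d * (\<Sum>n\<in>I. sq (g n)) \<le> real N ^ d * (C * sq f)" by (simp add: mult_ac)
  moreover have "real N ^ d > 0" by (simp add: N_def)
  ultimately show ?thesis by simp
qed

section \<open>Comparison of multipliers\<close>

text \<open>The mean of the cosines of the frequency, which is the multiplier of the nearest neighbour average. The
  multipliers of the Cesaro means and of the averages over balls are the next two definitions.\<close>

definition mcos :: "nat \<Rightarrow> (nat \<Rightarrow> real) \<Rightarrow> real" where
  "mcos d \<xi> = (\<Sum>i<d. cos (\<xi> i)) / real d"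

definition cesaro_mult :: "nat \<Rightarrow> real \<Rightarrow> real" where
  "cesaro_mult l c = (\<Sum>k<2 ^ l. c ^ k) / 2 ^ l"

definition ball_mult :: "nat \<Rightarrow> real \<Rightarrow> real \<Rightarrow> (nat \<Rightarrow> real) \<Rightarrow> complex" where
  "ball_mult d q K \<xi> = (\<Sum>y\<in>qball {..<d} q K. chi d \<xi> y) / of_nat (card (qball {..<d} q K))"

lemma abs_mcos_le: "\<bar>mcos d \<xi>\<bar> \<le> 1"
proof -
  have "\<bar>\<Sum>i<d. cos (\<xi> i)\<bar> \<le> (\<Sum>i<d. \<bar>cos (\<xi> i)\<bar>)" by (rule sum_abs)
  also have "\<dots> \<le> (\<Sum>i<d. 1)" by (intro sum_mono) simp
  finally show ?thesis by (cases "d = 0") (simp_all add: mcos_def divide_le_eq_1)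
qed

lemma one_minus_power_le:
  assumes "\<bar>c\<bar> \<le> (1::real)"
  shows "\<bar>1 - c ^ k\<bar> \<le> real k * (1 - c)"
proof (induction k)
  case (Suc k)
  have "\<bar>1 - c ^ Suc k\<bar> = \<bar>(1 - c) + c * (1 - c ^ k)\<bar>" by (simp add: algebra_simps)
  also have "\<dots> \<le> (1 - c) + \<bar>c\<bar> * \<bar>1 - c ^ k\<bar>"
    using assms by (intro order_trans[OF abs_triangle_ineq]) (simp add: abs_mult)
  also have "\<dots> \<le> (1 - c) + 1 * (real k * (1 - c))"
    using assms Suc by (intro add_left_mono mult_mono) auto
  finally show ?case by (simp add: algebra_simps)
qed simp

lemma cesaro_mult_low:
  assumes "\<bar>c\<bar> \<le> 1"
  shows "\<bar>1 - cesaro_mult l c\<bar> \<le> 2 ^ l * (1 - c)"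
proof -
  have "1 - cesaro_mult l c = (\<Sum>k<2 ^ l. 1 - c ^ k) / 2 ^ l"
    by (simp add: cesaro_mult_def sum_subtractf diff_divide_distrib)
  also have "\<bar>\<dots>\<bar> \<le> (\<Sum>k<(2::nat) ^ l. \<bar>1 - c ^ k\<bar>) / 2 ^ l"
    by (simp add: divide_right_mono)
  also have "\<dots> \<le> (\<Sum>k<(2::nat) ^ l. 2 ^ l * (1 - c)) / 2 ^ l"
  proof (intro divide_right_mono sum_mono)
    fix k assume "k \<in> {..<(2::nat) ^ l}"
    then have "real k \<le> real (2 ^ l)" unfolding of_nat_le_iff by simp
    then have "real k * (1 - c) \<le> 2 ^ l * (1 - c)" using assms by (intro mult_right_mono) auto
    then show "\<bar>1 - c ^ k\<bar> \<le> 2 ^ l * (1 - c)" using one_minus_power_le[OF assms, of k] by linarith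
  qed simp
  also have "\<dots> = 2 ^ l * (1 - c)" by simp
  finally show ?thesis .
qed

lemma cesaro_mult_high:
  assumes "\<bar>c\<bar> \<le> 1" "c < 1"
  shows "\<bar>cesaro_mult l c\<bar> \<le> 2 / sqrt (2 ^ l * (1 - c))"
proof -
  define a where "a = \<bar>cesaro_mult l c\<bar>"
  define u where "u = 2 ^ l * (1 - c)"
  have u: "u > 0" using assms by (simp add: u_def)
  have "cesaro_mult l c = (c ^ 2 ^ l - 1) / (c - 1) / 2 ^ l"
    unfolding cesaro_mult_def using assms by (subst geometric_sum) auto
  then have "a = \<bar>c ^ 2 ^ l - 1\<bar> / u"
    using assms by (simp add: a_def u_def abs_divide abs_mult mult.commute)
  also have "\<dots> \<le> 2 / u"
  proof -
    have "\<bar>c ^ 2 ^ l\<bar> \<le> 1" using assms by (simp add: power_abs power_le_one)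
    then have "\<bar>c ^ 2 ^ l - 1\<bar> \<le> 2" by linarith
    then show ?thesis using u by (intro divide_right_mono) auto
  qed
  finally have 1: "a \<le> 2 / u" .
  have 2: "a \<le> 1"
  proof -
    have "a \<le> (\<Sum>k<(2::nat) ^ l. \<bar>c ^ k\<bar>) / 2 ^ l"
      by (simp add: a_def cesaro_mult_def divide_right_mono)
    also have "\<dots> \<le> (\<Sum>k<(2::nat) ^ l. 1) / 2 ^ l"
      using assms by (intro divide_right_mono sum_mono) (auto simp: power_abs power_le_one)
    finally show ?thesis by simp
  qed
  have "a * a \<le> 2 / u * 1" using 1 2 u by (intro mult_mono) (auto simp: a_def)
  also have "\<dots> \<le> (2 / sqrt u) * (2 / sqrt u)" using u by (simp add: field_simps)
  finally have "a\<^sup>2 \<le> (2 / sqrt u)\<^sup>2" by (simp add: power2_eq_square)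
  then have "a \<le> 2 / sqrt u" by (rule power2_le_imp_le) (use u in simp)
  then show ?thesis by (simp add: a_def u_def)
qed

text \<open>The multiplier of the difference between the average over a ball, applied after one lazy step, and
  the Cesaro mean with index \<open>l\<close>.\<close>

definition mult_diff :: "nat \<Rightarrow> real \<Rightarrow> real \<Rightarrow> nat \<Rightarrow> (nat \<Rightarrow> real) \<Rightarrow> complex" where
  "mult_diff d q K l \<xi> = ball_mult d q K \<xi> * of_real ((1 + mcos d \<xi>) / 2)
     - of_real (cesaro_mult l (mcos d \<xi>))"

lemma qball_nonempty: "K \<ge> 0 \<Longrightarrow> (\<lambda>_. 0) \<in> qball D q K"
  by (simp add: qball_def)

lemma card_qball_pos:
  assumes "q \<ge> 1" "K \<ge> 0"
  shows "card (qball {..<d} q K) > 0"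
  using assms qball_nonempty[of K "{..<d}" q] finite_qball[of "{..<d}" q K]
  by (auto simp: card_gt_0_iff)

text \<open>With \<open>v = 2\<^sup>l s\<close>, which is comparable to \<open>K s\<close>, the difference of the multipliers is \<open>O(v)\<close> and
  also \<open>O(K/d + 1 / \<surd>v)\<close>.\<close>

lemma mult_diff_bound:
  assumes q: "q \<ge> 1" and K: "4 \<le> K" "4 * K \<le> real d" and l: "2 ^ l \<le> K" "K < 2 * 2 ^ l"
    and s_def: "s = 1 - mcos d \<xi>"
  shows "(cmod (mult_diff d q K l \<xi>))\<^sup>2
     \<le> 470000 * (K / real d)\<^sup>2 + 14000 * (if 2 ^ l * s \<le> 1 then 2 ^ l * s else 1 / (2 ^ l * s))"
proof -
  define c where "c = mcos d \<xi>"
  define \<rho> where "\<rho> = K / real d"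
  define s' where "s' = 1 + c"
  define n where "n = real (card (qball {..<d} q K))"
  have d: "real d > 0" using K by linarith
  have n: "n > 0" unfolding n_def using q K by (simp add: card_qball_pos)
  have c1: "\<bar>c\<bar> \<le> 1" unfolding c_def by (rule abs_mcos_le)
  have s: "s = (\<Sum>i<d. 1 - cos (\<xi> i)) / real d"
    using d by (simp add: s_def mcos_def sum_subtractf diff_divide_distrib)
  have s': "s' = (\<Sum>i<d. 1 + cos (\<xi> i)) / real d"
    using d by (simp add: s'_def c_def mcos_def sum.distrib add_divide_distrib)
  have sb: "0 \<le> s" "s \<le> 2" "0 \<le> s'" "s' \<le> 2" "s = 1 - c"
    using c1 by (auto simp: s_def s'_def c_def[symmetric])
  define \<mu> where "\<mu> = ball_mult d q K \<xi>"
  define D where "D = cmod (\<mu> * of_real (s' / 2) - of_real (cesaro_mult l c))"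
  define v where "v = 2 ^ l * s"
  have v: "v \<ge> 0" using sb by (simp add: v_def)
  have Ks: "K * s \<le> 2 * v" "v \<le> K * s"
    using l sb mult_right_mono[of K "2 * 2 ^ l" s] mult_right_mono[of "2 ^ l" K s] by (auto simp: v_def)
  have low: "D \<le> 100 * v"
  proof -
    have "\<mu> - 1 = - ((of_nat (card (qball {..<d} q K)) - (\<Sum>x\<in>qball {..<d} q K. chi d \<xi> x)) / of_real n)"
      using n by (simp add: \<mu>_def ball_mult_def n_def field_simps)
    then have "cmod (\<mu> - 1) = cmod (of_nat (card (qball {..<d} q K)) - (\<Sum>x\<in>qball {..<d} q K. chi d \<xi> x)) / n"
      using n by (simp only: norm_minus_cancel norm_divide norm_of_real abs_of_pos)
    also have "\<dots> \<le> (48 * (K / real d) * (\<Sum>i<d. 1 - cos (\<xi> i)) * n) / n"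
      unfolding n_def using K q by (intro divide_right_mono chi_sum_low) auto
    also have "\<dots> = 48 * (K * s)" using n d by (simp add: s)
    finally have m1: "cmod (\<mu> - 1) \<le> 48 * (K * s)" .
    have "\<mu> * of_real (s' / 2) - of_real (cesaro_mult l c)
        = (\<mu> - 1) * of_real (s' / 2) + (of_real (- (s / 2)) + of_real (1 - cesaro_mult l c))"
      by (simp add: sb(5) s'_def algebra_simps add_divide_distrib diff_divide_distrib)
    also have "cmod \<dots> \<le> cmod (\<mu> - 1) * (s' / 2) + (s / 2 + \<bar>1 - cesaro_mult l c\<bar>)"
    proof (intro norm_triangle_mono)
      show "cmod ((\<mu> - 1) * of_real (s' / 2)) \<le> cmod (\<mu> - 1) * (s' / 2)"
        using sb by (simp add: norm_mult)
      show "cmod (of_real (- (s / 2))) \<le> s / 2" unfolding norm_of_real abs_minus_cancel using sb(1) by simp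
      show "cmod (of_real (1 - cesaro_mult l c)) \<le> \<bar>1 - cesaro_mult l c\<bar>" by (simp only: norm_of_real)
    qed
    also have "\<dots> \<le> 48 * (K * s) * 1 + (v + v)"
    proof (intro add_mono mult_mono)
      show "s / 2 \<le> v" using sb mult_right_mono[of 1 "2 ^ l" s] by (simp add: v_def)
      show "\<bar>1 - cesaro_mult l c\<bar> \<le> v" using cesaro_mult_low[OF c1, of l] by (simp add: v_def sb(5))
    qed (use m1 sb K in auto)
    also have "\<dots> \<le> 100 * v" using Ks by simp
    finally show ?thesis by (simp add: D_def)
  qed
  have high: "D \<le> 481 * \<rho> + 41 / sqrt v" if v0: "v > 0"
  proof -
    have s0: "s > 0" using v0 by (simp add: v_def zero_less_mult_iff)
    have "cmod \<mu> * (s' / 2) \<le> 481 * \<rho> + 39 / sqrt v"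
    proof (cases "s' = 0")
      case True
      then show ?thesis using v0 K by (simp add: \<rho>_def)
    next
      case False
      then have s'0: "s' > 0" using sb by simp
      have "cmod \<mu> = cmod (\<Sum>x\<in>qball {..<d} q K. chi d \<xi> x) / n"
        using n by (simp add: \<mu>_def ball_mult_def norm_divide n_def)
      also have "\<dots> \<le> ((481 * \<rho> + 54 / sqrt (K * (s * s'))) * n) / n"
        unfolding n_def \<rho>_def using n s0 s'0 by (intro divide_right_mono chi_sum_high q K s s') auto
      also have "\<dots> = 481 * \<rho> + 54 / sqrt (K * (s * s'))" using n by simp
      finally have "cmod \<mu> * (s' / 2) \<le> (481 * \<rho> + 54 / sqrt (K * (s * s'))) * (s' / 2)"
        using sb by (intro mult_right_mono) auto
      also have "\<dots> = 481 * \<rho> * (s' / 2) + 27 * (s' / sqrt (K * (s * s')))"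
        by (simp add: field_simps)
      also have "\<dots> \<le> 481 * \<rho> * 1 + 27 * (sqrt 2 / sqrt v)"
      proof (intro add_mono mult_left_mono)
        \<comment> \<open>the factor \<open>s'\<close> of the lazy step absorbs the singularity \<open>1 / \<surd>s'\<close>\<close>
        have "s' = sqrt s' * sqrt s'" using s'0 by simp
        then have "s' / sqrt (K * (s * s')) = sqrt s' / sqrt (K * s)"
          using s'0 s0 K by (simp add: real_sqrt_mult field_simps)
        also have "\<dots> \<le> sqrt 2 / sqrt v"
          using sb v0 Ks by (intro frac_le) auto
        finally show "s' / sqrt (K * (s * s')) \<le> sqrt 2 / sqrt v" .
      qed (use sb K in \<open>auto simp: \<rho>_def\<close>)
      also have "\<dots> \<le> 481 * \<rho> + 39 / sqrt v"
      proof -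
        have "sqrt 2 \<le> 13 / 9" by (rule real_le_lsqrt) (auto simp: power2_eq_square)
        \<comment> \<open>\<open>39\<close> is an integer above \<open>27 \<surd>2\<close>\<close>
        then have "27 * (sqrt 2 / sqrt v) \<le> 39 / sqrt v"
          using v0 divide_right_mono[of "27 * sqrt 2" 39 "sqrt v"] by simp
        then show ?thesis by simp
      qed
      finally show ?thesis .
    qed
    moreover have "\<bar>cesaro_mult l c\<bar> \<le> 2 / sqrt v"
      using cesaro_mult_high[OF c1, of l] s0 by (simp add: v_def sb(5))
    moreover have "D \<le> cmod \<mu> * (s' / 2) + \<bar>cesaro_mult l c\<bar>"
    proof -
      have "D \<le> cmod (\<mu> * of_real (s' / 2)) + cmod (complex_of_real (cesaro_mult l c))"
        unfolding D_def by (rule norm_triangle_ineq4)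
      then show ?thesis using sb by (simp add: norm_mult)
    qed
    ultimately show ?thesis by (simp add: add_divide_distrib[symmetric])
  qed
  have D0: "D \<ge> 0" by (simp add: D_def)
  have \<rho>0: "\<rho> \<ge> 0" using K by (simp add: \<rho>_def)
  \<comment> \<open>crude constants: \<open>2 * 481\<^sup>2 \<le> 470000\<close> and \<open>2 * 41\<^sup>2 = 3362\<close>\<close>
  have high2: "D\<^sup>2 \<le> 470000 * \<rho>\<^sup>2 + 3362 / v" if v0: "v > 0"
  proof -
    have "D\<^sup>2 \<le> (481 * \<rho> + 41 / sqrt v)\<^sup>2" using high[OF v0] D0 by (intro power_mono) auto
    also have "\<dots> \<le> 2 * (481 * \<rho>)\<^sup>2 + 2 * (41 / sqrt v)\<^sup>2"
      using sum_squares_bound[of "481 * \<rho>" "41 / sqrt v"] by (simp add: power2_sum)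
    also have "(41 / sqrt v)\<^sup>2 = 1681 / v" using v0 by (simp add: power_divide)
    finally have "D\<^sup>2 \<le> 462722 * \<rho>\<^sup>2 + 3362 / v" by (simp add: power_mult_distrib)
    then show ?thesis using zero_le_power2[of \<rho>] by linarith
  qed
  have "D\<^sup>2 \<le> 470000 * \<rho>\<^sup>2 + 14000 * (if v \<le> 1 then v else 1 / v)"
  proof (cases "v \<le> 1/2")
    case True
    have "D\<^sup>2 \<le> (100 * v)\<^sup>2" using low D0 by (intro power_mono) auto
    also have "\<dots> = 10000 * (v * v)" by (simp add: power2_eq_square)
    also have "\<dots> \<le> 10000 * (v * (1/2))" using True v by (intro mult_left_mono) auto
    also have "\<dots> \<le> 470000 * \<rho>\<^sup>2 + 14000 * v" using v zero_le_power2[of \<rho>] by linarith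
    finally show ?thesis using True by simp
  next
    case False
    then have v0: "v > 0" by simp
    have "3362 / v \<le> 14000 * (if v \<le> 1 then v else 1 / v)"
    proof (cases "v \<le> 1")
      case True
      have "(1/2) * (1/2) \<le> v * v" using False by (intro mult_mono) auto
      then have "3362 / v \<le> 14000 * v" using v0 by (simp add: field_simps)
      then show ?thesis using True by simp
    qed (use v0 in \<open>simp add: divide_right_mono\<close>)
    then show ?thesis using high2[OF v0] by linarith
  qed
  then show ?thesis unfolding D_def mult_diff_def \<mu>_def s'_def c_def \<rho>_def v_def .
qed

section \<open>The square function and the bound on square summable functions\<close>

lemma sum_two_power_le:
  assumes "finite L" "\<And>l. l \<in> L \<Longrightarrow> 2 ^ l \<le> (A::real)" "A \<ge> 0"
  shows "(\<Sum>l\<in>L. 2 ^ l) \<le> 2 * A"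
proof (cases "L = {}")
  case False
  define b where "b = Max L"
  have b: "b \<in> L" "L \<subseteq> {..b}" using False assms(1) by (auto simp: b_def)
  have geo: "(\<Sum>l\<le>n. (2::real) ^ l) \<le> 2 * 2 ^ n" for n by (induction n) auto
  have "(\<Sum>l\<in>L. (2::real) ^ l) \<le> (\<Sum>l\<le>b. 2 ^ l)" using b(2) by (intro sum_mono2) auto
  also have "\<dots> \<le> 2 * 2 ^ b" by (rule geo)
  also have "\<dots> \<le> 2 * A" using assms(2)[OF b(1)] by simp
  finally show ?thesis .
qed (use assms in simp)

text \<open>A geometric sum in both directions. The summand \<open>min v (1 / v)\<close> with \<open>v = 2\<^sup>l s\<close> is at most six times the
  increment of \<open>v / (1 + v)\<close> from \<open>v\<close> to \<open>2 v\<close>, so the sum telescopes.\<close>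

lemma sum_min_dyadic_le:
  assumes "finite L" "s \<ge> 0"
  shows "(\<Sum>l\<in>L. if 2 ^ l * s \<le> 1 then 2 ^ l * s else 1 / (2 ^ l * s)) \<le> (6::real)"
proof -
  define \<phi> where "\<phi> = (\<lambda>v::real. v / (1 + v))"
  have step: "(if v \<le> 1 then v else 1 / v) \<le> 6 * (\<phi> (2 * v) - \<phi> v)" if v: "v \<ge> 0" for v
  proof -
    have e: "\<phi> (2 * v) - \<phi> v = v / ((1 + v) * (1 + 2 * v))"
      using v by (simp add: \<phi>_def divide_simps) (simp add: algebra_simps)
    show ?thesis
    proof (cases "v \<le> 1")
      case True
      have "(1 + v) * (1 + 2 * v) \<le> 2 * 3" using True v by (intro mult_mono) auto
      then have "v / 6 \<le> v / ((1 + v) * (1 + 2 * v))"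
        using v by (intro divide_left_mono) (auto intro: add_pos_nonneg)
      then have "v \<le> 6 * (\<phi> (2 * v) - \<phi> v)" unfolding e by linarith
      then show ?thesis using True by simp
    next
      case False
      have "(1 + v) * (1 + 2 * v) \<le> (2 * v) * (3 * v)" using False by (intro mult_mono) auto
      then have "v / ((2 * v) * (3 * v)) \<le> v / ((1 + v) * (1 + 2 * v))"
        using False by (intro divide_left_mono) (auto intro: add_pos_nonneg)
      moreover have "v / ((2 * v) * (3 * v)) = 1 / (6 * v)" using False by simp
      ultimately show ?thesis using False e by simp
    qed
  qed
  have mono: "\<phi> (2 * v) - \<phi> v \<ge> 0" if "v \<ge> 0" for v
    using step[OF that] that by (smt (verit) divide_nonneg_nonneg)
  obtain b where b: "L \<subseteq> {..<b}" using assms(1) finite_nat_set_iff_bounded by auto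
  have "(\<Sum>l\<in>L. if 2 ^ l * s \<le> 1 then 2 ^ l * s else 1 / (2 ^ l * s))
      \<le> (\<Sum>l\<in>L. 6 * (\<phi> (2 ^ Suc l * s) - \<phi> (2 ^ l * s)))"
    using step[of "2 ^ _ * s"] assms(2) by (intro sum_mono) (simp add: mult.assoc)
  also have "\<dots> \<le> (\<Sum>l<b. 6 * (\<phi> (2 ^ Suc l * s) - \<phi> (2 ^ l * s)))"
    using b mono[of "2 ^ _ * s"] assms by (intro sum_mono2) (auto simp: mult.assoc)
  also have "\<dots> = 6 * (\<phi> (2 ^ b * s) - \<phi> (2 ^ 0 * s))"
    unfolding sum_distrib_left[symmetric] by (subst sum_lessThan_telescope) simp
  also have "\<dots> \<le> 6 * 1"
  proof -
    have "\<phi> v \<le> 1" "\<phi> v \<ge> 0" if "v \<ge> 0" for v using that by (auto simp: \<phi>_def divide_le_eq_1)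
    then have "\<phi> (2 ^ b * s) \<le> 1" "\<phi> (2 ^ 0 * s) \<ge> 0" using assms by auto
    then show ?thesis by argo
  qed
  finally show ?thesis by simp
qed

lemma mult_diff_square_sum:
  assumes q: "q \<ge> 1" and I: "finite I" and inj: "inj_on l I"
    and K: "\<And>n. n \<in> I \<Longrightarrow> 4 \<le> K n" "\<And>n. n \<in> I \<Longrightarrow> 4 * K n \<le> real d"
    and l: "\<And>n. n \<in> I \<Longrightarrow> 2 ^ l n \<le> K n" "\<And>n. n \<in> I \<Longrightarrow> K n < 2 * 2 ^ l n"
  shows "(\<Sum>n\<in>I. (cmod (mult_diff d q (K n) (l n) \<xi>))\<^sup>2) \<le> 2000000"
proof -
  define s where "s = 1 - mcos d \<xi>"
  have s: "s \<ge> 0" using abs_mcos_le[of d \<xi>] by (simp add: s_def)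
  define \<psi> where "\<psi> = (\<lambda>l. if 2 ^ l * s \<le> 1 then 2 ^ l * s else 1 / (2 ^ l * s))"
  show ?thesis
  proof (cases "I = {}")
    case False
    then have d: "real d > 0" using K by fastforce
    have sq: "(K n / real d)\<^sup>2 \<le> 2 ^ l n * (2 / real d)" if "n \<in> I" for n
    proof -
      have "0 \<le> K n / real d" "K n / real d \<le> 1" using K[OF that] d by auto
      then have "(K n / real d)\<^sup>2 \<le> K n / real d"
        unfolding power2_eq_square by (intro mult_left_le) auto
      also have "\<dots> \<le> 2 * 2 ^ l n / real d" using l[OF that] d by (intro divide_right_mono) auto
      finally show ?thesis by (simp add: mult.commute)
    qed
    have "(\<Sum>n\<in>I. (cmod (mult_diff d q (K n) (l n) \<xi>))\<^sup>2)
       \<le> (\<Sum>n\<in>I. 470000 * (K n / real d)\<^sup>2 + 14000 * \<psi> (l n))"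
      unfolding \<psi>_def by (intro sum_mono mult_diff_bound q K l) (auto simp: s_def)
    also have "\<dots> \<le> (\<Sum>n\<in>I. 470000 * (2 ^ l n * (2 / real d)) + 14000 * \<psi> (l n))"
      by (intro sum_mono add_right_mono mult_left_mono sq) auto
    also have "\<dots> = 470000 * ((\<Sum>n\<in>I. 2 ^ l n) * (2 / real d)) + 14000 * (\<Sum>n\<in>I. \<psi> (l n))"
      unfolding sum.distrib sum_distrib_right sum_distrib_left ..
    also have "(\<Sum>n\<in>I. 2 ^ l n) = (\<Sum>k\<in>l ` I. 2 ^ k)"
      by (simp add: sum.reindex[OF inj])
    also have "(\<Sum>n\<in>I. \<psi> (l n)) = (\<Sum>k\<in>l ` I. \<psi> k)"
      by (simp add: sum.reindex[OF inj])
    also have "470000 * ((\<Sum>k\<in>l ` I. 2 ^ k) * (2 / real d)) + 14000 * (\<Sum>k\<in>l ` I. \<psi> k)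
        \<le> 470000 * ((2 * (real d / 4)) * (2 / real d)) + 14000 * 6"
    proof (intro add_mono mult_left_mono mult_right_mono)
      show "(\<Sum>k\<in>l ` I. 2 ^ k) \<le> 2 * (real d / 4)"
      proof (rule sum_two_power_le)
        fix k assume "k \<in> l ` I"
        then obtain n where "n \<in> I" "k = l n" by auto
        then show "2 ^ k \<le> real d / 4" using K(2)[of n] l(1)[of n] by simp
      qed (use I in auto)
      show "(\<Sum>k\<in>l ` I. \<psi> k) \<le> 6"
        unfolding \<psi>_def by (rule sum_min_dyadic_le) (use I s in auto)
    qed auto
    also have "\<dots> \<le> 2000000" using d by simp
    finally show ?thesis .
  qed simp
qed

text \<open>The \<open>q\<close>-th power of the radius \<open>2\<^sup>n\<close>. The admissible radii \<open>2\<^sup>n \<le> d\<^bsup>1/q\<^esup>\<close> are those with scale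
  at most \<open>d\<close>.\<close>

definition scale :: "real \<Rightarrow> nat \<Rightarrow> real" where
  "scale q n = (2 ^ n) powr q"

definition scales :: "nat \<Rightarrow> real \<Rightarrow> nat set" where
  "scales d q = {n. scale q n \<le> real d}"

lemma scale_eq: "scale q n = 2 powr (q * real n)"
  by (simp add: scale_def powr_realpow[symmetric] powr_powr mult.commute)

lemma scale_pos: "scale q n > 0"
  by (simp add: scale_eq)

lemma scale_mono:
  assumes "q \<ge> 1" "m \<le> n"
  shows "2 ^ (n - m) * scale q m \<le> scale q n"
proof -
  have "2 ^ (n - m) * scale q m = 2 powr (real (n - m) + q * real m)"
    by (simp add: scale_eq powr_add powr_realpow)
  also have "\<dots> \<le> 2 powr (q * real n)"
  proof (rule powr_mono)
    have "1 * real (n - m) \<le> q * real (n - m)" using assms by (intro mult_right_mono) auto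
    then show "real (n - m) + q * real m \<le> q * real n"
      using assms by (simp add: of_nat_diff algebra_simps)
  qed simp
  finally show ?thesis by (simp add: scale_eq)
qed

lemma scale_0: "scale q 0 = 1"
  by (simp add: scale_def)

lemma scale_ge: "q \<ge> 1 \<Longrightarrow> 2 ^ n \<le> scale q n"
  using scale_mono[of q 0 n] by (simp add: scale_0)

lemma finite_scales:
  assumes "q \<ge> 1"
  shows "finite (scales d q)"
proof (rule finite_subset)
  show "scales d q \<subseteq> {..d}"
  proof
    fix n assume "n \<in> scales d q"
    then have "2 ^ n \<le> real d"
      using scale_ge[OF assms, of n] unfolding scales_def mem_Collect_eq by linarith
    moreover have "real n \<le> 2 ^ n" by (rule of_nat_less_two_power[THEN less_imp_le])
    ultimately have "real n \<le> real d" by linarith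
    then show "n \<in> {..d}" by simp
  qed
qed simp

lemma scales_0: "d \<ge> 1 \<Longrightarrow> 0 \<in> scales d q"
  by (simp add: scales_def scale_0)

text \<open>Scales at least double with \<open>n\<close>, so at most two of them are below \<open>4\<close>, and at most two lie in the top
  range \<open>d / 4 < scale q n \<le> d\<close>.\<close>

lemma card_exceptional_scales:
  assumes q: "q \<ge> 1"
  shows "card {n \<in> scales d q. \<not> (4 \<le> scale q n \<and> 4 * scale q n \<le> real d)} \<le> 4"
proof -
  define E where "E = {n \<in> scales d q. 4 * scale q n > real d}"
  have E: "\<exists>m. E \<subseteq> {m, Suc m}"
  proof (cases "E = {}")
    case False
    define m where "m = (LEAST n. n \<in> E)"
    have m: "m \<in> E" unfolding m_def using False by (auto intro: LeastI)
    have "E \<subseteq> {m, Suc m}"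
    proof
      fix n assume n: "n \<in> E"
      have mn: "m \<le> n" unfolding m_def using n by (rule Least_le)
      show "n \<in> {m, Suc m}"
      proof (rule ccontr)
        assume "n \<notin> {m, Suc m}"
        then have "2 \<le> n - m" using mn by auto
        then have "(2::real) ^ 2 \<le> 2 ^ (n - m)" by (intro power_increasing) auto
        then have "2 ^ 2 * scale q m \<le> 2 ^ (n - m) * scale q m"
          using scale_pos[of q m] by (intro mult_right_mono) auto
        also have "\<dots> \<le> scale q n" by (rule scale_mono[OF q mn])
        finally show False using m n by (simp add: E_def scales_def)
      qed
    qed
    then show ?thesis by blast
  qed auto
  then obtain m where m: "E \<subseteq> {m, Suc m}" by blast
  have "{n \<in> scales d q. \<not> (4 \<le> scale q n \<and> 4 * scale q n \<le> real d)} \<subseteq> {0, 1, m, Suc m}"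
  proof
    fix n assume n: "n \<in> {n \<in> scales d q. \<not> (4 \<le> scale q n \<and> 4 * scale q n \<le> real d)}"
    show "n \<in> {0, 1, m, Suc m}"
    proof (cases "4 \<le> scale q n")
      case True
      then have "n \<in> E" using n by (auto simp: E_def)
      then show ?thesis using m by auto
    next
      case False
      have "n < 2"
      proof (rule ccontr)
        assume "\<not> n < 2"
        then have "(2::real) ^ 2 \<le> 2 ^ n" by (intro power_increasing) auto
        then show False using False scale_ge[OF q, of n] by simp
      qed
      then show ?thesis by auto
    qed
  qed
  then have "card {n \<in> scales d q. \<not> (4 \<le> scale q n \<and> 4 * scale q n \<le> real d)} \<le> card {0, 1, m, Suc m}"
    by (intro card_mono) auto
  also have "\<dots> \<le> 4" by (simp add: card_insert_if)
  finally show ?thesis .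
qed

text \<open>The index \<open>l\<close> of the Cesaro mean that is matched with the scale \<open>n\<close>. It is injective in \<open>n\<close> because
  \<open>q \<ge> 1\<close>, so every Cesaro mean is used at most once.\<close>

definition dlevel :: "real \<Rightarrow> nat \<Rightarrow> nat" where
  "dlevel q n = nat \<lfloor>q * real n\<rfloor>"

lemma dlevel_bounds:
  assumes "q \<ge> 1"
  shows "2 ^ dlevel q n \<le> scale q n" "scale q n < 2 * 2 ^ dlevel q n"
proof -
  have r: "real (dlevel q n) = real_of_int \<lfloor>q * real n\<rfloor>" using assms by (simp add: dlevel_def)
  have "2 ^ dlevel q n = 2 powr real (dlevel q n)" by (simp add: powr_realpow)
  also have "\<dots> \<le> scale q n" unfolding scale_eq r by (intro powr_mono) auto
  finally show "2 ^ dlevel q n \<le> scale q n" .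
  have "scale q n < 2 powr (1 + real (dlevel q n))"
    unfolding scale_eq r by (intro powr_less_mono) linarith+
  also have "\<dots> = 2 * 2 ^ dlevel q n" by (simp add: powr_add powr_realpow)
  finally show "scale q n < 2 * 2 ^ dlevel q n" .
qed

lemma inj_dlevel:
  assumes "q \<ge> 1"
  shows "inj (dlevel q)"
proof (rule strict_mono_imp_inj_on, rule strict_mono_onI)
  fix m n :: nat assume mn: "m < n"
  have "q * real m + 1 \<le> q * real n"
  proof -
    have "1 * 1 \<le> q * (real n - real m)" using assms mn by (intro mult_mono) auto
    then show ?thesis by (simp add: algebra_simps)
  qed
  then have "\<lfloor>q * real m\<rfloor> + 1 \<le> \<lfloor>q * real n\<rfloor>" by linarith
  moreover have "\<lfloor>q * real m\<rfloor> \<ge> 0" using assms by simp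
  ultimately show "dlevel q m < dlevel q n" unfolding dlevel_def by linarith
qed

text \<open>The maximal function for nonnegative functions: the largest of the averages over the admissible balls.\<close>

definition ballmax :: "nat \<Rightarrow> real \<Rightarrow> (point \<Rightarrow> real) \<Rightarrow> point \<Rightarrow> real" where
  "ballmax d q f x = Max ((\<lambda>n. avg (qball {..<d} q (scale q n)) f x) ` scales d q)"

lemma ballmax_attained:
  assumes "q \<ge> 1" "d \<ge> 1"
  shows "\<exists>n\<in>scales d q. ballmax d q f x = avg (qball {..<d} q (scale q n)) f x"
proof -
  have "ballmax d q f x \<in> (\<lambda>n. avg (qball {..<d} q (scale q n)) f x) ` scales d q"
    unfolding ballmax_def using assms finite_scales[of q d] scales_0[of d q] by (intro Max_in) auto
  then show ?thesis by auto
qed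

lemma avg_le_ballmax:
  assumes "q \<ge> 1" "n \<in> scales d q"
  shows "avg (qball {..<d} q (scale q n)) f x \<le> ballmax d q f x"
  unfolding ballmax_def using assms finite_scales[of q d] by (intro Max_ge) auto

lemma qball_lattice: "qball {..<d} q r \<subseteq> int_lattice d"
  by (auto simp: qball_def int_lattice_def)

lemma FS_ballmax:
  assumes "q \<ge> 1" "d \<ge> 1" "f \<in> FS d" "\<And>x. f x \<ge> 0"
  shows "ballmax d q f \<in> FS d"
proof -
  have "(\<lambda>x. \<Sum>n\<in>scales d q. avg (qball {..<d} q (scale q n)) f x) \<in> FS d"
    using assms by (intro FS_sum FS_avg qball_lattice) auto
  then show ?thesis
  proof (rule FS_dominated)
    fix x assume "(\<Sum>n\<in>scales d q. avg (qball {..<d} q (scale q n)) f x) = 0"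
    then have "\<forall>n\<in>scales d q. avg (qball {..<d} q (scale q n)) f x = 0"
      using assms finite_scales[of q d]
      by (subst (asm) sum_nonneg_eq_0_iff) (auto intro: avg_nonneg)
    then show "ballmax d q f x = 0" using ballmax_attained[of q d f x] assms by auto
  qed
qed

text \<open>One step of the lazy walk. Its multiplier \<open>(1 + c) / 2\<close> vanishes at the frequency \<open>\<pi>\<close>, where
  the averages over balls may oscillate with the parity of the number of nonzero coordinates.\<close>

definition lazy :: "nat \<Rightarrow> (point \<Rightarrow> real) \<Rightarrow> point \<Rightarrow> real" where
  "lazy d f x = 1 / 2 * (f x + walk d 1 f x)"

lemma FS_lazy: "f \<in> FS d \<Longrightarrow> lazy d f \<in> FS d"
  unfolding lazy_def[abs_def] by (intro FS_cmult FS_add FS_walk)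

lemma FT_lazy:
  assumes "f \<in> FS d"
  shows "FT d \<xi> (lazy d f) = of_real ((1 + mcos d \<xi>) / 2) * FT d \<xi> f"
  unfolding lazy_def[abs_def] using assms
  by (subst FT_cmult[OF FS_add[OF _ FS_walk]])
     (simp_all add: FT_add FS_walk FT_walk mcos_def algebra_simps add_divide_distrib)

lemma avg_le_avg_lazy:
  assumes "\<And>x. f x \<ge> 0"
  shows "avg V f x \<le> 2 * avg V (lazy d f) x"
proof -
  have "2 * avg V (lazy d f) x = avg V f x + avg V (walk d 1 f) x"
    unfolding lazy_def[abs_def] avg_cmult avg_add by simp
  then show ?thesis using avg_nonneg[of "walk d 1 f" V x] walk_nonneg[of f d 1] assms by auto
qed

lemma sq_ballmax_le:
  assumes q: "q \<ge> 1" and d: "d \<ge> 1" and f: "f \<in> FS d" "\<And>x. f x \<ge> 0"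
  shows "sq (ballmax d q f) \<le> 16000204 * sq f"
proof -
  define M where "M = (\<lambda>n. avg (qball {..<d} q (scale q n)))"
  define Imid where "Imid = {n \<in> scales d q. 4 \<le> scale q n \<and> 4 * scale q n \<le> real d}"
  define Iex where "Iex = {n \<in> scales d q. \<not> (4 \<le> scale q n \<and> 4 * scale q n \<le> real d)}"
  have fin: "finite Imid" "finite Iex" using finite_scales[OF q, of d] by (auto simp: Imid_def Iex_def)
  \<comment> \<open>the functions that enter the square function\<close>
  define dif where "dif = (\<lambda>n x. M n (lazy d f) x + (- 1) * cesaro d (dlevel q n) f x)"
  define b where "b = Max (insert 0 (dlevel q ` Imid))"
  have lb: "dlevel q n \<le> b" if "n \<in> Imid" for n
    unfolding b_def using fin that by (intro Max_ge) auto
  have FSM: "M n g \<in> FS d" if "g \<in> FS d" for n g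
    unfolding M_def using that by (intro FS_avg qball_lattice)
  have FSd: "dif n \<in> FS d" for n
    unfolding dif_def by (intro FS_add FS_cmult FSM FS_cesaro FS_lazy f)
  have FSc: "cesaro_max d b f \<in> FS d" using f by (intro FS_cesaro_max)
  have point: "(ballmax d q f x)\<^sup>2 \<le> (\<Sum>n\<in>Iex. (M n f x)\<^sup>2) + (8 * (cesaro_max d b f x)\<^sup>2 + 8 * (\<Sum>n\<in>Imid. (dif n x)\<^sup>2))" for x
  proof -
    obtain n where n: "n \<in> scales d q" "ballmax d q f x = M n f x"
      using ballmax_attained[OF q d] unfolding M_def by blast
    have Mf: "M n f x \<ge> 0" unfolding M_def using f by (intro avg_nonneg)
    have pos: "(\<Sum>n\<in>Iex. (M n f x)\<^sup>2) \<ge> 0" "(\<Sum>n\<in>Imid. (dif n x)\<^sup>2) \<ge> 0" by (auto intro: sum_nonneg)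
    show ?thesis
    proof (cases "n \<in> Imid")
      case True
      have "M n f x \<le> 2 * M n (lazy d f) x" unfolding M_def by (intro avg_le_avg_lazy f)
      also have "M n (lazy d f) x = dif n x + cesaro d (dlevel q n) f x" by (simp add: dif_def)
      finally have "M n f x \<le> 2 * (\<bar>dif n x\<bar> + cesaro_max d b f x)"
        using cesaro_le_cesaro_max[OF lb[OF True], of d f x] abs_ge_self[of "dif n x"] by argo
      then have "(M n f x)\<^sup>2 \<le> (2 * (\<bar>dif n x\<bar> + cesaro_max d b f x))\<^sup>2"
        using Mf by (intro power_mono) auto
      also have "\<dots> \<le> 8 * (cesaro_max d b f x)\<^sup>2 + 8 * (dif n x)\<^sup>2"
        using sum_squares_bound[of "\<bar>dif n x\<bar>" "cesaro_max d b f x"]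
        by (simp add: power2_sum power_mult_distrib)
      also have "(dif n x)\<^sup>2 \<le> (\<Sum>n\<in>Imid. (dif n x)\<^sup>2)"
        using True fin by (intro member_le_sum) auto
      finally show ?thesis using pos by (simp add: n(2))
    next
      case False
      then have "n \<in> Iex" using n(1) by (auto simp: Imid_def Iex_def)
      then have "(M n f x)\<^sup>2 \<le> (\<Sum>n\<in>Iex. (M n f x)\<^sup>2)"
        using fin by (intro member_le_sum) auto
      moreover have "0 \<le> (cesaro_max d b f x)\<^sup>2" by simp
      ultimately show ?thesis unfolding n(2) using pos by argo
    qed
  qed
  have "sq (ballmax d q f) \<le> Sum_any (\<lambda>x. (\<Sum>n\<in>Iex. (M n f x)\<^sup>2) + (8 * (cesaro_max d b f x)\<^sup>2 + 8 * (\<Sum>n\<in>Imid. (dif n x)\<^sup>2)))"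
    unfolding sq_def using f q d
    by (intro Sum_any_FS_mono[where d = d] point FS_power2 FS_ballmax FS_add FS_sum FS_cmult FSM FSd FSc)
  also have "\<dots> = (\<Sum>n\<in>Iex. sq (M n f)) + (8 * sq (cesaro_max d b f) + 8 * (\<Sum>n\<in>Imid. sq (dif n)))"
  proof -
    have F: "(\<lambda>x. \<Sum>n\<in>Iex. (M n f x)\<^sup>2) \<in> FS d" "(\<lambda>x. 8 * (cesaro_max d b f x)\<^sup>2) \<in> FS d"
      "(\<lambda>x. 8 * (\<Sum>n\<in>Imid. (dif n x)\<^sup>2)) \<in> FS d"
      "(\<lambda>x. (cesaro_max d b f x)\<^sup>2) \<in> FS d" "(\<lambda>x. \<Sum>n\<in>Imid. (dif n x)\<^sup>2) \<in> FS d"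
      by (intro FS_power2 FS_add FS_sum FS_cmult FSM FSd FSc f)+
    show ?thesis
      unfolding sq_def
      by (simp only: Sum_any.distrib[OF FS_finite[OF F(1)] FS_finite[OF FS_add[OF F(2,3)]]]
            Sum_any.distrib[OF FS_finite[OF F(2)] FS_finite[OF F(3)]]
            Sum_any_right_distrib[OF FS_finite[OF F(4)], symmetric]
            Sum_any_right_distrib[OF FS_finite[OF F(5)], symmetric]
            Sum_any_FS_sum[OF FS_power2[OF FSM[OF f(1)]]] Sum_any_FS_sum[OF FS_power2[OF FSd]])
  qed
  also have "\<dots> \<le> 4 * sq f + (8 * (25 * sq f) + 8 * (2000000 * sq f))"
  proof (intro add_mono mult_left_mono)
    have "(\<Sum>n\<in>Iex. sq (M n f)) \<le> (\<Sum>n\<in>Iex. sq f)"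
    proof (rule sum_mono)
      fix n
      have K: "scale q n \<ge> 0" using scale_pos[of q n] by simp
      have "qball {..<d} q (scale q n) \<noteq> {}" using qball_nonempty[OF K] by blast
      then show "sq (M n f) \<le> sq f"
        unfolding M_def using f q by (intro sq_avg_le[where d = d] qball_lattice finite_qball) auto
    qed
    also have "\<dots> = real (card Iex) * sq f" by simp
    also have "\<dots> \<le> 4 * sq f"
      using card_exceptional_scales[OF q, of d] sq_nonneg[of f] by (intro mult_right_mono) (auto simp: Iex_def)
    finally show "(\<Sum>n\<in>Iex. sq (M n f)) \<le> 4 * sq f" .
    show "sq (cesaro_max d b f) \<le> 25 * sq f" using d f by (intro sq_cesaro_max_le) auto
    show "(\<Sum>n\<in>Imid. sq (dif n)) \<le> 2000000 * sq f"
    proof (rule sum_sq_le_of_multipliers[OF fin(1) f(1) FSd])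
      fix n \<xi>
      have "FT d \<xi> (dif n) = FT d \<xi> (M n (lazy d f)) + of_real (- 1) * FT d \<xi> (cesaro d (dlevel q n) f)"
        unfolding dif_def using f
        by (simp only: FT_add[OF FSM[OF FS_lazy] FS_cmult[OF FS_cesaro]] FT_cmult[OF FS_cesaro])
      also have "FT d \<xi> (M n (lazy d f))
          = ball_mult d q (scale q n) \<xi> * of_real ((1 + mcos d \<xi>) / 2) * FT d \<xi> f"
        unfolding M_def ball_mult_def using f
        by (subst FT_avg[OF qball_lattice FS_lazy]) (auto simp: FT_lazy)
      also have "FT d \<xi> (cesaro d (dlevel q n) f) = of_real (cesaro_mult (dlevel q n) (mcos d \<xi>)) * FT d \<xi> f"
        unfolding cesaro_mult_def mcos_def by (rule FT_cesaro[OF f(1)])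
      finally show "FT d \<xi> (dif n) = mult_diff d q (scale q n) (dlevel q n) \<xi> * FT d \<xi> f"
        by (simp add: mult_diff_def left_diff_distrib)
    next
      fix \<xi>
      show "(\<Sum>n\<in>Imid. (cmod (mult_diff d q (scale q n) (dlevel q n) \<xi>))\<^sup>2) \<le> 2000000"
        by (rule mult_diff_square_sum[OF q fin(1) inj_on_subset[OF inj_dlevel[OF q] subset_UNIV]])
           (auto simp: Imid_def dlevel_bounds[OF q])
    qed
  qed auto
  finally show ?thesis by simp
qed

section \<open>General exponents\<close>

text \<open>The values of the maximal function on a finite set depend on finitely many values of \<open>g\<close> only, so no
  summability assumption on \<open>g\<close> is needed here.\<close>

lemma sum_ballmax_square_le:
  assumes q: "q \<ge> 1" and d: "d \<ge> 1" and g: "\<And>x. g x \<ge> 0"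
    and X: "finite X" "X \<subseteq> int_lattice d"
  shows "\<exists>Y. finite Y \<and> Y \<subseteq> int_lattice d
           \<and> (\<Sum>x\<in>X. (ballmax d q g x)\<^sup>2) \<le> 16000204 * (\<Sum>y\<in>Y. (g y)\<^sup>2)"
proof -
  define Y where "Y = (\<Union>n\<in>scales d q. (\<lambda>(x, y). x - y) ` (X \<times> qball {..<d} q (scale q n)))"
  have fin: "finite Y"
    unfolding Y_def using X finite_scales[OF q] finite_qball[OF _ q] by auto
  have lat: "Y \<subseteq> int_lattice d"
    using X(2) qball_lattice by (fastforce simp: Y_def int_lattice_def)
  define h where "h = (\<lambda>x. if x \<in> Y then g x else 0)"
  have h: "h \<in> FS d" "\<And>x. h x \<ge> 0"
  proof -
    have "{x. h x \<noteq> 0} \<subseteq> Y" by (auto simp: h_def)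
    then show "h \<in> FS d" using fin lat finite_subset by (auto simp: FS_def)
  qed (simp add: h_def g)
  have eq: "ballmax d q g x = ballmax d q h x" if x: "x \<in> X" for x
  proof -
    have "avg (qball {..<d} q (scale q n)) g x = avg (qball {..<d} q (scale q n)) h x"
      if n: "n \<in> scales d q" for n
      unfolding avg_def
    proof (intro arg_cong2[where f = "(/)"] sum.cong refl)
      fix y assume "y \<in> qball {..<d} q (scale q n)"
      then have "x - y \<in> Y" unfolding Y_def using x n by force
      then show "g (x - y) = h (x - y)" by (simp add: h_def)
    qed
    then show ?thesis unfolding ballmax_def by (intro arg_cong[where f = Max] image_cong) auto
  qed
  have "(\<Sum>x\<in>X. (ballmax d q g x)\<^sup>2) = (\<Sum>x\<in>X. (ballmax d q h x)\<^sup>2)"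
    by (simp add: eq)
  also have "\<dots> \<le> (\<Sum>x\<in>X \<union> {x. ballmax d q h x \<noteq> 0}. (ballmax d q h x)\<^sup>2)"
    using X FS_finite[OF FS_ballmax[OF q d h]] by (intro sum_mono2) auto
  also have "\<dots> = sq (ballmax d q h)"
    unfolding sq_def using X FS_finite[OF FS_ballmax[OF q d h]]
    by (intro Sum_any_FS[symmetric]) auto
  also have "\<dots> \<le> 16000204 * sq h" by (rule sq_ballmax_le[OF q d h])
  also have "sq h = (\<Sum>y\<in>Y. (h y)\<^sup>2)"
    unfolding sq_def using fin by (intro Sum_any_FS) (auto simp: h_def)
  also have "\<dots> = (\<Sum>y\<in>Y. (g y)\<^sup>2)" by (intro sum.cong) (auto simp: h_def)
  finally show ?thesis using fin lat by blast
qed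

lemma int_lattice_ball_eq: "int_lattice_ball d q t = qball {..<d} q (t powr q)"
  by (auto simp: int_lattice_ball_def qball_def lq_ball_def euclid_def int_lattice_def qcost_def
      intro: le_neq_implies_less)

lemma radii_eq:
  assumes "q \<ge> 1"
  shows "{t \<in> dyadic. t \<le> real d powr (1 / q)} = (\<lambda>n. 2 ^ n) ` scales d q"
proof -
  have "2 ^ n \<le> real d powr (1 / q) \<longleftrightarrow> n \<in> scales d q" for n :: nat
  proof -
    have 1: "(2 ^ n) powr q \<le> (real d powr (1 / q)) powr q \<longleftrightarrow> 2 ^ n \<le> real d powr (1 / q)"
      using assms powr_mono2[of q "2 ^ n" "real d powr (1 / q)"]
        powr_less_mono2[of q "real d powr (1 / q)" "2 ^ n"] by (auto simp: not_le[symmetric])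
    have 2: "(real d powr (1 / q)) powr q = real d"
      using assms by (simp add: powr_powr)
    show ?thesis using 1 unfolding 2 by (simp add: scales_def scale_def)
  qed
  then show ?thesis by (auto simp: dyadic_def)
qed

lemma hl_dyadic_max_attained:
  assumes "q \<ge> 1" "d \<ge> 1"
  shows "\<exists>n\<in>scales d q. hl_dyadic_max d q f x = cmod (hl_avg d q (2 ^ n) f x)"
proof -
  have fin: "finite ((\<lambda>n. cmod (hl_avg d q (2 ^ n) f x)) ` scales d q)"
    using finite_scales[OF assms(1)] by simp
  have ne: "(\<lambda>n. cmod (hl_avg d q (2 ^ n) f x)) ` scales d q \<noteq> {}"
    using scales_0[OF assms(2)] by auto
  have "hl_dyadic_max d q f x = Max ((\<lambda>n. cmod (hl_avg d q (2 ^ n) f x)) ` scales d q)"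
    unfolding hl_dyadic_max_def radii_eq[OF assms(1)] image_image
    by (rule cSup_eq_Max[OF fin ne])
  then have "hl_dyadic_max d q f x \<in> (\<lambda>n. cmod (hl_avg d q (2 ^ n) f x)) ` scales d q"
    using Max_in[OF fin ne] by simp
  then show ?thesis by auto
qed

lemma cmod_hl_avg_le:
  "cmod (hl_avg d q (2 ^ n) f x) \<le> avg (qball {..<d} q (scale q n)) (\<lambda>y. cmod (f y)) x"
  unfolding hl_avg_def avg_def int_lattice_ball_eq scale_def norm_divide norm_of_nat
  by (intro divide_right_mono norm_sum of_nat_0_le_iff)

lemma powr_average_le:
  fixes a :: "'a \<Rightarrow> real"
  assumes S: "finite S" and r: "r \<ge> 1" and a: "\<And>y. y \<in> S \<Longrightarrow> a y \<ge> 0"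
  shows "((\<Sum>y\<in>S. a y) / real (card S)) powr r \<le> (\<Sum>y\<in>S. a y powr r) / real (card S)"
proof -
  define T where "T = {y \<in> S. a y > 0}"
  have T: "finite T" "T \<subseteq> S" using S by (auto simp: T_def)
  have sums: "(\<Sum>y\<in>S. a y) = (\<Sum>y\<in>T. a y)" "(\<Sum>y\<in>S. a y powr r) = (\<Sum>y\<in>T. a y powr r)"
    using S a by (auto intro!: sum.mono_neutral_right simp: T_def less_le)
  show ?thesis
  proof (cases "T = {}")
    case False
    define m where "m = real (card T)"
    define n where "n = real (card S)"
    have m: "m > 0" using T False by (simp add: m_def card_gt_0_iff)
    have mn: "m \<le> n" using card_mono[OF S T(2)] by (simp add: m_def n_def)
    have "(\<Sum>y\<in>T. (1 / m) *\<^sub>R a y) powr r \<le> (\<Sum>y\<in>T. (1 / m) * a y powr r)"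
      by (rule convex_on_sum[OF T(1) False powr_convex[OF r]]) (use m in \<open>auto simp: m_def T_def\<close>)
    then have jensen: "((\<Sum>y\<in>T. a y) / m) powr r \<le> (\<Sum>y\<in>T. a y powr r) / m"
      by (simp add: sum_divide_distrib)
    have pos: "(\<Sum>y\<in>T. a y) \<ge> 0" by (intro sum_nonneg) (auto simp: T_def)
    have "((\<Sum>y\<in>T. a y) / n) powr r = ((m / n) * ((\<Sum>y\<in>T. a y) / m)) powr r"
      using m by simp
    also have "\<dots> = (m / n) powr r * ((\<Sum>y\<in>T. a y) / m) powr r"
      by (rule powr_mult)
    also have "\<dots> \<le> (m / n) * ((\<Sum>y\<in>T. a y powr r) / m)"
    proof (rule mult_mono)
      have "(m / n) powr r \<le> (m / n) powr 1" using m mn r by (intro powr_mono') auto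
      then show "(m / n) powr r \<le> m / n" using m mn by simp
    qed (use jensen m mn in auto)
    also have "\<dots> = (\<Sum>y\<in>T. a y powr r) / n" using m by simp
    finally show ?thesis by (simp add: sums n_def)
  qed (simp add: sums)
qed

lemma hl_dyadic_max_powr_le:
  assumes q: "q \<ge> 1" and d: "d \<ge> 1" and p: "p \<ge> 2"
  shows "hl_dyadic_max d q f x powr p \<le> (ballmax d q (\<lambda>y. cmod (f y) powr (p / 2)) x)\<^sup>2"
proof -
  obtain n where n: "n \<in> scales d q" "hl_dyadic_max d q f x = cmod (hl_avg d q (2 ^ n) f x)"
    using hl_dyadic_max_attained[OF q d] by blast
  define V where "V = qball {..<d} q (scale q n)"
  have V: "finite V" unfolding V_def using q by (simp add: finite_qball)
  have "hl_dyadic_max d q f x powr (p / 2) \<le> avg V (\<lambda>y. cmod (f y)) x powr (p / 2)"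
    unfolding n(2) V_def using cmod_hl_avg_le p by (intro powr_mono2) auto
  also have "\<dots> \<le> avg V (\<lambda>y. cmod (f y) powr (p / 2)) x"
    unfolding avg_def using p by (intro powr_average_le V) auto
  also have "\<dots> \<le> ballmax d q (\<lambda>y. cmod (f y) powr (p / 2)) x"
    unfolding V_def by (rule avg_le_ballmax[OF q n(1)])
  finally have "(hl_dyadic_max d q f x powr (p / 2))\<^sup>2 \<le> (ballmax d q (\<lambda>y. cmod (f y) powr (p / 2)) x)\<^sup>2"
    by (intro power_mono) auto
  moreover have "(hl_dyadic_max d q f x powr (p / 2))\<^sup>2 = hl_dyadic_max d q f x powr p"
    unfolding power2_eq_square powr_add[symmetric] by simp
  ultimately show ?thesis by simp
qed

lemma hl_dyadic_max_nonneg: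
  assumes "q \<ge> 1" "d \<ge> 1"
  shows "hl_dyadic_max d q f x \<ge> 0"
  using hl_dyadic_max_attained[OF assms, of f x] by auto

lemma hl_dyadic_max_inf:
  assumes q: "q \<ge> 1" and d: "d \<ge> 1" and f: "f \<in> lp_space \<infinity> (int_lattice d)"
  shows "hl_dyadic_max d q f \<in> lp_space \<infinity> (int_lattice d)"
    and "lp_norm \<infinity> (int_lattice d) (hl_dyadic_max d q f) \<le> lp_norm \<infinity> (int_lattice d) f"
proof -
  have bdd: "bdd_above ((\<lambda>x. cmod (f x)) ` int_lattice d)" using f by (simp add: lp_space_def)
  define S where "S = (SUP x\<in>int_lattice d. cmod (f x))"
  have le: "norm (hl_dyadic_max d q f x) \<le> S" if x: "x \<in> int_lattice d" for x
  proof -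
    obtain n where n: "hl_dyadic_max d q f x = cmod (hl_avg d q (2 ^ n) f x)"
      using hl_dyadic_max_attained[OF q d] by blast
    define V where "V = qball {..<d} q (scale q n)"
    have V: "card V > 0" unfolding V_def using q scale_pos[of q n] by (intro card_qball_pos) auto
    have "hl_dyadic_max d q f x \<le> avg V (\<lambda>y. cmod (f y)) x"
      unfolding n V_def by (rule cmod_hl_avg_le)
    also have "\<dots> \<le> (\<Sum>y\<in>V. S) / real (card V)"
      unfolding avg_def
    proof (intro divide_right_mono sum_mono)
      fix y assume "y \<in> V"
      then have "y \<in> int_lattice d" unfolding V_def using qball_lattice by blast
      then have "x - y \<in> int_lattice d" using x by (simp add: int_lattice_def)
      then show "cmod (f (x - y)) \<le> S" unfolding S_def by (intro cSUP_upper bdd)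
    qed simp
    also have "\<dots> = S" using V by simp
    finally show ?thesis using hl_dyadic_max_nonneg[OF q d, of f x] by simp
  qed
  then show "hl_dyadic_max d q f \<in> lp_space \<infinity> (int_lattice d)"
    by (auto simp: lp_space_def intro!: bdd_aboveI2)
  have "int_lattice d \<noteq> {}" by (auto simp: int_lattice_def)
  then show "lp_norm \<infinity> (int_lattice d) (hl_dyadic_max d q f) \<le> lp_norm \<infinity> (int_lattice d) f"
    unfolding lp_norm_def S_def[symmetric] using le by (auto intro!: cSUP_least)
qed

lemma hl_dyadic_max_finite:
  fixes p :: real
  assumes q: "q \<ge> 1" and d: "d \<ge> 1" and p: "p \<ge> 2" and f: "f \<in> lp_space (ereal p) (int_lattice d)"
  shows "hl_dyadic_max d q f \<in> lp_space (ereal p) (int_lattice d)"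
    and "lp_norm (ereal p) (int_lattice d) (hl_dyadic_max d q f)
           \<le> 16000204 * lp_norm (ereal p) (int_lattice d) f"
proof -
  define A where "A = int_lattice d"
  define F where "F = (\<lambda>x. cmod (f x) powr p)"
  define G where "G = (\<lambda>x. norm (hl_dyadic_max d q f x) powr p)"
  define S where "S = infsum F A"
  have F: "F summable_on A" using f by (simp add: lp_space_def F_def A_def)
  have S: "S \<ge> 0" unfolding S_def by (rule infsum_nonneg) (simp add: F_def)
  have bound: "sum G X \<le> 16000204 * S" if X: "finite X" "X \<subseteq> A" for X
  proof -
    define g where "g = (\<lambda>y. cmod (f y) powr (p / 2))"
    have g2: "(g y)\<^sup>2 = F y" for y
      unfolding g_def F_def power2_eq_square powr_add[symmetric] by simp
    obtain Y where Y: "finite Y" "Y \<subseteq> A"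
      "(\<Sum>x\<in>X. (ballmax d q g x)\<^sup>2) \<le> 16000204 * (\<Sum>y\<in>Y. (g y)\<^sup>2)"
      using sum_ballmax_square_le[OF q d _ X(1) X(2)[unfolded A_def], of g] unfolding A_def
      by (auto simp: g_def)
    have "sum G X \<le> (\<Sum>x\<in>X. (ballmax d q g x)\<^sup>2)"
      unfolding G_def g_def using hl_dyadic_max_nonneg[OF q d]
      by (intro sum_mono) (simp add: hl_dyadic_max_powr_le[OF q d p])
    also have "\<dots> \<le> 16000204 * (\<Sum>y\<in>Y. F y)" using Y(3) by (simp add: g2)
    also have "(\<Sum>y\<in>Y. F y) \<le> S"
      unfolding S_def by (rule finite_sum_le_infsum[OF F Y(1,2)]) (simp add: F_def)
    finally show ?thesis by simp
  qed
  have Gs: "G summable_on A"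
  proof (rule nonneg_bdd_above_summable_on)
    show "bdd_above (sum G ` {X. X \<subseteq> A \<and> finite X})"
      using bound by (intro bdd_aboveI2[where M = "16000204 * S"]) auto
  qed (simp add: G_def)
  then show "hl_dyadic_max d q f \<in> lp_space (ereal p) (int_lattice d)"
    by (simp add: lp_space_def G_def A_def)
  have "infsum G A \<le> 16000204 * S"
    using bound by (intro infsum_le_finite_sums Gs)
  then have "infsum G A powr (1 / p) \<le> (16000204 * S) powr (1 / p)"
    using p by (intro powr_mono2 infsum_nonneg) (auto simp: G_def)
  also have "\<dots> = 16000204 powr (1 / p) * S powr (1 / p)" using S by (simp add: powr_mult)
  also have "\<dots> \<le> 16000204 powr 1 * S powr (1 / p)"
    using p by (intro mult_right_mono powr_mono) auto
  finally show "lp_norm (ereal p) (int_lattice d) (hl_dyadic_max d q f)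
           \<le> 16000204 * lp_norm (ereal p) (int_lattice d) f"
    by (simp add: lp_norm_def G_def F_def A_def S_def)
qed

theorem theorem1p1:
  "\<exists>C::real. C > 0 \<and>
     (\<forall>(q::real) (p::ereal) (d::nat) (f :: (nat \<Rightarrow> int) \<Rightarrow> complex).
        q \<ge> 1 \<longrightarrow> p \<ge> 2 \<longrightarrow> d \<ge> 1 \<longrightarrow> f \<in> lp_space p (int_lattice d) \<longrightarrow>
        hl_dyadic_max d q f \<in> lp_space p (int_lattice d) \<and>
        lp_norm p (int_lattice d) (hl_dyadic_max d q f) \<le> C * lp_norm p (int_lattice d) f)"
proof (intro exI[of _ 16000204] conjI allI impI)
  fix q :: real and p :: ereal and d :: nat and f :: "(nat \<Rightarrow> int) \<Rightarrow> complex"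
  assume q: "q \<ge> 1" and p: "p \<ge> 2" and d: "d \<ge> 1" and f: "f \<in> lp_space p (int_lattice d)"
  consider r where "p = ereal r" "r \<ge> 2" | "p = \<infinity>" using p by (cases p) auto
  then have "hl_dyadic_max d q f \<in> lp_space p (int_lattice d) \<and>
    lp_norm p (int_lattice d) (hl_dyadic_max d q f) \<le> 16000204 * lp_norm p (int_lattice d) f"
  proof cases
    case 1
    then show ?thesis using hl_dyadic_max_finite[OF q d, of r f] f by simp
  next
    case 2
    have "lp_norm \<infinity> (int_lattice d) f \<ge> 0"
    proof -
      have "0 \<le> cmod (f (\<lambda>_. 0))" by simp
      also have "\<dots> \<le> lp_norm \<infinity> (int_lattice d) f"
        unfolding lp_norm_def using f 2
        by (auto intro!: cSUP_upper simp: lp_space_def int_lattice_def)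
      finally show ?thesis .
    qed
    then show ?thesis using hl_dyadic_max_inf[OF q d, of f] f 2 by force
  qed
  then show "hl_dyadic_max d q f \<in> lp_space p (int_lattice d)"
    "lp_norm p (int_lattice d) (hl_dyadic_max d q f) \<le> 16000204 * lp_norm p (int_lattice d) f"
    by auto
qed simp

end
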